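(* Let $K\subset\mathscr X$ be such that, as $\Theta=[\xi,\beta]$ ranges over $K$, the measures $\beta$ form a uniformly tight family in $\mathcal M_1(X)$ (weak topology). Then every sequence in $K$ has a subsequence that converges in the metric space $(\mathscr X,\mathscr D)$.
   Context: $X$ is a complete separable metric space, $d\ge1$; $\mathcal M_1(\cdot)$, $\mathcal M_{\le1}(\cdot)$ denote probability and sub-probability measures. For $\lambda\in\mathcal M_{\le1}(X\otimes\mathbb R^d)$ and $a\in\mathbb R^d$ let $(\lambda\star\delta_a)(\mathrm dx\,\mathrm dy)=\lambda(\mathrm dx\,\mathrm d(y+a))$; the orbit of $\lambda$ is $\widetilde\lambda=\{\lambda\star\delta_a:a\in\mathbb R^d\}$, and $\widetilde\lambda^{(1)}$ denotes the common marginal on $X$ of its members. Let $\mathscr X=\{\Theta=[\xi,\beta]\}$ where $\beta\in\mathcal M_1(X)$ and $\xi$ is an empty, finite or countable collection of orbits $\widetilde\lambda$ of measures $\lambda\in\mathcal M_{\le1}(X\otimes\mathbb R^d)$ with $\sum_{\widetilde\lambda\in\xi}\widetilde\lambda^{(1)}(\cdot)\le\beta(\cdot)$. Metric: fix a countable family $\{f_j\}$ of continuous functions on $X$ bounded by $1$ that determines weak convergence on $\mathcal M_1(X)$, and set $\mathrm d(\beta_1,\beta_2)=\sum_j2^{-j}|\int f_j\,\mathrm d\beta_1-\int f_j\,\mathrm d\beta_2|$. For $k\ge2$ let $\mathfrak C_k$ be the continuous functions $W$ on $(\mathbb R^d)^k$ invariant under simultaneous translation of all arguments and tending to $0$ as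 $\sup_{i,j}|y_i-y_j|\to\infty$, and fix a countable family $\mathcal W_k\subset\mathfrak C_k$ of functions bounded by $1$ with dense linear span (uniform norm). Enumerate all pairs $(f_j,W)$, $W\in\bigcup_{k\ge2}\mathcal W_k$, as a single sequence $(f_r,W_r)$, with $W_r$ a function of $k(r)$ variables. For a collection $\xi$ of orbits put $\Lambda_{f,W}(\xi)=\sum_{\widetilde\lambda\in\xi}\int\prod_{i=1}^{k}f(x_i)\,W(y_1,\dots,y_k)\prod_{i=1}^k\lambda(\mathrm dx_i,\mathrm dy_i)$ (independent of the representative $\lambda$ of $\widetilde\lambda$), $\mathbf D^\star(\xi_1,\xi_2)=\sum_r2^{-r}|\Lambda_{f_r,W_r}(\xi_1)-\Lambda_{f_r,W_r}(\xi_2)|$, and $\mathscr D([\xi_1,\beta_1],[\xi_2,\beta_2])=\mathbf D^\star(\xi_1,\xi_2)+\mathrm d(\beta_1,\beta_2)$, which is a metric on $\mathscr X$. *)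

theory Defs
  imports "HOL-Probability.Probability"
begin

text \<open>Translation of a measure on X x R^d in the R^d coordinate:
  (lambda * delta_a)(dx dy) = lambda(dx d(y+a)), i.e. the image of lambda under (x,y) |-> (x, y - a).\<close>
definition shift_meas :: "('a::topological_space \<times> 'b::real_normed_vector) measure \<Rightarrow> 'b \<Rightarrow> ('a \<times> 'b) measure" where
  "shift_meas \<mu> a = distr \<mu> borel (\<lambda>(x, y). (x, y - a))"

definition orbit :: "('a::topological_space \<times> 'b::real_normed_vector) measure \<Rightarrow> ('a \<times> 'b) measure set" where
  "orbit \<mu> = range (shift_meas \<mu>)"

text \<open>A representative of an orbit (all quantities used below do not depend on the choice).\<close>
definition rep :: "'c measure set \<Rightarrow> 'c measure" where
  "rep Orb = (SOME \<mu>. \<mu> \<in> Orb)"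

text \<open>The space script-X. A collection xi of orbits (with multiplicities, possibly finite or empty)
  is encoded as a nat-indexed family of orbits, padded with orbits of the null measure.\<close>
definition Xspace :: "((nat \<Rightarrow> ('a::topological_space \<times> 'b::real_normed_vector) measure set) \<times> 'a measure) set" where
  "Xspace = {(\<xi>, \<beta>). prob_space \<beta> \<and> sets \<beta> = sets (borel :: 'a measure) \<and>
      (\<forall>i. \<exists>\<mu>. subprob_space \<mu> \<and> sets \<mu> = sets (borel :: ('a \<times> 'b) measure) \<and> \<xi> i = orbit \<mu>) \<and>
      (\<forall>A \<in> sets (borel :: 'a measure). (\<Sum>i. emeasure (rep (\<xi> i)) (A \<times> UNIV)) \<le> emeasure \<beta> A)}"

text \<open>The class C_k of continuous translation invariant functions on (R^d)^k vanishing at infinity.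
  (R^d)^k is represented as the extensional functions PiE {..<k} (\<lambda>_. UNIV).\<close>
definition Ck :: "nat \<Rightarrow> ((nat \<Rightarrow> 'b::real_normed_vector) \<Rightarrow> real) set" where
  "Ck k = {W. continuous_on (PiE {..<k} (\<lambda>_. UNIV)) W \<and>
      (\<forall>y \<in> PiE {..<k} (\<lambda>_. UNIV). \<forall>a. W (\<lambda>i\<in>{..<k}. y i + a) = W y) \<and>
      (\<forall>\<epsilon>>0. \<exists>R. \<forall>y \<in> PiE {..<k} (\<lambda>_. UNIV).
          (\<exists>i<k. \<exists>j<k. norm (y i - y j) > R) \<longrightarrow> \<bar>W y\<bar> < \<epsilon>)}"

definition weak_conv :: "(nat \<Rightarrow> 'a::topological_space measure) \<Rightarrow> 'a measure \<Rightarrow> bool" where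
  "weak_conv \<beta>s \<beta> \<longleftrightarrow> (\<forall>g :: 'a \<Rightarrow> real. continuous_on UNIV g \<and> bounded (range g) \<longrightarrow>
      (\<lambda>n. integral\<^sup>L (\<beta>s n) g) \<longlonglongrightarrow> integral\<^sup>L \<beta> g)"

definition admissible_f :: "(nat \<Rightarrow> 'a::topological_space \<Rightarrow> real) \<Rightarrow> bool" where
  "admissible_f fs \<longleftrightarrow> (\<forall>j. continuous_on UNIV (fs j) \<and> (\<forall>x. \<bar>fs j x\<bar> \<le> 1)) \<and>
     (\<forall>\<beta>s \<beta>. (\<forall>n. prob_space (\<beta>s n) \<and> sets (\<beta>s n) = sets (borel :: 'a measure)) \<and>
               prob_space \<beta> \<and> sets \<beta> = sets (borel :: 'a measure) \<longrightarrow>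
        (weak_conv \<beta>s \<beta> \<longleftrightarrow> (\<forall>j. (\<lambda>n. integral\<^sup>L (\<beta>s n) (fs j)) \<longlonglongrightarrow> integral\<^sup>L \<beta> (fs j))))"

definition admissible_W :: "(nat \<Rightarrow> ((nat \<Rightarrow> 'b::real_normed_vector) \<Rightarrow> real) set) \<Rightarrow> bool" where
  "admissible_W Wk \<longleftrightarrow> (\<forall>k\<ge>2. countable (Wk k) \<and> Wk k \<subseteq> Ck k \<and>
      (\<forall>w \<in> Wk k. \<forall>y \<in> PiE {..<k} (\<lambda>_. UNIV). \<bar>w y\<bar> \<le> 1) \<and>
      (\<forall>W \<in> Ck k. \<forall>\<epsilon>>0. \<exists>S c. finite S \<and> S \<subseteq> Wk k \<and>
          (\<forall>y \<in> PiE {..<k} (\<lambda>_. UNIV). \<bar>W y - (\<Sum>w\<in>S. c w * w y)\<bar> \<le> \<epsilon>)))"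

definition Lam :: "(nat \<Rightarrow> 'a \<Rightarrow> real) \<Rightarrow> (nat \<Rightarrow> nat \<times> nat \<times> ((nat \<Rightarrow> 'b) \<Rightarrow> real)) \<Rightarrow> nat
     \<Rightarrow> (nat \<Rightarrow> ('a \<times> 'b) measure set) \<Rightarrow> real" where
  "Lam fs e r \<xi> = (case e r of (j, k, W) \<Rightarrow>
     (\<Sum>i. integral\<^sup>L (PiM {..<k} (\<lambda>_. rep (\<xi> i)))
            (\<lambda>z. (\<Prod>l<k. fs j (fst (z l))) * W (\<lambda>l\<in>{..<k}. snd (z l)))))"

definition dist_beta :: "(nat \<Rightarrow> 'a \<Rightarrow> real) \<Rightarrow> 'a measure \<Rightarrow> 'a measure \<Rightarrow> real" where
  "dist_beta fs \<beta>1 \<beta>2 = (\<Sum>j. (1/2) ^ Suc j * \<bar>integral\<^sup>L \<beta>1 (fs j) - integral\<^sup>L \<beta>2 (fs j)\<bar>)"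

definition Dstar :: "(nat \<Rightarrow> 'a \<Rightarrow> real) \<Rightarrow> (nat \<Rightarrow> nat \<times> nat \<times> ((nat \<Rightarrow> 'b) \<Rightarrow> real))
     \<Rightarrow> (nat \<Rightarrow> ('a \<times> 'b) measure set) \<Rightarrow> (nat \<Rightarrow> ('a \<times> 'b) measure set) \<Rightarrow> real" where
  "Dstar fs e \<xi>1 \<xi>2 = (\<Sum>r. (1/2) ^ Suc r * \<bar>Lam fs e r \<xi>1 - Lam fs e r \<xi>2\<bar>)"

definition Dmet :: "(nat \<Rightarrow> 'a \<Rightarrow> real) \<Rightarrow> (nat \<Rightarrow> nat \<times> nat \<times> ((nat \<Rightarrow> 'b) \<Rightarrow> real))
     \<Rightarrow> (nat \<Rightarrow> ('a \<times> 'b) measure set) \<times> 'a measure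
     \<Rightarrow> (nat \<Rightarrow> ('a \<times> 'b) measure set) \<times> 'a measure \<Rightarrow> real" where
  "Dmet fs e \<Theta>1 \<Theta>2 = Dstar fs e (fst \<Theta>1) (fst \<Theta>2) + dist_beta fs (snd \<Theta>1) (snd \<Theta>2)"

definition uniformly_tight :: "'a::topological_space measure set \<Rightarrow> bool" where
  "uniformly_tight B \<longleftrightarrow> (\<forall>\<epsilon>>0. \<exists>C. compact C \<and> (\<forall>\<beta>\<in>B. measure \<beta> (space \<beta> - C) \<le> \<epsilon>))"

end

(* Each Theta_n is a countable family of sub-probability measures on X x R^d. For every m, a maximal
   family of disjoint balls of radius m+1 and mass above 1/(m+1) provides at most m+1 centres, and
   every ball that heavy lies within 2(m+1) of one of them. Along a subsequence, beta_n converges,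
   the measures recentred at each of these countably many centres converge (mass may escape to
   infinity in R^d, but not in X, by tightness), and any two centres either stay in the same
   component at bounded distance or drift apart. One limit measure per class of centres that stay
   together gives the limit collection of orbits: close centres have limits in the same orbit, and
   the limits of distinct classes collect disjoint parts of the mass. Since the test functions have
   at least two variables and decay in the mutual distances, the part of Lambda in which the first
   variable is far from all centres found at level m is small uniformly in n. *)

theory Submission
  imports Defs "HOL-Library.Diagonal_Subsequence"
begin

section \<open>Almost sure representation of tight sequences\<close>

text \<open>Lambda is not linear in the measures, so limits are required for all k-fold products at
  once. They are read off a coupling: variables that converge almost surely on one probability space
  give every k-fold integral in the limit, by dominated convergence on the powers of that space. The
  coupling is imported from the real line: a Borel code maps the points of countably many compact
  sets to reals so that convergence of codes forces convergence of points; Helly selection and the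
  Skorohod representation act on the coded laws, and decoding is continuous on a closed set that
  carries them. The second obstacle is that a translation invariant test function does not decay
  when all its arguments move away together. A cut-off in the first variable alone restores decay,
  since the other variables must stay near the first. Radius m+1 and threshold 1/(m+1) share one
  index, because a large radius (test function small beyond it) and a small threshold (little mass
  within it) are wanted simultaneously. The order of choices is: level m, a finite set of centre
  classes, the cut-off radius, and last n.\<close>

definition ternary :: "(nat \<Rightarrow> bool) \<Rightarrow> real" where
  "ternary a = (\<Sum>j. of_bool (a j) * (1/3) ^ Suc j)"

lemma ternary_summable: "summable (\<lambda>j. of_bool (a j) * (1/3::real) ^ Suc j)"
proof (rule summable_comparison_test')
  show "summable (\<lambda>j. (1/3::real) ^ Suc j)"
    by (simp add: summable_mult)
qed auto

lemma ternary_bounds: "0 \<le> ternary a" "ternary a \<le> 1/2"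
proof -
  show "0 \<le> ternary a"
    unfolding ternary_def by (rule suminf_nonneg[OF ternary_summable]) auto
  have s: "(\<lambda>j. (1/3::real) ^ Suc j) sums (1/2)"
    using sums_mult[OF geometric_sums[of "1/3::real"], of "1/3"] by simp
  have "ternary a \<le> (\<Sum>j. (1/3::real) ^ Suc j)"
    unfolding ternary_def
    by (rule suminf_le[OF _ ternary_summable sums_summable[OF s]]) auto
  then show "ternary a \<le> 1/2"
    using sums_unique[OF s] by simp
qed

lemma ternary_split:
  "ternary a = (\<Sum>i<n. of_bool (a i) * (1/3) ^ Suc i) + (1/3)^n * ternary (\<lambda>i. a (i + n))"
proof -
  have "(\<Sum>i. of_bool (a (i + n)) * (1/3) ^ Suc (i + n)) = (1/3::real)^n * ternary (\<lambda>i. a (i + n))"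
    unfolding ternary_def
    by (subst suminf_mult[symmetric, OF ternary_summable]) (simp add: power_add mult_ac)
  then show ?thesis
    using suminf_split_initial_segment[OF ternary_summable, of a n] by (simp add: ternary_def)
qed

text \<open>The first differing digit moves the value by a full unit 3^-(n+1), while all later
  digits together move it by at most half of that unit. Base 3 with digits 0 and 1 leaves this gap;
  in base 2 the later digits could close it.\<close>

lemma ternary_separated:
  assumes "\<And>i. i < n \<Longrightarrow> a i = b i" and "a n \<noteq> b n"
  shows "(1/3) ^ Suc n / 2 \<le> \<bar>ternary a - ternary b\<bar>"
proof -
  let ?ra = "ternary (\<lambda>i. a (i + Suc n))" and ?rb = "ternary (\<lambda>i. b (i + Suc n))"
  have eq: "(\<Sum>i<n. of_bool (a i) * (1/3::real) ^ Suc i) = (\<Sum>i<n. of_bool (b i) * (1/3) ^ Suc i)"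
    using assms by (intro sum.cong) auto
  let ?d = "of_bool (a n) - of_bool (b n) + (?ra - ?rb)"
  have "ternary a - ternary b = (1/3) ^ Suc n * ?d"
    unfolding ternary_split[of a "Suc n"] ternary_split[of b "Suc n"] sum.lessThan_Suc eq
    by (simp add: algebra_simps)
  then have diff: "\<bar>ternary a - ternary b\<bar> = (1/3) ^ Suc n * \<bar>?d\<bar>"
    by (simp only: abs_mult) simp
  have "1/2 \<le> \<bar>?d\<bar>"
    using assms(2) ternary_bounds[of "\<lambda>i. a (i + Suc n)"] ternary_bounds[of "\<lambda>i. b (i + Suc n)"]
    by (cases "a n"; cases "b n") auto
  then have "(1/3::real) ^ Suc n * (1/2) \<le> (1/3) ^ Suc n * \<bar>?d\<bar>"
    by (intro mult_left_mono) auto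
  then show ?thesis
    unfolding diff by (simp only: times_divide_eq_right mult_1_right)
qed

text \<open>If digit j of two members differs, their first differing digit is at or before j, which
  keeps the values apart by an amount that depends on j only.\<close>

lemma ternary_Cauchy_digits:
  assumes "Cauchy (\<lambda>n. ternary (a n))"
  shows "\<exists>N. \<forall>n\<ge>N. \<forall>m\<ge>N. a n j = a m j"
proof -
  have "(1/3::real) ^ Suc j / 2 > 0" by simp
  from CauchyD[OF assms this] obtain N where
    N: "\<And>m n. m \<ge> N \<Longrightarrow> n \<ge> N \<Longrightarrow> \<bar>ternary (a m) - ternary (a n)\<bar> < (1/3) ^ Suc j / 2"
    by auto
  have "a n j = a m j" if "n \<ge> N" "m \<ge> N" for n m
  proof (rule ccontr)
    assume neq: "a n j \<noteq> a m j"
    define i where "i = (LEAST i. a n i \<noteq> a m i)"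
    have i: "a n i \<noteq> a m i" "i \<le> j"
      unfolding i_def by (rule LeastI[of "\<lambda>i. a n i \<noteq> a m i", OF neq])
        (rule Least_le[of "\<lambda>i. a n i \<noteq> a m i", OF neq])
    have eq: "a n i' = a m i'" if "i' < i" for i'
      using not_less_Least[of i' "\<lambda>i. a n i \<noteq> a m i"] that by (simp add: i_def)
    have "(1/3::real) ^ Suc j / 2 \<le> (1/3) ^ Suc i / 2"
      using power_decreasing[of "Suc i" "Suc j" "1/3::real"] i(2) by simp
    also have "\<dots> \<le> \<bar>ternary (a n) - ternary (a m)\<bar>"
      using i(1) eq by (intro ternary_separated) auto
    finally show False
      using N[OF that] by linarith
  qed
  then show ?thesis by blast
qed

lemma ternary_measurable:
  assumes "\<And>j. Measurable.pred M (\<lambda>x. a x j)"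
  shows "(\<lambda>x. ternary (a x)) \<in> borel_measurable M"
proof -
  have "(\<lambda>x. of_bool (a x j) * (1/3) ^ Suc j :: real) \<in> borel_measurable M" for j
  proof -
    have "(\<lambda>x. of_bool (a x j) :: real) \<in> borel_measurable M"
      by (rule measurable_compose[OF assms]) simp
    then show ?thesis by (rule borel_measurable_times) simp
  qed
  then show ?thesis
    unfolding ternary_def by (rule borel_measurable_suminf)
qed

text \<open>The code of a point records, besides the least compact set containing it, to which sets
  of a countable base it belongs. The code is discontinuous but its inverse is continuous on each
  of the compact sets, which transfers compactness questions to laws on the real line.\<close>

definition code :: "(nat \<Rightarrow> 'c set) \<Rightarrow> (nat \<Rightarrow> 'c set) \<Rightarrow> 'c \<Rightarrow> real" where
  "code C U x = real (LEAST m. x \<in> C m) + ternary (\<lambda>j. x \<in> U j)"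

text \<open>Fractional parts in [0, 1/2] differ by at most 1/2, so sums less than 1/2 apart have
  integer parts less than 1 apart.\<close>

lemma Cauchy_eventually_constant_nat:
  fixes m :: "nat \<Rightarrow> nat" and t :: "nat \<Rightarrow> real"
  assumes "Cauchy (\<lambda>n. real (m n) + t n)" and "\<And>n. 0 \<le> t n" "\<And>n. t n \<le> 1/2"
  shows "\<exists>N. \<forall>n\<ge>N. m n = m N"
proof -
  from CauchyD[OF assms(1), of "1/2"] obtain N where
    N: "\<And>i n. i \<ge> N \<Longrightarrow> n \<ge> N \<Longrightarrow> \<bar>(real (m i) + t i) - (real (m n) + t n)\<bar> < 1/2"
    by auto
  have "m n = m N" if "n \<ge> N" for n
  proof -
    have "\<bar>real (m n) - real (m N)\<bar> < 1"
      using N[OF that order_refl] assms(2,3)[of n] assms(2,3)[of N] by linarith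
    then show ?thesis by linarith
  qed
  then show ?thesis by blast
qed

text \<open>A convergent code has an eventually constant integer part, which confines the tail to
  one compact set, and eventually constant digits. Two cluster points are then impossible: a base
  set around one of them contains either almost all or almost none of the points.\<close>

lemma code_convergent_imp_convergent:
  fixes x :: "nat \<Rightarrow> 'c::metric_space"
  assumes C: "\<And>m. compact (C m)" and U: "topological_basis (range U)"
    and x: "\<And>n. x n \<in> (\<Union>m. C m)" and conv: "convergent (\<lambda>n. code C U (x n))"
  shows "convergent x"
proof -
  define m where "m n = (LEAST k. x n \<in> C k)" for n
  define a where "a n = (\<lambda>j. x n \<in> U j)" for n
  have code: "code C U (x n) = real (m n) + ternary (a n)" for n
    by (simp add: code_def m_def a_def)
  have xm: "x n \<in> C (m n)" for n
    unfolding m_def using x[of n] by (auto intro: LeastI)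
  have "Cauchy (\<lambda>n. real (m n) + ternary (a n))"
    using convergent_Cauchy[OF conv] by (simp add: code)
  then obtain N where N: "\<And>n. n \<ge> N \<Longrightarrow> m n = m N"
    using Cauchy_eventually_constant_nat[of m "\<lambda>n. ternary (a n)"] ternary_bounds by blast
  define y where "y n = x (n + N)" for n
  have yC: "y n \<in> C (m N)" for n
    using xm[of "n + N"] N[of "n + N"] by (simp add: y_def)
  have "convergent (\<lambda>n. code C U (x (n + N)) - real (m N))"
    using convergent_ignore_initial_segment[of "\<lambda>n. code C U (x n)" N] conv
    by (intro convergent_diff convergent_const) auto
  moreover have "code C U (x (n + N)) - real (m N) = ternary (a (n + N))" for n
    unfolding code using N[of "n + N"] by simp
  ultimately have "Cauchy (\<lambda>n. ternary (a (n + N)))"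
    by (simp add: convergent_Cauchy)
  then have dig: "\<exists>K. \<forall>n\<ge>K. \<forall>k\<ge>K. (y n \<in> U j) = (y k \<in> U j)" for j
    using ternary_Cauchy_digits[of "\<lambda>n. a (n + N)" j] by (simp add: a_def y_def)
  from C[of "m N"] yC obtain l r where l: "l \<in> C (m N)" "strict_mono r" "(y \<circ> r) \<longlonglongrightarrow> l"
    unfolding compact_def by blast
  have "y \<longlonglongrightarrow> l"
  proof (rule ccontr)
    assume "\<not> y \<longlonglongrightarrow> l"
    then obtain e where e: "e > 0" "\<exists>\<^sub>F n in sequentially. \<not> dist (y n) l < e"
      by (auto simp: tendsto_iff frequently_def)
    obtain s :: "nat \<Rightarrow> nat" where s: "strict_mono s" "\<And>n. \<not> dist (y (s n)) l < e"
    proof -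
      let ?S = "{n. \<not> dist (y n) l < e}"
      have "infinite ?S"
        using e(2) by (simp add: frequently_cofinite cofinite_eq_sequentially[symmetric])
      then show ?thesis
        using that[of "enumerate ?S"] strict_mono_enumerate enumerate_in_set by blast
    qed
    from C[of "m N"] yC obtain l' r' where l': "l' \<in> C (m N)" "strict_mono r'" "(y \<circ> s \<circ> r') \<longlonglongrightarrow> l'"
      using C[of "m N", unfolded compact_def, rule_format, of "y \<circ> s"] by auto
    have "(\<lambda>n. dist (y (s (r' n))) l) \<longlonglongrightarrow> dist l' l"
      using tendsto_dist[OF l'(3) tendsto_const[of l]] by (simp add: comp_def)
    then have ge: "e \<le> dist l' l"
      by (rule Lim_bounded2[where N=0]) (use s(2) in \<open>auto simp: not_less\<close>)
    \<comment> \<open>This base set is visited along \<open>r\<close>, which tends to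
      \<open>l\<close>, hence by the digits from some index on; but the points along
      \<open>s\<close> stay at distance at least \<open>e\<close> from \<open>l\<close>.\<close>
    obtain j where j: "l \<in> U j" "U j \<subseteq> ball l (e/2)"
      using topological_basisE[OF U, of "ball l (e/2)" l] e(1) by force
    have "open (U j)" using U by (auto simp: topological_basis_open)
    obtain K where K: "\<And>n k. n \<ge> K \<Longrightarrow> k \<ge> K \<Longrightarrow> (y n \<in> U j) = (y k \<in> U j)"
      using dig[of j] by blast
    have "\<forall>\<^sub>F n in sequentially. y (r n) \<in> U j"
      using topological_tendstoD[OF l(3) \<open>open (U j)\<close> j(1)] by simp
    then obtain n1 where n1: "n1 \<ge> K" "y (r n1) \<in> U j"
      unfolding eventually_sequentially by (metis nat_le_linear)
    have "\<forall>\<^sub>F n in sequentially. dist (y (s (r' n))) l' < e/2"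
      using tendstoD[OF l'(3), of "e/2"] e(1) by simp
    then obtain n2 where n2: "n2 \<ge> K" "dist (y (s (r' n2))) l' < e/2"
      unfolding eventually_sequentially by (metis nat_le_linear)
    have "r n1 \<ge> K" "s (r' n2) \<ge> K"
      using n1(1) n2(1) seq_suble[OF l(2), of n1] seq_suble[OF s(1), of "r' n2"]
        seq_suble[OF l'(2), of n2] by linarith+
    then have "y (s (r' n2)) \<in> U j"
      using K n1(2) by blast
    then have "dist l (y (s (r' n2))) < e/2"
      using j(2) by auto
    then show False
      using n2(2) ge dist_triangle[of l' l "y (s (r' n2))"] by (simp add: dist_commute)
  qed
  then have "(\<lambda>n. x (n + N)) \<longlonglongrightarrow> l"
    by (simp add: y_def[abs_def])
  then show ?thesis
    unfolding convergent_def using LIMSEQ_offset by blast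
qed

text \<open>All sequences of \<open>G\<close> whose images tend to the same \<open>t\<close> have
  the same limit, because two of them can be interleaved into a sequence to which the hypothesis
  applies again. This limit is the value of the extension at \<open>t\<close>.\<close>

lemma convergent_inverse_extends_continuously:
  fixes T :: "'c::metric_space \<Rightarrow> real"
  assumes conv: "\<And>x. (\<And>n. x n \<in> G) \<Longrightarrow> convergent (\<lambda>n. T (x n)) \<Longrightarrow> convergent x"
  shows "\<exists>S. continuous_on (closure (T ` G)) S \<and> (\<forall>x\<in>G. S (T x) = x)"
proof -
  have ex: "\<exists>l. \<forall>x. (\<forall>n. x n \<in> G) \<and> (\<lambda>n. T (x n)) \<longlonglongrightarrow> t \<longrightarrow> x \<longlonglongrightarrow> l" for t
  proof (cases "\<exists>x. (\<forall>n. x n \<in> G) \<and> (\<lambda>n. T (x n)) \<longlonglongrightarrow> t")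
    case True
    then obtain x where x: "\<And>n. x n \<in> G" "(\<lambda>n. T (x n)) \<longlonglongrightarrow> t" by blast
    obtain l where l: "x \<longlonglongrightarrow> l"
      using conv[of x] x by (auto simp: convergent_def)
    have "y \<longlonglongrightarrow> l" if y: "\<And>n. y n \<in> G" "(\<lambda>n. T (y n)) \<longlonglongrightarrow> t" for y
    proof -
      define u where "u n = (if even n then x (n div 2) else y (n div 2))" for n
      have div2: "filterlim (\<lambda>n::nat. n div 2) sequentially sequentially"
        unfolding filterlim_at_top eventually_sequentially by (metis div_le_mono nonzero_mult_div_cancel_right zero_neq_numeral)
      have "(\<lambda>n. T (u n)) \<longlonglongrightarrow> t"
      proof (rule metric_LIMSEQ_I)
        fix r :: real assume "r > 0"
        have "\<forall>\<^sub>F n in sequentially. dist (T (x (n div 2))) t < r"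
          using filterlim_compose[OF x(2) div2] \<open>r > 0\<close> by (rule tendstoD)
        moreover have "\<forall>\<^sub>F n in sequentially. dist (T (y (n div 2))) t < r"
          using filterlim_compose[OF y(2) div2] \<open>r > 0\<close> by (rule tendstoD)
        ultimately have "\<forall>\<^sub>F n in sequentially. dist (T (u n)) t < r"
          by eventually_elim (auto simp: u_def)
        then show "\<exists>no. \<forall>n\<ge>no. dist (T (u n)) t < r"
          by (simp add: eventually_sequentially)
      qed
      moreover have "u n \<in> G" for n using x y by (simp add: u_def)
      ultimately obtain L where L: "u \<longlonglongrightarrow> L"
        using conv[of u] by (auto simp: convergent_def)
      have "(u \<circ> (\<lambda>n. 2 * n)) \<longlonglongrightarrow> L" "(u \<circ> (\<lambda>n. 2 * n + 1)) \<longlonglongrightarrow> L"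
        by (rule LIMSEQ_subseq_LIMSEQ[OF L]; simp add: strict_mono_def)+
      then have "x \<longlonglongrightarrow> L" "y \<longlonglongrightarrow> L"
        by (simp_all add: u_def comp_def)
      then show ?thesis using LIMSEQ_unique[OF l] by simp
    qed
    then show ?thesis by blast
  qed blast
  then obtain S where S: "\<And>t x. (\<And>n. x n \<in> G) \<Longrightarrow> (\<lambda>n. T (x n)) \<longlonglongrightarrow> t \<Longrightarrow> x \<longlonglongrightarrow> S t"
    by metis
  have inv: "S (T x) = x" if "x \<in> G" for x
    using LIMSEQ_unique[OF S[of "\<lambda>_. x" "T x"] tendsto_const] that by simp
  have "continuous_on (closure (T ` G)) S"
  proof (rule continuous_on_sequentiallyI)
    fix u t assume u: "\<forall>n. u n \<in> closure (T ` G)" and t: "t \<in> closure (T ` G)" and lim: "u \<longlonglongrightarrow> t"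
    \<comment> \<open>Each point of the closure is replaced by a point of \<open>G\<close> with
      error 1/(n+1) both for \<open>T\<close> and for \<open>S\<close>; the defining property of
      \<open>S\<close> then applies to the replacing sequence.\<close>
    have "\<exists>x\<in>G. dist (T x) (u n) < 1 / Suc n \<and> dist x (S (u n)) < 1 / Suc n" for n
    proof -
      obtain v where v: "\<And>k. v k \<in> T ` G" "v \<longlonglongrightarrow> u n"
        using u closure_sequential by metis
      have "\<exists>x. \<forall>k. x k \<in> G \<and> v k = T (x k)"
        using v(1) by (intro choice) blast
      then obtain x where x: "\<And>k. x k \<in> G" "\<And>k. v k = T (x k)" by blast
      have "v = (\<lambda>k. T (x k))" using x(2) by (rule ext)
      then have lim: "x \<longlonglongrightarrow> S (u n)" using S[OF x(1)] v(2) by simp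
      have pos: "(0::real) < 1 / Suc n" by simp
      from tendstoD[OF lim pos] tendstoD[OF v(2) pos]
      have "\<forall>\<^sub>F k in sequentially. dist (x k) (S (u n)) < 1 / Suc n \<and> dist (T (x k)) (u n) < 1 / Suc n"
        by eventually_elim (simp add: x)
      then show ?thesis using x(1) eventually_happens'[OF sequentially_bot] by blast
    qed
    then have "\<forall>n. \<exists>x. x \<in> G \<and> dist (T x) (u n) < 1 / Suc n \<and> dist x (S (u n)) < 1 / Suc n"
      by (simp add: Bex_def)
    from choice[OF this] obtain x where x: "\<And>n. x n \<in> G" "\<And>n. dist (T (x n)) (u n) < 1 / Suc n"
      "\<And>n. dist (x n) (S (u n)) < 1 / Suc n" by blast
    have small: "f \<longlonglongrightarrow> 0" if "\<And>n. f n < 1 / Suc n" "\<And>n. 0 \<le> f n" for f :: "nat \<Rightarrow> real"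
    proof (rule tendsto_sandwich[OF _ _ tendsto_const LIMSEQ_inverse_real_of_nat])
      show "\<forall>\<^sub>F n in sequentially. 0 \<le> f n" using that(2) by simp
      show "\<forall>\<^sub>F n in sequentially. f n \<le> inverse (real (Suc n))"
        using less_imp_le[OF that(1)] by (simp only: inverse_eq_divide eventually_True)
    qed
    have "(\<lambda>n. T (x n)) \<longlonglongrightarrow> t"
    proof (rule Lim_transform[OF lim])
      show "(\<lambda>n. T (x n) - u n) \<longlonglongrightarrow> 0"
        by (rule tendsto_norm_zero_cancel, rule small)
          (use x(2) in \<open>simp_all add: dist_real_def abs_minus_commute\<close>)
    qed
    then have lim': "x \<longlonglongrightarrow> S t" by (rule S[OF x(1)])
    have "(\<lambda>n. dist (x n) (S (u n)) + dist (x n) (S t)) \<longlonglongrightarrow> 0 + 0"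
    proof (rule tendsto_add)
      show "(\<lambda>n. dist (x n) (S (u n))) \<longlonglongrightarrow> 0"
        by (rule small[OF x(3)]) simp
      show "(\<lambda>n. dist (x n) (S t)) \<longlonglongrightarrow> 0"
        by (rule tendsto_dist_iff[THEN iffD1, OF lim'])
    qed
    then have sum: "(\<lambda>n. dist (x n) (S (u n)) + dist (x n) (S t)) \<longlonglongrightarrow> 0" by simp
    have "(\<lambda>n. dist (S (u n)) (S t)) \<longlonglongrightarrow> 0"
      by (rule tendsto_sandwich[OF _ _ tendsto_const sum])
        (auto intro!: always_eventually dist_triangle3)
    then show "(\<lambda>n. S (u n)) \<longlonglongrightarrow> S t"
      by (rule tendsto_dist_iff[THEN iffD2])
  qed
  then show ?thesis using inv by blast
qed

text \<open>A Skorohod representation reduced to the real line. Tightness of the laws makes the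
  coded laws tight, the real-valued theorems give convergent variables with the coded laws, and the
  extended inverse of the code turns them into variables with the original laws.\<close>

lemma tight_subseq_ae_coupling:
  fixes \<nu> :: "nat \<Rightarrow> 'c::{metric_space, second_countable_topology} measure"
  assumes prob: "\<And>n. prob_space (\<nu> n)" and sets: "\<And>n. sets (\<nu> n) = sets borel"
    and tight: "\<And>\<epsilon>. \<epsilon> > 0 \<Longrightarrow> \<exists>C. compact C \<and> (\<forall>n. measure (\<nu> n) (- C) \<le> \<epsilon>)"
  shows "\<exists>r (\<Omega> :: real measure) Y Z. strict_mono (r :: nat \<Rightarrow> nat) \<and> prob_space \<Omega> \<and>
    (\<forall>n. Y n \<in> borel_measurable \<Omega>) \<and> Z \<in> borel_measurable \<Omega> \<and>
    (\<forall>n. distr \<Omega> borel (Y n) = \<nu> (r n)) \<and> (AE \<omega> in \<Omega>. (\<lambda>n. Y n \<omega>) \<longlonglongrightarrow> Z \<omega>)"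
proof -
  have "\<exists>C. compact C \<and> (\<forall>n. measure (\<nu> n) (- C) \<le> 1 / Suc m)" for m
    by (rule tight) simp
  then obtain C where C: "\<And>m. compact (C m)" "\<And>m n. measure (\<nu> n) (- C m) \<le> 1 / Suc m"
    by metis
  obtain B :: "'c set set" where B: "countable B" "topological_basis B"
    using ex_countable_basis by auto
  define U where "U = from_nat_into B"
  have "B \<noteq> {}" using topological_basisE[OF B(2) open_UNIV UNIV_I] by blast
  then have rU: "range U = B" using B(1) by (simp add: U_def range_from_nat_into)
  then have basis: "topological_basis (range U)" using B by simp
  have [measurable]: "C m \<in> sets borel" for m using C(1) by (simp add: borel_compact)
  have Uo [measurable]: "U j \<in> sets borel" for j
    using basis by (simp add: topological_basis_open)
  define G where "G = (\<Union>m. C m)"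
  have [measurable]: "G \<in> sets borel" by (simp add: G_def)
  have spU [simp]: "space (\<nu> n) = UNIV" for n using sets_eq_imp_space_eq[OF sets] by simp
  define T where "T = code C U"
  have [measurable]: "T \<in> borel_measurable borel"
  proof -
    have "(\<lambda>x. real (LEAST m. x \<in> C m)) \<in> borel_measurable borel"
      by measurable
    moreover have "(\<lambda>x. ternary (\<lambda>j. x \<in> U j)) \<in> borel_measurable borel"
      by (rule ternary_measurable) measurable
    ultimately show ?thesis
      unfolding T_def code_def by (rule borel_measurable_add)
  qed
  have Tle: "0 \<le> T x" "T x \<le> real m + 1/2" if "x \<in> C m" for x m
    using ternary_bounds[of "\<lambda>j. x \<in> U j"] Least_le[of "\<lambda>m. x \<in> C m", OF that]
    unfolding T_def code_def by linarith+
  have meas_T: "T \<in> measurable (\<nu> n) borel" for n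
    by (subst measurable_cong_sets[OF sets refl]) measurable
  have Gfull: "AE x in \<nu> n. x \<in> G" for n
  proof -
    interpret prob_space "\<nu> n" by (rule prob)
    have "measure (\<nu> n) (- G) \<le> 1 / Suc m" for m
      using finite_measure_mono[of "- G" "- C m"] C(2)[of n m] sets[of n] by (force simp: G_def)
    then have "measure (\<nu> n) (- G) \<le> 0"
      by (intro LIMSEQ_le[OF tendsto_const LIMSEQ_inverse_real_of_nat]) (auto simp: inverse_eq_divide)
    then have "emeasure (\<nu> n) (- G) = 0"
      by (simp add: emeasure_eq_measure measure_le_0_iff)
    moreover have "- G \<in> sets (\<nu> n)" using sets by simp
    ultimately show ?thesis by (intro AE_I[of _ _ "- G"]) auto
  qed
  define \<mu> where "\<mu> n = distr (\<nu> n) borel T" for n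
  have rd: "real_distribution (\<mu> n)" for n
  proof -
    interpret prob_space "\<nu> n" by (rule prob)
    show ?thesis
      unfolding \<mu>_def by (intro real_distribution.intro prob_space_distr meas_T real_distribution_axioms.intro) auto
  qed
  have "Helly_Selection.tight \<mu>"
    unfolding Helly_Selection.tight_def
  proof (intro conjI allI impI)
    fix \<epsilon> :: real assume "\<epsilon> > 0"
    then obtain m where m: "1 / Suc m < \<epsilon>" using nat_approx_posE by auto
    \<comment> \<open>Codes of points of \<open>C m\<close> lie in [0, m + 1/2], which this
      half-open interval contains.\<close>
    have "measure (\<mu> n) {-1<..real m + 1} > 1 - \<epsilon>" for n
    proof -
      interpret prob_space "\<nu> n" by (rule prob)
      have "1 - 1 / Suc m \<le> measure (\<nu> n) (C m)"
        using C(2)[of n m] prob_compl[of "C m"] sets[of n] by (simp add: Compl_eq_Diff_UNIV)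
      also have "\<dots> \<le> measure (\<nu> n) (T -` {-1<..real m + 1})"
        using Tle[of _ m] measurable_sets[OF meas_T, of "{-1<..real m + 1}" n]
        by (intro finite_measure_mono) fastforce+
      also have "\<dots> = measure (\<mu> n) {-1<..real m + 1}"
        unfolding \<mu>_def by (subst measure_distr[OF meas_T]) auto
      finally show ?thesis using m by linarith
    qed
    then show "\<exists>a b. a < b \<and> (\<forall>n. measure (\<mu> n) {a<..b} > 1 - \<epsilon>)"
      by (intro exI[of _ "-1"] exI[of _ "real m + 1"]) simp
  qed (rule rd)
  from tight_imp_convergent_subsubsequence[OF this strict_mono_id] obtain r M where
    r: "strict_mono r" "real_distribution M" "weak_conv_m (\<lambda>n. \<mu> (r n)) M"
    by (auto simp: comp_def)
  have "\<exists>(\<Omega> :: real measure) V W. prob_space \<Omega> \<and> (\<forall>n. V n \<in> borel_measurable \<Omega>) \<and>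
      (\<forall>n. distr \<Omega> borel (V n) = \<mu> (r n)) \<and> W \<in> measurable \<Omega> lborel \<and>
      distr \<Omega> borel W = M \<and> (\<forall>x\<in>space \<Omega>. (\<lambda>n. V n x) \<longlonglongrightarrow> W x)"
    by (rule Skorohod[OF rd r(2,3)])
  then obtain \<Omega> :: "real measure" and V W where "prob_space \<Omega> \<and> (\<forall>n. V n \<in> borel_measurable \<Omega>) \<and>
      (\<forall>n. distr \<Omega> borel (V n) = \<mu> (r n)) \<and> W \<in> measurable \<Omega> lborel \<and>
      distr \<Omega> borel W = M \<and> (\<forall>x\<in>space \<Omega>. (\<lambda>n. V n x) \<longlonglongrightarrow> W x)"
    by (elim exE) (rule that)
  then have V: "prob_space \<Omega>" "\<And>n. V n \<in> borel_measurable \<Omega>" "\<And>n. distr \<Omega> borel (V n) = \<mu> (r n)"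
      "W \<in> measurable \<Omega> lborel" "\<And>x. x \<in> space \<Omega> \<Longrightarrow> (\<lambda>n. V n x) \<longlonglongrightarrow> W x"
    by simp_all
  have W: "W \<in> borel_measurable \<Omega>" using V(4) by simp
  have key: "convergent x" if "\<And>n. x n \<in> G" "convergent (\<lambda>n. T (x n))" for x
    using code_convergent_imp_convergent[where C=C and U=U and x=x, OF C(1) basis] that
    unfolding G_def T_def by auto
  have "\<exists>S. continuous_on (closure (T ` G)) S \<and> (\<forall>x\<in>G. S (T x) = x)"
    by (rule convergent_inverse_extends_continuously[OF key])
  then obtain S where S: "continuous_on (closure (T ` G)) S" "\<And>x. x \<in> G \<Longrightarrow> S (T x) = x"
    by blast
  define E where "E = closure (T ` G)"
  have TE: "T x \<in> E" if "x \<in> G" for x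
    unfolding E_def by (rule subsetD[OF closure_subset imageI[OF that]])
  \<comment> \<open>\<open>S\<close> is continuous only on the closed set \<open>E\<close>; the
    constant value elsewhere makes a function that is Borel on the whole line.\<close>
  define S' where "S' t = (if t \<in> E then S t else undefined)" for t
  have [measurable]: "E \<in> sets borel" by (simp add: E_def)
  have S'm: "S' \<in> borel_measurable borel"
    unfolding S'_def[abs_def]
  proof (subst measurable_If_restrict_space_iff)
    show "S \<in> measurable (restrict_space borel {x. x \<in> E}) borel \<and>
      (\<lambda>_. undefined :: 'c) \<in> measurable (restrict_space borel {x. x \<notin> E}) borel"
      using borel_measurable_continuous_on_restrict[OF S(1)] by (simp add: E_def)
  qed simp
  have S'T: "S' (T x) = x" if "x \<in> G" for x
    unfolding S'_def using TE[OF that] S(2)[OF that] by (simp only: if_True)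
  have law: "distr \<Omega> borel (\<lambda>\<omega>. S' (V n \<omega>)) = \<nu> (r n)" for n
  proof -
    have "distr \<Omega> borel (\<lambda>\<omega>. S' (V n \<omega>)) = distr (\<mu> (r n)) borel S'"
      using distr_distr[OF S'm V(2)[of n]] V(3)[of n] by (simp add: comp_def)
    also have "\<dots> = distr (\<nu> (r n)) borel (\<lambda>x. S' (T x))"
      using distr_distr[OF S'm meas_T[of "r n"]] by (simp add: comp_def \<mu>_def)
    also have "\<dots> = distr (\<nu> (r n)) borel (\<lambda>x. x)"
    proof (rule distr_cong_AE)
      show "AE x in \<nu> (r n). S' (T x) = x"
        using Gfull by eventually_elim (rule S'T)
      show "(\<lambda>x. S' (T x)) \<in> measurable (\<nu> (r n)) borel"
        using measurable_compose[OF meas_T S'm] .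
    qed (auto simp: measurable_ident_sets[OF sets])
    also have "\<dots> = \<nu> (r n)"
      by (rule distr_id2) (simp add: sets)
    finally show ?thesis .
  qed
  have "AE \<omega> in \<Omega>. V n \<omega> \<in> E" for n
  proof -
    have "AE t in \<mu> (r n). t \<in> E"
      unfolding \<mu>_def using Gfull[of "r n"] TE by (subst AE_distr_iff[OF meas_T]) auto
    then have "AE t in distr \<Omega> borel (V n). t \<in> E" unfolding V(3) .
    then show ?thesis by (subst (asm) AE_distr_iff[OF V(2)]) auto
  qed
  then have "AE \<omega> in \<Omega>. \<forall>n. V n \<omega> \<in> E" by (simp add: AE_all_countable)
  then have "AE \<omega> in \<Omega>. (\<lambda>n. S' (V n \<omega>)) \<longlonglongrightarrow> S' (W \<omega>)"
  proof (rule AE_mp, intro AE_I2 impI)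
    fix \<omega> assume "\<omega> \<in> space \<Omega>" and E: "\<forall>n. V n \<omega> \<in> E"
    then have lim: "(\<lambda>n. V n \<omega>) \<longlonglongrightarrow> W \<omega>" using V(5) by blast
    \<comment> \<open>The variables \<open>V n\<close> lie in \<open>E\<close> almost surely by
      their law, and their limit stays there because \<open>E\<close> is closed. Continuity of
      \<open>S\<close> on \<open>E\<close> is then all that is used; nothing is claimed about the
      law of the limit.\<close>
    have WE: "W \<omega> \<in> E"
      using closed_sequentially[of E "\<lambda>n. V n \<omega>"] E lim by (auto simp: E_def)
    have "(\<lambda>n. S (V n \<omega>)) \<longlonglongrightarrow> S (W \<omega>)"
      using continuous_on_tendsto_compose[OF S(1), of "\<lambda>n. V n \<omega>" "W \<omega>" sequentially] lim WE E
      by (simp add: E_def)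
    then show "(\<lambda>n. S' (V n \<omega>)) \<longlonglongrightarrow> S' (W \<omega>)"
      using E WE by (simp add: S'_def)
  qed
  moreover have "(\<lambda>\<omega>. S' (V n \<omega>)) \<in> borel_measurable \<Omega>" for n
    by (rule measurable_compose[OF V(2) S'm])
  moreover have "(\<lambda>\<omega>. S' (W \<omega>)) \<in> borel_measurable \<Omega>"
    by (rule measurable_compose[OF W S'm])
  ultimately show ?thesis
    using r(1) V(1) law
    by (intro exI[of _ r] exI[of _ \<Omega>] exI[of _ "\<lambda>n \<omega>. S' (V n \<omega>)"] exI[of _ "\<lambda>\<omega>. S' (W \<omega>)"]) auto
qed

section \<open>Vague limits of measures with tight marginals\<close>

text \<open>A measure that may have lost mass is the image of \<open>\<Omega>\<close> restricted to
  the event \<open>D\<close>. Product measures are determined by boxes, and on a box both sides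
  factor into the same product.\<close>

lemma PiM_pushforward:
  assumes \<Omega>: "finite_measure \<Omega>" and \<nu>: "finite_measure \<nu>" and I: "finite I"
    and D: "D \<in> sets \<Omega>" and g: "g \<in> measurable \<Omega> \<nu>"
    and eq: "\<And>A. A \<in> sets \<nu> \<Longrightarrow> emeasure \<nu> A = emeasure \<Omega> (g -` A \<inter> D)"
  shows "PiM I (\<lambda>_. \<nu>) = distr (density (PiM I (\<lambda>_. \<Omega>)) (indicator (PiE I (\<lambda>_. D))))
    (PiM I (\<lambda>_. \<nu>)) (\<lambda>\<omega>. \<lambda>i\<in>I. g (\<omega> i))" (is "_ = distr ?d _ ?G")
proof -
  interpret O: finite_measure \<Omega> by fact
  interpret N: finite_measure \<nu> by fact
  interpret PO: product_sigma_finite "\<lambda>_. \<Omega>"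
    by (rule product_sigma_finite.intro) (rule O.sigma_finite_measure_axioms)
  interpret PN: product_sigma_finite "\<lambda>_. \<nu>"
    by (rule product_sigma_finite.intro) (rule N.sigma_finite_measure_axioms)
  have D': "PiE I (\<lambda>_. D) \<in> sets (PiM I (\<lambda>_. \<Omega>))"
    using I D by (intro sets_PiM_I_finite) auto
  have G: "?G \<in> measurable (PiM I (\<lambda>_. \<Omega>)) (PiM I (\<lambda>_. \<nu>))"
    by (rule measurable_restrict, rule measurable_compose[OF _ g],
      erule measurable_component_singleton)
  have "distr ?d (PiM I (\<lambda>_. \<nu>)) ?G = PiM I (\<lambda>_. \<nu>)"
  proof (rule PN.PiM_eqI[OF I])
    show "sets (distr ?d (PiM I (\<lambda>_. \<nu>)) ?G) = sets (PiM I (\<lambda>_. \<nu>))" by simp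
    fix A assume A: "\<And>i. i \<in> I \<Longrightarrow> A i \<in> sets \<nu>"
    then have A': "PiE I A \<in> sets (PiM I (\<lambda>_. \<nu>))"
      using I by (intro sets_PiM_I_finite) auto
    have gA: "g -` A i \<inter> D \<in> sets \<Omega>" if "i \<in> I" for i
    proof -
      have "(g -` A i \<inter> space \<Omega>) \<inter> D \<in> sets \<Omega>"
        using measurable_sets[OF g A[OF that]] D by (rule sets.Int)
      then show ?thesis
        using sets.sets_into_space[OF D] by (simp add: Int_assoc Int_absorb1)
    qed
    have "emeasure (distr ?d (PiM I (\<lambda>_. \<nu>)) ?G) (PiE I A) = emeasure ?d (?G -` PiE I A \<inter> space (PiM I (\<lambda>_. \<Omega>)))"
      using G A' by (subst emeasure_distr) auto
    also have "\<dots> = emeasure (PiM I (\<lambda>_. \<Omega>)) (PiE I (\<lambda>_. D) \<inter> (?G -` PiE I A \<inter> space (PiM I (\<lambda>_. \<Omega>))))"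
      by (rule emeasure_restricted[OF D' measurable_sets[OF G A']])
    also have "PiE I (\<lambda>_. D) \<inter> (?G -` PiE I A \<inter> space (PiM I (\<lambda>_. \<Omega>))) = PiE I (\<lambda>i. g -` A i \<inter> D)"
      using sets.sets_into_space[OF D] by (auto simp: space_PiM PiE_iff)
    also have "emeasure (PiM I (\<lambda>_. \<Omega>)) \<dots> = (\<Prod>i\<in>I. emeasure \<Omega> (g -` A i \<inter> D))"
      using gA by (intro PO.emeasure_PiM[OF I])
    also have "\<dots> = (\<Prod>i\<in>I. emeasure \<nu> (A i))"
      using eq[OF A] by (intro prod.cong) auto
    finally show "emeasure (distr ?d (PiM I (\<lambda>_. \<nu>)) ?G) (PiE I A) = (\<Prod>i\<in>I. emeasure \<nu> (A i))" .
  qed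
  then show ?thesis by simp
qed

lemma integral_PiM_pushforward:
  fixes h :: "_ \<Rightarrow> real"
  assumes \<Omega>: "finite_measure \<Omega>" and \<nu>: "finite_measure \<nu>" and I: "finite I"
    and D: "D \<in> sets \<Omega>" and g: "g \<in> measurable \<Omega> \<nu>"
    and eq: "\<And>A. A \<in> sets \<nu> \<Longrightarrow> emeasure \<nu> A = emeasure \<Omega> (g -` A \<inter> D)"
    and h: "h \<in> borel_measurable (PiM I (\<lambda>_. \<nu>))"
  shows "integral\<^sup>L (PiM I (\<lambda>_. \<nu>)) h =
    (\<integral>\<omega>. indicator (PiE I (\<lambda>_. D)) \<omega> * h (\<lambda>i\<in>I. g (\<omega> i)) \<partial>PiM I (\<lambda>_. \<Omega>))"
proof -
  let ?d = "density (PiM I (\<lambda>_. \<Omega>)) (indicator (PiE I (\<lambda>_. D)))"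
  let ?G = "\<lambda>\<omega>. \<lambda>i\<in>I. g (\<omega> i)"
  have D': "PiE I (\<lambda>_. D) \<in> sets (PiM I (\<lambda>_. \<Omega>))"
    using I D by (intro sets_PiM_I_finite) auto
  have G: "?G \<in> measurable (PiM I (\<lambda>_. \<Omega>)) (PiM I (\<lambda>_. \<nu>))"
    by (rule measurable_restrict, rule measurable_compose[OF _ g],
      erule measurable_component_singleton)
  then have G': "?G \<in> measurable ?d (PiM I (\<lambda>_. \<nu>))" by simp
  have "integral\<^sup>L (PiM I (\<lambda>_. \<nu>)) h = integral\<^sup>L (distr ?d (PiM I (\<lambda>_. \<nu>)) ?G) h"
    by (simp only: PiM_pushforward[OF \<Omega> \<nu> I D g eq, symmetric])
  also have "\<dots> = integral\<^sup>L ?d (\<lambda>\<omega>. h (?G \<omega>))"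
    by (rule integral_distr[OF G' h])
  also have "?d = density (PiM I (\<lambda>_. \<Omega>)) (\<lambda>\<omega>. ennreal (indicator (PiE I (\<lambda>_. D)) \<omega>))"
    by (simp add: ennreal_indicator)
  also have "integral\<^sup>L \<dots> (\<lambda>\<omega>. h (?G \<omega>)) =
      (\<integral>\<omega>. indicator (PiE I (\<lambda>_. D)) \<omega> *\<^sub>R h (?G \<omega>) \<partial>PiM I (\<lambda>_. \<Omega>))"
    using D' measurable_compose[OF G h] by (intro integral_density) auto
  finally show ?thesis by simp
qed

section \<open>Completion of sub-probability measures and the unit ball model of the Euclidean
  factor\<close>

lemma ex_add_measure:
  assumes "sets N = sets M"
  shows "\<exists>P. sets P = sets M \<and> (\<forall>A\<in>sets M. emeasure P A = emeasure M A + emeasure N A)"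
proof -
  define \<mu> where "\<mu> A = emeasure M A + emeasure N A" for A
  define P where "P = measure_of (space M) (sets M) \<mu>"
  have "countably_additive (sets M) \<mu>"
  proof (rule countably_additiveI)
    fix A :: "nat \<Rightarrow> _" assume A: "range A \<subseteq> sets M" "disjoint_family A"
    then show "(\<Sum>i. \<mu> (A i)) = \<mu> (\<Union>i. A i)"
      unfolding \<mu>_def using suminf_emeasure[of A M] suminf_emeasure[of A N] assms
      by (simp add: suminf_add[symmetric])
  qed
  moreover have "positive (sets M) \<mu>" by (simp add: positive_def \<mu>_def)
  ultimately have "emeasure P A = \<mu> A" if "A \<in> sets M" for A
    unfolding P_def using that by (intro emeasure_measure_of_sigma sets.sigma_algebra_axioms)
  then show ?thesis by (intro exI[of _ P]) (auto simp: P_def \<mu>_def)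
qed

text \<open>A point mass at \<open>p\<close> carries the missing mass, so that sub-probability
  measures can be fed into the coupling of probability measures.\<close>

lemma ex_completion_to_prob:
  fixes \<nu> :: "'c::topological_space measure"
  assumes "subprob_space \<nu>" and sets: "sets \<nu> = sets borel"
  shows "\<exists>P. prob_space P \<and> sets P = sets borel \<and>
    (\<forall>A\<in>sets borel. emeasure P A = emeasure \<nu> A + (1 - emeasure \<nu> UNIV) * indicator A p)"
proof -
  interpret subprob_space \<nu> by fact
  have sp: "space \<nu> = UNIV" using sets_eq_imp_space_eq[OF sets] by simp
  obtain P where P: "sets P = sets \<nu>" "\<And>A. A \<in> sets \<nu> \<Longrightarrow> emeasure P A =
      emeasure \<nu> A + emeasure (scale_measure (1 - emeasure \<nu> UNIV) (return borel p)) A"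
    using ex_add_measure[of "scale_measure (1 - emeasure \<nu> UNIV) (return borel p)" \<nu>] sets by auto
  have spP: "space P = UNIV" using sets_eq_imp_space_eq[OF P(1)] sp by simp
  have eq: "emeasure P A = emeasure \<nu> A + (1 - emeasure \<nu> UNIV) * indicator A p" if "A \<in> sets borel" for A
    using P(2)[of A] that sets by simp
  have "emeasure P UNIV = 1"
    using eq[of UNIV] emeasure_space_le_1 by (simp add: sp)
  then have "prob_space P" by (intro prob_spaceI) (simp add: spP)
  then show ?thesis using P(1) sets eq by auto
qed

text \<open>The Euclidean factor is squeezed into the open unit ball; mass reaching the unit sphere in the
  limit is lost.\<close>

definition compactify :: "'a \<times> 'b::real_normed_vector \<Rightarrow> 'a \<times> 'b" where
  "compactify z = (fst z, inverse (1 + norm (snd z)) *\<^sub>R snd z)"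

definition uncompactify :: "'a \<times> 'b::real_normed_vector \<Rightarrow> 'a \<times> 'b" where
  "uncompactify z = (fst z, inverse (1 - norm (snd z)) *\<^sub>R snd z)"

lemma norm_snd_compactify: "norm (snd (compactify z)) < 1"
proof -
  have "1 + norm (snd z) > 0" using norm_ge_zero[of "snd z"] by linarith
  then show ?thesis by (simp add: compactify_def divide_simps)
qed

lemma uncompactify_compactify [simp]: "uncompactify (compactify z) = z"
proof -
  have "1 + norm (snd z) > 0" using norm_ge_zero[of "snd z"] by linarith
  then have "inverse (1 - norm (snd z) / (1 + norm (snd z))) * inverse (1 + norm (snd z)) = 1"
    by (simp add: field_simps)
  then show ?thesis
    by (cases z) (simp add: compactify_def uncompactify_def divide_inverse abs_of_nonneg mult.commute)
qed

lemma continuous_compactify: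
  "continuous_on UNIV (compactify :: 'a::topological_space \<times> 'b::real_normed_vector \<Rightarrow> _)"
proof -
  have "1 + norm (y :: 'b) \<noteq> 0" for y using norm_ge_zero[of y] by linarith
  then show ?thesis unfolding compactify_def by (intro continuous_intros) auto
qed

lemma measurable_compactify:
  "compactify \<in> borel_measurable (borel :: ('a::topological_space \<times> 'b::real_normed_vector) measure)"
  by (rule borel_measurable_continuous_onI[OF continuous_compactify])

lemma norm_snd_uncompactify:
  "norm (snd z) < 1 \<Longrightarrow> norm (snd (uncompactify z)) = norm (snd z) / (1 - norm (snd z))"
  by (simp add: uncompactify_def divide_inverse mult.commute)

lemma measurable_uncompactify:
  "uncompactify \<in> borel_measurable (borel :: ('a::{second_countable_topology, metric_space} \<times> 'b::euclidean_space) measure)"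
proof -
  have [measurable]: "snd \<in> borel_measurable (borel :: ('a \<times> 'b) measure)"
    and fst: "fst \<in> borel_measurable (borel :: ('a \<times> 'b) measure)"
    by (intro borel_measurable_continuous_onI continuous_intros)+
  have "(\<lambda>z :: 'a \<times> 'b. inverse (1 - norm (snd z)) *\<^sub>R snd z) \<in> borel_measurable borel"
    by measurable
  then show ?thesis
    unfolding uncompactify_def by (intro borel_measurable_Pair fst)
qed

section \<open>Test functions of k points and vague convergence of products\<close>

abbreviation seqs :: "nat \<Rightarrow> (nat \<Rightarrow> 'c) set" where
  "seqs k \<equiv> PiE {..<k} (\<lambda>_. UNIV)"

text \<open>Continuity refers to the topology of the full function space, measurability to the
  product over k factors. Restricting to the first k coordinates gives a continuous function on the
  full space, whose Borel sets are those of the countable product; padding with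
  \<open>undefined\<close> leads back to k factors.\<close>

lemma measurable_continuous_on_seqs:
  fixes F :: "(nat \<Rightarrow> 'c::second_countable_topology) \<Rightarrow> 'd::topological_space"
  assumes F: "continuous_on (seqs k) F"
  shows "F \<in> borel_measurable (PiM {..<k} (\<lambda>_. borel))"
proof -
  define r :: "(nat \<Rightarrow> 'c) \<Rightarrow> nat \<Rightarrow> 'c" where "r y = (\<lambda>i\<in>{..<k}. y i)" for y
  have "continuous_on UNIV (\<lambda>y. r y i)" for i
    unfolding r_def restrict_def by (cases "i < k") (auto intro: continuous_on_product_coordinates)
  then have "continuous_on UNIV r"
    by (rule continuous_on_coordinatewise_then_product)
  then have "continuous_on UNIV (\<lambda>y. F (r y))"
    by (rule continuous_on_compose2[OF F]) (simp add: r_def image_subset_iff restrict_PiE_iff)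
  then have m: "(\<lambda>y. F (r y)) \<in> borel_measurable (PiM UNIV (\<lambda>_. borel))"
    using borel_measurable_continuous_onI measurable_cong_sets[OF sets_PiM_equal_borel refl] by blast
  define x :: "(nat \<Rightarrow> 'c) \<Rightarrow> nat \<Rightarrow> 'c" where "x z = (\<lambda>i\<in>UNIV. if i < k then z i else undefined)" for z
  have "(\<lambda>z. if i < k then z i else undefined) \<in> measurable (PiM {..<k} (\<lambda>_. borel)) (borel :: 'c measure)" for i
    by (cases "i < k") (auto intro: measurable_component_singleton)
  then have "x \<in> measurable (PiM {..<k} (\<lambda>_. borel)) (PiM UNIV (\<lambda>_. borel))"
    unfolding x_def by (intro measurable_restrict)
  then have "(\<lambda>z. F (r (x z))) \<in> borel_measurable (PiM {..<k} (\<lambda>_. borel))"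
    using m by (rule measurable_compose)
  moreover have "r (x z) = z" if "z \<in> seqs k" for z
    using that by (auto simp: r_def x_def PiE_iff extensional_def restrict_def)
  ultimately show ?thesis
    by (subst measurable_cong[where g="\<lambda>z. F (r (x z))"]) (auto simp: space_PiM)
qed

text \<open>Outside the first k coordinates every point of \<open>seqs k\<close> equals
  \<open>undefined\<close>, so convergence of k coordinates is convergence in the product
  topology.\<close>

lemma continuous_on_seqs_tendsto:
  fixes F :: "(nat \<Rightarrow> 'c::topological_space) \<Rightarrow> 'd::topological_space"
  assumes F: "continuous_on (seqs k) F" and z: "\<And>n. zs n \<in> seqs k" "z \<in> seqs k"
    and lim: "\<And>i. i < k \<Longrightarrow> (\<lambda>n. zs n i) \<longlonglongrightarrow> z i"
  shows "(\<lambda>n. F (zs n)) \<longlonglongrightarrow> F z"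
proof -
  have "(\<lambda>n. zs n i) \<longlonglongrightarrow> z i" for i
    using lim[of i] z by (cases "i < k") (auto simp: PiE_iff extensional_def)
  then have "limitin (product_topology (\<lambda>_. euclidean) UNIV) zs z sequentially"
    by (subst limitin_componentwise) auto
  then have "zs \<longlonglongrightarrow> z"
    by (simp add: euclidean_product_topology)
  then show ?thesis
    using continuous_on_tendsto_compose[OF F, of zs z sequentially] z by auto
qed

text \<open>Decay is asked in each Euclidean coordinate, so that the function extends by zero to the
  sphere at infinity. None is asked in the first factor, where tightness prevents loss of
  mass.\<close>

definition vanishing_test :: "nat \<Rightarrow> ((nat \<Rightarrow> 'a::topological_space \<times> 'b::real_normed_vector) \<Rightarrow> real) \<Rightarrow> bool" where
  "vanishing_test k F \<longleftrightarrow> continuous_on (seqs k) F \<and> (\<exists>B. \<forall>z\<in>seqs k. \<bar>F z\<bar> \<le> B) \<and>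
    (\<forall>\<epsilon>>0. \<exists>R. \<forall>z\<in>seqs k. (\<exists>i<k. norm (snd (z i)) > R) \<longrightarrow> \<bar>F z\<bar> \<le> \<epsilon>)"

text \<open>Integrals over all powers of the measures are part of the notion because Lambda
  integrates against k-fold products.\<close>

definition vague_conv :: "(nat \<Rightarrow> ('a::topological_space \<times> 'b::real_normed_vector) measure) \<Rightarrow> ('a \<times> 'b) measure \<Rightarrow> bool" where
  "vague_conv \<nu>s \<nu> \<longleftrightarrow> (\<forall>k F. vanishing_test k F \<longrightarrow>
    (\<lambda>n. integral\<^sup>L (PiM {..<k} (\<lambda>_. \<nu>s n)) F) \<longlonglongrightarrow> integral\<^sup>L (PiM {..<k} (\<lambda>_. \<nu>)) F)"

lemma vague_conv_subseq:
  fixes \<nu>s :: "nat \<Rightarrow> ('a::topological_space \<times> 'b::real_normed_vector) measure"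
  assumes "strict_mono r" "vague_conv \<nu>s \<nu>"
  shows "vague_conv (\<nu>s \<circ> r) \<nu>"
  unfolding vague_conv_def
proof (intro allI impI)
  fix k and F :: "(nat \<Rightarrow> 'a \<times> 'b) \<Rightarrow> real" assume "vanishing_test k F"
  with assms(2) have "(\<lambda>n. integral\<^sup>L (PiM {..<k} (\<lambda>_. \<nu>s n)) F) \<longlonglongrightarrow> integral\<^sup>L (PiM {..<k} (\<lambda>_. \<nu>)) F"
    by (simp add: vague_conv_def)
  from LIMSEQ_subseq_LIMSEQ[OF this assms(1)]
  show "(\<lambda>n. integral\<^sup>L (PiM {..<k} (\<lambda>_. (\<nu>s \<circ> r) n)) F) \<longlonglongrightarrow> integral\<^sup>L (PiM {..<k} (\<lambda>_. \<nu>)) F"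
    by (simp add: comp_def)
qed

definition extend_by_zero :: "nat \<Rightarrow> ((nat \<Rightarrow> 'a \<times> 'b::real_normed_vector) \<Rightarrow> real) \<Rightarrow> (nat \<Rightarrow> 'a \<times> 'b) \<Rightarrow> real" where
  "extend_by_zero k F z =
    (if \<forall>i<k. norm (snd (z i)) < 1 then F (\<lambda>i\<in>{..<k}. uncompactify (z i)) else 0)"

text \<open>Inside the open ball this is continuity of \<open>F\<close>. At the unit sphere the norm
  t/(1-t) of the decompactified point tends to infinity as t tends to 1, where \<open>F\<close>
  vanishes.\<close>

lemma extend_by_zero_tendsto:
  fixes F :: "(nat \<Rightarrow> 'a::topological_space \<times> 'b::real_normed_vector) \<Rightarrow> real"
  assumes F: "vanishing_test k F" and lim: "\<And>i. i < k \<Longrightarrow> (\<lambda>n. zs n i) \<longlonglongrightarrow> z i"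
  shows "(\<lambda>n. extend_by_zero k F (zs n)) \<longlonglongrightarrow> extend_by_zero k F z"
proof (cases "\<forall>i<k. norm (snd (z i)) < 1")
  case True
  have nlim: "(\<lambda>n. norm (snd (zs n i))) \<longlonglongrightarrow> norm (snd (z i))" if "i < k" for i
    by (intro tendsto_intros lim that)
  have "\<forall>\<^sub>F n in sequentially. norm (snd (zs n i)) < 1" if "i < k" for i
    using order_tendstoD(2)[OF nlim[OF that]] True that by blast
  then have "\<forall>\<^sub>F n in sequentially. \<forall>i\<in>{..<k}. norm (snd (zs n i)) < 1"
    by (intro eventually_ball_finite) auto
  then have ev: "\<forall>\<^sub>F n in sequentially. extend_by_zero k F (zs n) = F (\<lambda>i\<in>{..<k}. uncompactify (zs n i))"
    by eventually_elim (simp add: extend_by_zero_def)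
  have "(\<lambda>n. F (\<lambda>i\<in>{..<k}. uncompactify (zs n i))) \<longlonglongrightarrow> F (\<lambda>i\<in>{..<k}. uncompactify (z i))"
  proof (rule continuous_on_seqs_tendsto[where F=F and k=k])
    show "continuous_on (seqs k) F" using F by (simp add: vanishing_test_def)
    fix i assume i: "i < k"
    have "(\<lambda>n. uncompactify (zs n i)) \<longlonglongrightarrow> uncompactify (z i)"
      unfolding uncompactify_def using True i
      by (intro tendsto_intros lim) auto
    then show "(\<lambda>n. (\<lambda>i\<in>{..<k}. uncompactify (zs n i)) i) \<longlonglongrightarrow> (\<lambda>i\<in>{..<k}. uncompactify (z i)) i"
      using i by simp
  qed auto
  then show ?thesis
    using True tendsto_cong[OF ev] by (simp add: extend_by_zero_def)
next
  case False
  then obtain i where i: "i < k" "norm (snd (z i)) \<ge> 1" by (auto simp: not_less)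
  have "(\<lambda>n. extend_by_zero k F (zs n)) \<longlonglongrightarrow> 0"
  proof (rule tendstoI)
    fix \<epsilon> :: real assume "\<epsilon> > 0"
    then obtain R where R: "\<And>z. z \<in> seqs k \<Longrightarrow> (\<exists>i<k. norm (snd (z i)) > R) \<Longrightarrow> \<bar>F z\<bar> \<le> \<epsilon>/2"
      using F unfolding vanishing_test_def by (meson half_gt_zero)
    define R' where "R' = max R 0"
    have R'0: "0 \<le> R'" by (simp add: R'_def)
    \<comment> \<open>The radius of the ball model that corresponds to norm \<open>R'\<close>: the
      map t/(1-t) takes it back to \<open>R'\<close>.\<close>
    have "R' / (1 + R') < 1" using R'0 by (simp add: divide_simps)
    moreover have "(\<lambda>n. norm (snd (zs n i))) \<longlonglongrightarrow> norm (snd (z i))"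
      by (intro tendsto_intros lim i)
    ultimately have "\<forall>\<^sub>F n in sequentially. norm (snd (zs n i)) > R' / (1 + R')"
      using i(2) by (intro order_tendstoD(1)[where y="norm (snd (z i))"]) auto
    then show "\<forall>\<^sub>F n in sequentially. dist (extend_by_zero k F (zs n)) 0 < \<epsilon>"
    proof eventually_elim
      case (elim n)
      show ?case
      proof (cases "\<forall>i<k. norm (snd (zs n i)) < 1")
        case lt: True
        let ?t = "norm (snd (zs n i))"
        have t: "?t < 1" using lt i by blast
        have "R' < ?t / (1 - ?t)"
          using elim t R'0 by (simp add: field_simps)
        then have "R < norm (snd (uncompactify (zs n i)))"
          using norm_snd_uncompactify[OF t] by (simp add: R'_def)
        then have "\<bar>F (\<lambda>i\<in>{..<k}. uncompactify (zs n i))\<bar> \<le> \<epsilon>/2"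
          using i by (intro R) auto
        then show ?thesis using \<open>\<epsilon> > 0\<close> lt by (simp add: extend_by_zero_def)
      next
        case False
        show ?thesis unfolding extend_by_zero_def if_not_P[OF False] using \<open>\<epsilon> > 0\<close> by simp
      qed
    qed
  qed
  moreover have "extend_by_zero k F z = 0" unfolding extend_by_zero_def if_not_P[OF False] ..
  ultimately show ?thesis by simp
qed

lemma integral_PiM_eq_extend_by_zero:
  fixes \<nu> :: "('a::{metric_space, second_countable_topology} \<times> 'b::euclidean_space) measure"
  assumes \<Omega>: "finite_measure \<Omega>" and \<nu>: "finite_measure \<nu>" and sets: "sets \<nu> = sets borel"
    and Y: "Y \<in> borel_measurable \<Omega>" and F: "vanishing_test k F"
    and law: "\<And>A. A \<in> sets borel \<Longrightarrow> emeasure \<nu> A =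
      emeasure \<Omega> ((\<lambda>\<omega>. uncompactify (Y \<omega>)) -` A \<inter> {\<omega> \<in> space \<Omega>. norm (snd (Y \<omega>)) < 1})"
  shows "integral\<^sup>L (PiM {..<k} (\<lambda>_. \<nu>)) F = (\<integral>\<omega>. extend_by_zero k F (\<lambda>i. Y (\<omega> i)) \<partial>PiM {..<k} (\<lambda>_. \<Omega>))"
    and "(\<lambda>\<omega>. extend_by_zero k F (\<lambda>i. Y (\<omega> i))) \<in> borel_measurable (PiM {..<k} (\<lambda>_. \<Omega>))"
proof -
  let ?D = "{\<omega> \<in> space \<Omega>. norm (snd (Y \<omega>)) < 1}"
  have [measurable]: "snd \<in> borel_measurable (borel :: ('a \<times> 'b) measure)"
    by (intro borel_measurable_continuous_onI continuous_intros)
  have [measurable]: "Y \<in> borel_measurable \<Omega>" by fact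
  have D: "?D \<in> sets \<Omega>" by measurable
  have D': "PiE {..<k} (\<lambda>_. ?D) \<in> sets (PiM {..<k} (\<lambda>_. \<Omega>))"
    using D by (intro sets_PiM_I_finite) auto
  have g: "(\<lambda>\<omega>. uncompactify (Y \<omega>)) \<in> measurable \<Omega> borel"
    by (rule measurable_compose[OF Y measurable_uncompactify])
  then have g': "(\<lambda>\<omega>. uncompactify (Y \<omega>)) \<in> measurable \<Omega> \<nu>"
    by (simp add: measurable_cong_sets[OF refl sets])
  have F': "F \<in> borel_measurable (PiM {..<k} (\<lambda>_. borel))"
    using F by (intro measurable_continuous_on_seqs) (simp add: vanishing_test_def)
  moreover have "sets (PiM {..<k} (\<lambda>_. \<nu>)) = sets (PiM {..<k} (\<lambda>_. borel))"
    by (intro sets_PiM_cong) (auto simp: sets)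
  ultimately have h: "F \<in> borel_measurable (PiM {..<k} (\<lambda>_. \<nu>))"
    by (simp cong: measurable_cong_sets)
  have G: "(\<lambda>\<omega>. \<lambda>i\<in>{..<k}. uncompactify (Y (\<omega> i))) \<in> measurable (PiM {..<k} (\<lambda>_. \<Omega>)) (PiM {..<k} (\<lambda>_. borel))"
    by (rule measurable_restrict, rule measurable_compose[OF _ g], erule measurable_component_singleton)
  have eq: "indicator (PiE {..<k} (\<lambda>_. ?D)) \<omega> * F (\<lambda>i\<in>{..<k}. uncompactify (Y (\<omega> i))) =
      extend_by_zero k F (\<lambda>i. Y (\<omega> i))" if "\<omega> \<in> space (PiM {..<k} (\<lambda>_. \<Omega>))" for \<omega>
    using that by (auto simp: extend_by_zero_def indicator_def space_PiM PiE_iff)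
  have "integral\<^sup>L (PiM {..<k} (\<lambda>_. \<nu>)) F = (\<integral>\<omega>. indicator (PiE {..<k} (\<lambda>_. ?D)) \<omega> *
      F (\<lambda>i\<in>{..<k}. uncompactify (Y (\<omega> i))) \<partial>PiM {..<k} (\<lambda>_. \<Omega>))"
    by (rule integral_PiM_pushforward[OF \<Omega> \<nu> finite_lessThan D g' _ h]) (simp add: law sets)
  also have "\<dots> = (\<integral>\<omega>. extend_by_zero k F (\<lambda>i. Y (\<omega> i)) \<partial>PiM {..<k} (\<lambda>_. \<Omega>))"
    by (rule Bochner_Integration.integral_cong[OF refl eq])
  finally show "integral\<^sup>L (PiM {..<k} (\<lambda>_. \<nu>)) F = (\<integral>\<omega>. extend_by_zero k F (\<lambda>i. Y (\<omega> i)) \<partial>PiM {..<k} (\<lambda>_. \<Omega>))" .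
  have "(\<lambda>\<omega>. indicator (PiE {..<k} (\<lambda>_. ?D)) \<omega> * F (\<lambda>i\<in>{..<k}. uncompactify (Y (\<omega> i)))) \<in> borel_measurable (PiM {..<k} (\<lambda>_. \<Omega>))"
    using D' measurable_compose[OF G F'] by (intro borel_measurable_times borel_measurable_indicator)
  then show "(\<lambda>\<omega>. extend_by_zero k F (\<lambda>i. Y (\<omega> i))) \<in> borel_measurable (PiM {..<k} (\<lambda>_. \<Omega>))"
    by (subst (asm) measurable_cong[OF eq])
qed

text \<open>In the ball model the Euclidean factor is relatively compact, so tightness in the first
  factor is enough for the coupling. Mass that the coupled limit puts on the sphere is discarded,
  which agrees with the zero extension of the test functions.\<close>

lemma tight_marginals_imp_vague_subseq:
  fixes \<nu>s :: "nat \<Rightarrow> ('a::{metric_space, second_countable_topology} \<times> 'b::euclidean_space) measure"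
  assumes sub: "\<And>n. subprob_space (\<nu>s n)" and sets: "\<And>n. sets (\<nu>s n) = sets borel"
    and tight: "\<And>\<epsilon>. \<epsilon> > 0 \<Longrightarrow> \<exists>C. compact C \<and> (\<forall>n. measure (\<nu>s n) ((- C) \<times> UNIV) \<le> \<epsilon>)"
  shows "\<exists>r \<nu>. strict_mono (r :: nat \<Rightarrow> nat) \<and> subprob_space \<nu> \<and> sets \<nu> = sets borel \<and> vague_conv (\<nu>s \<circ> r) \<nu>"
proof -
  obtain e :: 'b where e: "norm e = 1" using nonempty_Basis norm_Basis by blast
  \<comment> \<open>A point over the unit sphere: the mass added there lies outside the image of
    \<open>compactify\<close>, and zero-extended test functions do not see it.\<close>
  define p :: "'a \<times> 'b" where "p = (undefined, e)"
  have sp: "space (\<nu>s n) = UNIV" for n using sets_eq_imp_space_eq[OF sets] by simp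
  have comp: "compactify \<in> measurable (\<nu>s n) borel" for n
    using measurable_compactify by (simp add: measurable_cong_sets[OF sets refl])
  have ex: "\<exists>P. prob_space P \<and> sets P = sets borel \<and> (\<forall>A\<in>sets borel. p \<notin> A \<longrightarrow>
      emeasure P A = emeasure (\<nu>s n) (compactify -` A))" for n
  proof -
    have "subprob_space (distr (\<nu>s n) borel compactify)"
      by (rule subprob_space.subprob_space_distr[OF sub comp]) simp
    from ex_completion_to_prob[OF this, of p] obtain P where
      P: "prob_space P" "sets P = sets borel" "\<And>A. A \<in> sets borel \<Longrightarrow> emeasure P A =
        emeasure (distr (\<nu>s n) borel compactify) A +
        (1 - emeasure (distr (\<nu>s n) borel compactify) UNIV) * indicator A p"
      by auto
    have "emeasure P A = emeasure (\<nu>s n) (compactify -` A)" if "A \<in> sets borel" "p \<notin> A" for A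
      using P(3)[OF that(1)] that by (simp add: emeasure_distr[OF comp] sp)
    then show ?thesis using P by blast
  qed
  have "\<exists>P. \<forall>n. prob_space (P n) \<and> sets (P n) = sets borel \<and> (\<forall>A\<in>sets borel. p \<notin> A \<longrightarrow>
      emeasure (P n) A = emeasure (\<nu>s n) (compactify -` A))"
    using ex by (intro choice) blast
  then obtain P where P: "\<And>n. prob_space (P n)" "\<And>n. sets (P n) = sets borel"
    "\<And>n A. A \<in> sets borel \<Longrightarrow> p \<notin> A \<Longrightarrow> emeasure (P n) A = emeasure (\<nu>s n) (compactify -` A)"
    by blast
  have tightP: "\<exists>C. compact C \<and> (\<forall>n. measure (P n) (- C) \<le> \<epsilon>)" if \<epsilon>: "\<epsilon> > 0" for \<epsilon>
  proof -
    obtain C where C: "compact C" "\<And>n. measure (\<nu>s n) ((- C) \<times> UNIV) \<le> \<epsilon>"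
      using tight[OF \<epsilon>] by blast
    \<comment> \<open>\<open>undefined\<close> is the first coordinate of the added point
      \<open>p\<close>, which has to belong to the compact set.\<close>
    let ?C = "insert undefined C \<times> cball (0 :: 'b) 1"
    have cC: "compact ?C" using C(1) by (intro compact_Times compact_insert) auto
    have CB: "(- C) \<times> (UNIV :: 'b set) \<in> sets borel"
      using compact_imp_closed[OF C(1)] by (intro borel_open open_Times) auto
    have "measure (P n) (- ?C) \<le> \<epsilon>" for n
    proof -
      interpret subprob_space "\<nu>s n" by (rule sub)
      have "- ?C \<in> sets borel" using compact_imp_closed[OF cC] by (intro borel_open) auto
      moreover have "p \<notin> - ?C" using e by (simp add: p_def)
      ultimately have "measure (P n) (- ?C) = measure (\<nu>s n) (compactify -` (- ?C))"
        using P(3)[of "- ?C" n] by (simp add: measure_def)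
      also have "\<dots> \<le> measure (\<nu>s n) ((- C) \<times> UNIV)"
      proof (rule finite_measure_mono)
        have "compactify z \<in> ?C" if "fst z \<in> C" for z
          using that norm_snd_compactify[of z] by (auto simp: compactify_def mem_Times_iff)
        then show "compactify -` (- ?C) \<subseteq> (- C) \<times> UNIV"
          unfolding subset_iff vimage_eq Compl_iff mem_Times_iff by blast
      qed (simp add: CB sets)
      finally show ?thesis using C(2)[of n] by linarith
    qed
    then show ?thesis using cC by blast
  qed
  have "\<exists>r (\<Omega> :: real measure) Y Z. strict_mono (r :: nat \<Rightarrow> nat) \<and> prob_space \<Omega> \<and>
    (\<forall>n. Y n \<in> borel_measurable \<Omega>) \<and> Z \<in> borel_measurable \<Omega> \<and>
    (\<forall>n. distr \<Omega> borel (Y n) = P (r n)) \<and> (AE \<omega> in \<Omega>. (\<lambda>n. Y n \<omega>) \<longlonglongrightarrow> Z \<omega>)"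
    using tightP by (intro tight_subseq_ae_coupling P(1,2))
  then obtain r and \<Omega> :: "real measure" and Y Z where "strict_mono (r :: nat \<Rightarrow> nat) \<and> prob_space \<Omega> \<and>
    (\<forall>n. Y n \<in> borel_measurable \<Omega>) \<and> Z \<in> borel_measurable \<Omega> \<and>
    (\<forall>n. distr \<Omega> borel (Y n) = P (r n)) \<and> (AE \<omega> in \<Omega>. (\<lambda>n. Y n \<omega>) \<longlonglongrightarrow> Z \<omega>)"
    by (elim exE) (rule that)
  then have r: "strict_mono (r :: nat \<Rightarrow> nat)" and \<Omega>: "prob_space \<Omega>"
    and Y: "\<And>n. Y n \<in> borel_measurable \<Omega>" and Z: "Z \<in> borel_measurable \<Omega>"
    and distr: "\<And>n. distr \<Omega> borel (Y n) = P (r n)"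
    and lim: "AE \<omega> in \<Omega>. (\<lambda>n. Y n \<omega>) \<longlonglongrightarrow> Z \<omega>"
    by simp_all
  interpret \<Omega>: prob_space \<Omega> by fact
  have fin: "finite_measure \<Omega>" by (rule \<Omega>.finite_measure_axioms)
  have [measurable]: "snd \<in> borel_measurable (borel :: ('a \<times> 'b) measure)"
    by (intro borel_measurable_continuous_onI continuous_intros)
  have law: "emeasure (\<nu>s (r n)) A = emeasure \<Omega> ((\<lambda>\<omega>. uncompactify (Y n \<omega>)) -` A \<inter>
      {\<omega> \<in> space \<Omega>. norm (snd (Y n \<omega>)) < 1})" if A: "A \<in> sets borel" for n A
  proof -
    let ?B = "uncompactify -` A \<inter> {z :: 'a \<times> 'b. norm (snd z) < 1}"
    have "{z :: 'a \<times> 'b. norm (snd z) < 1} \<in> sets borel" by measurable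
    moreover have "uncompactify -` A \<in> sets borel"
      using measurable_sets[OF measurable_uncompactify A] by simp
    ultimately have B: "?B \<in> sets borel" by (intro sets.Int)
    have "(\<lambda>\<omega>. uncompactify (Y n \<omega>)) -` A \<inter> {\<omega> \<in> space \<Omega>. norm (snd (Y n \<omega>)) < 1} = Y n -` ?B \<inter> space \<Omega>"
      by auto
    also have "emeasure \<Omega> \<dots> = emeasure (P (r n)) ?B"
      using emeasure_distr[OF Y B] distr by simp
    also have "\<dots> = emeasure (\<nu>s (r n)) (compactify -` ?B)"
      using B e by (intro P(3)) (auto simp: p_def)
    also have "compactify -` ?B = A"
      unfolding vimage_def Int_def mem_Collect_eq uncompactify_compactify
      by (simp add: norm_snd_compactify)
    finally show ?thesis by simp
  qed
  let ?D = "{\<omega> \<in> space \<Omega>. norm (snd (Z \<omega>)) < 1}"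
  define \<nu> where "\<nu> = distr (density \<Omega> (indicator ?D)) borel (\<lambda>\<omega>. uncompactify (Z \<omega>))"
  have D: "?D \<in> sets \<Omega>" using Z by measurable
  have g: "(\<lambda>\<omega>. uncompactify (Z \<omega>)) \<in> borel_measurable \<Omega>"
    by (rule measurable_compose[OF Z measurable_uncompactify])
  have law': "emeasure \<nu> A = emeasure \<Omega> ((\<lambda>\<omega>. uncompactify (Z \<omega>)) -` A \<inter> ?D)" if A: "A \<in> sets borel" for A
  proof -
    have "emeasure \<nu> A = emeasure (density \<Omega> (indicator ?D)) ((\<lambda>\<omega>. uncompactify (Z \<omega>)) -` A \<inter> space \<Omega>)"
      unfolding \<nu>_def using g A by (subst emeasure_distr) auto
    also have "\<dots> = emeasure \<Omega> (?D \<inter> ((\<lambda>\<omega>. uncompactify (Z \<omega>)) -` A \<inter> space \<Omega>))"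
      by (rule emeasure_restricted[OF D measurable_sets[OF g A]])
    also have "?D \<inter> ((\<lambda>\<omega>. uncompactify (Z \<omega>)) -` A \<inter> space \<Omega>) = (\<lambda>\<omega>. uncompactify (Z \<omega>)) -` A \<inter> ?D"
      by auto
    finally show ?thesis .
  qed
  have sets\<nu>: "sets \<nu> = sets borel" by (simp add: \<nu>_def)
  have sp\<nu>: "space \<nu> = UNIV" using sets_eq_imp_space_eq[OF sets\<nu>] by simp
  have sub\<nu>: "subprob_space \<nu>"
    using law'[of UNIV] \<Omega>.emeasure_le_1 by (intro subprob_spaceI) (auto simp: sp\<nu>)
  have "vague_conv (\<nu>s \<circ> r) \<nu>"
    unfolding vague_conv_def
  proof (intro allI impI)
    fix k and F :: "(nat \<Rightarrow> 'a \<times> 'b) \<Rightarrow> real" assume F: "vanishing_test k F"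
    then obtain B where B: "\<And>z. z \<in> seqs k \<Longrightarrow> \<bar>F z\<bar> \<le> B"
      unfolding vanishing_test_def by blast
    have fin\<nu>: "finite_measure (\<nu>s n)" "finite_measure \<nu>" for n
      using sub sub\<nu> by (auto simp: subprob_space_def)
    interpret P\<Omega>: prob_space "PiM {..<k} (\<lambda>_. \<Omega>)"
      by (rule prob_space_PiM) (rule \<Omega>)
    note E = integral_PiM_eq_extend_by_zero[OF fin fin\<nu>(1) sets Y F law]
      and E' = integral_PiM_eq_extend_by_zero[OF fin fin\<nu>(2) sets\<nu> Z F law']
    \<comment> \<open>Independent copies of one coupling: each of the k coordinates converges almost
      surely, hence all of them do, and the k-fold integrals converge by dominated
      convergence.\<close>
    have "AE \<omega> in PiM {..<k} (\<lambda>_. \<Omega>). \<forall>i\<in>{..<k}. (\<lambda>n. Y n (\<omega> i)) \<longlonglongrightarrow> Z (\<omega> i)"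
    proof (rule AE_finite_allI[OF finite_lessThan])
      fix i assume "i \<in> {..<k}"
      then show "AE \<omega> in PiM {..<k} (\<lambda>_. \<Omega>). (\<lambda>n. Y n (\<omega> i)) \<longlonglongrightarrow> Z (\<omega> i)"
        using AE_PiM_component[of "{..<k}" "\<lambda>_. \<Omega>" i, OF \<Omega> _ lim] by simp
    qed
    then have conv: "AE \<omega> in PiM {..<k} (\<lambda>_. \<Omega>). (\<lambda>n. extend_by_zero k F (\<lambda>i. Y n (\<omega> i))) \<longlonglongrightarrow> extend_by_zero k F (\<lambda>i. Z (\<omega> i))"
      by eventually_elim (rule extend_by_zero_tendsto[OF F], simp)
    have bound: "norm (extend_by_zero k F z) \<le> \<bar>B\<bar>" for z
      using B[of "\<lambda>i\<in>{..<k}. uncompactify (z i)"] by (auto simp: extend_by_zero_def)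
    have "(\<lambda>n. \<integral>\<omega>. extend_by_zero k F (\<lambda>i. Y n (\<omega> i)) \<partial>PiM {..<k} (\<lambda>_. \<Omega>)) \<longlonglongrightarrow>
       (\<integral>\<omega>. extend_by_zero k F (\<lambda>i. Z (\<omega> i)) \<partial>PiM {..<k} (\<lambda>_. \<Omega>))"
      by (rule integral_dominated_convergence[where w="\<lambda>_. \<bar>B\<bar>"])
        (use E(2) E'(2) conv bound in auto)
    then show "(\<lambda>n. integral\<^sup>L (PiM {..<k} (\<lambda>_. (\<nu>s \<circ> r) n)) F) \<longlonglongrightarrow> integral\<^sup>L (PiM {..<k} (\<lambda>_. \<nu>)) F"
      by (simp add: E(1) E'(1))
  qed
  then show ?thesis using r sub\<nu> sets\<nu> by blast
qed

section \<open>Heavy balls\<close>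

text \<open>Balls in the same component with centres more than twice the radius apart are disjoint,
  so their masses add up to at most the mass of that component; the components share total mass at
  most 1.\<close>

lemma sum_measure_packing_le:
  fixes \<mu> :: "nat \<Rightarrow> ('a::{metric_space, second_countable_topology} \<times> 'b::euclidean_space) measure"
  assumes fin: "\<And>i. finite_measure (\<mu> i)" and sets: "\<And>i. sets (\<mu> i) = sets borel"
    and mass: "(\<Sum>i. emeasure (\<mu> i) UNIV) \<le> 1"
    and S: "finite S" "\<And>i y y'. (i, y) \<in> S \<Longrightarrow> (i, y') \<in> S \<Longrightarrow> y \<noteq> y' \<Longrightarrow> dist y y' > 2 * \<rho>"
  shows "(\<Sum>(i, y)\<in>S. measure (\<mu> i) (UNIV \<times> cball y \<rho>)) \<le> 1"
proof -
  interpret finite_measure "\<mu> i" for i by (rule fin)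
  have ball: "UNIV \<times> cball y \<rho> \<in> sets (\<mu> i)" for i y
    by (simp add: sets borel_closed closed_Times)
  have part: "(\<Sum>s\<in>{s\<in>S. fst s = i}. case s of (i, y) \<Rightarrow> measure (\<mu> i) (UNIV \<times> cball y \<rho>)) \<le> measure (\<mu> i) UNIV" for i
  proof -
    let ?T = "{s\<in>S. fst s = i}"
    let ?B = "\<lambda>s. (UNIV :: 'a set) \<times> cball (snd s) \<rho>"
    have "disjoint_family_on ?B ?T"
      unfolding disjoint_family_on_def
    proof (intro ballI impI)
      fix s t assume st: "s \<in> ?T" "t \<in> ?T" "s \<noteq> t"
      then have "snd s \<noteq> snd t" by (auto simp: prod_eq_iff)
      then have d: "dist (snd s) (snd t) > 2 * \<rho>"
        using S(2)[of i "snd s" "snd t"] st by (metis (mono_tags, lifting) mem_Collect_eq prod.collapse)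
      have "False" if "dist (snd s) y \<le> \<rho>" "dist (snd t) y \<le> \<rho>" for y
        using d that dist_triangle2[of "snd s" "snd t" y] by linarith
      then show "?B s \<inter> ?B t = {}" by auto
    qed
    then have "(\<Sum>s\<in>?T. measure (\<mu> i) (?B s)) = measure (\<mu> i) (\<Union>s\<in>?T. ?B s)"
      using S(1) ball by (intro finite_measure_finite_Union[symmetric]) auto
    also have "\<dots> \<le> measure (\<mu> i) UNIV"
      by (intro finite_measure_mono) (auto simp: sets)
    finally show ?thesis
      by (auto simp: case_prod_beta intro: order_trans[rotated] sum_mono)
  qed
  have "(\<Sum>(i, y)\<in>S. measure (\<mu> i) (UNIV \<times> cball y \<rho>)) =
      (\<Sum>i\<in>fst ` S. \<Sum>s\<in>{s\<in>S. fst s = i}. case s of (i, y) \<Rightarrow> measure (\<mu> i) (UNIV \<times> cball y \<rho>))"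
    using S(1) by (intro sum.group[symmetric]) auto
  also have "\<dots> \<le> (\<Sum>i\<in>fst ` S. measure (\<mu> i) UNIV)"
    by (intro sum_mono part)
  also have "\<dots> \<le> 1"
  proof -
    have "ennreal (\<Sum>i\<in>fst ` S. measure (\<mu> i) UNIV) = (\<Sum>i\<in>fst ` S. emeasure (\<mu> i) UNIV)"
      by (simp add: emeasure_eq_measure sum_ennreal)
    also have "\<dots> \<le> (\<Sum>i. emeasure (\<mu> i) UNIV)"
      using S(1) by (intro sum_le_suminf) auto
    finally show ?thesis using mass by (metis ennreal_le_1 order_trans)
  qed
  finally show ?thesis .
qed

text \<open>The witness is a maximal set of centres of heavy balls that are pairwise disjoint.\<close>

lemma ex_heavy_centres:
  fixes \<mu> :: "nat \<Rightarrow> ('a::{metric_space, second_countable_topology} \<times> 'b::euclidean_space) measure"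
  assumes fin: "\<And>i. finite_measure (\<mu> i)" and sets: "\<And>i. sets (\<mu> i) = sets borel"
    and mass: "(\<Sum>i. emeasure (\<mu> i) UNIV) \<le> 1"
  shows "\<exists>c. \<forall>i y. measure (\<mu> i) (UNIV \<times> cball y \<rho>) > 1 / real (Suc m) \<longrightarrow>
    (\<exists>j\<le>m. fst (c j) = i \<and> dist y (snd (c j)) \<le> 2 * \<rho>)"
proof -
  define heavy where "heavy s \<longleftrightarrow> measure (\<mu> (fst s)) (UNIV \<times> cball (snd s) \<rho>) > 1 / real (Suc m)" for s
  define pack where "pack S \<longleftrightarrow> finite S \<and> (\<forall>s\<in>S. heavy s) \<and>
    (\<forall>i y y'. (i, y) \<in> S \<longrightarrow> (i, y') \<in> S \<longrightarrow> y \<noteq> y' \<longrightarrow> dist y y' > 2 * \<rho>)" for S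
  have card: "card S \<le> Suc m" if "pack S" for S
  proof -
    have "real (card S) * (1 / real (Suc m)) = (\<Sum>s\<in>S. 1 / real (Suc m))" by simp
    also have "\<dots> \<le> (\<Sum>(i, y)\<in>S. measure (\<mu> i) (UNIV \<times> cball y \<rho>))"
      using that by (intro sum_mono) (auto simp: pack_def heavy_def case_prod_beta less_imp_le)
    also have "\<dots> \<le> 1"
      using that by (intro sum_measure_packing_le[OF fin sets mass]) (auto simp: pack_def)
    finally show ?thesis by (simp add: divide_simps)
  qed
  have "pack {}" by (simp add: pack_def)
  moreover have "\<forall>S. pack S \<longrightarrow> card S \<le> Suc m" using card by blast
  ultimately obtain S where S: "pack S" "\<And>T. pack T \<Longrightarrow> card T \<le> card S"
    using ex_has_greatest_nat[of pack "{}" card "Suc (Suc m)"] by (auto simp: less_Suc_eq_le)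
  have fS: "finite S" using S(1) by (simp add: pack_def)
  \<comment> \<open>The enumeration is specified only below \<open>card S\<close>; the remaining
    entries are arbitrary pairs, which is harmless because only the existence of a suitable entry is
    claimed.\<close>
  obtain c where c: "bij_betw c {0..<card S} S" using ex_bij_betw_nat_finite[OF fS] by blast
  have "\<exists>j\<le>m. fst (c j) = i \<and> dist y (snd (c j)) \<le> 2 * \<rho>"
    if h: "measure (\<mu> i) (UNIV \<times> cball y \<rho>) > 1 / real (Suc m)" for i y
  proof -
    have "\<exists>s\<in>S. fst s = i \<and> dist y (snd s) \<le> 2 * \<rho>"
    proof (rule ccontr)
      assume *: "\<not> ?thesis"
      then have far: "dist y y' > 2 * \<rho>" if "(i, y') \<in> S" for y' using that by force
      \<comment> \<open>If \<open>y\<close> were itself a centre, its distance 0 would exceed twice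
        the radius. This forces a negative radius, whose balls are empty and hence not
        heavy.\<close>
      have "(i, y) \<notin> S \<or> 0 > \<rho>" using far[of y] by fastforce
      moreover have "\<not> 0 > \<rho>"
      proof
        assume "0 > \<rho>"
        then have "measure (\<mu> i) (UNIV \<times> cball y \<rho>) = 0" by simp
        moreover have "0 < 1 / real (Suc m)" by simp
        ultimately show False using h by linarith
      qed
      ultimately have "(i, y) \<notin> S" by blast
      have "pack (insert (i, y) S)"
        using S(1) h far unfolding pack_def heavy_def by (auto simp: dist_commute)
      then have "card (insert (i, y) S) \<le> card S" by (rule S(2))
      then show False using \<open>(i, y) \<notin> S\<close> fS by simp
    qed
    then obtain s where s: "s \<in> S" "fst s = i" "dist y (snd s) \<le> 2 * \<rho>" by blast
    then have "s \<in> c ` {0..<card S}" using c by (simp add: bij_betw_def)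
    then obtain j where "j < card S" "c j = s" by auto
    then show ?thesis using s card[OF S(1)] by (intro exI[of _ j]) auto
  qed
  then show ?thesis by blast
qed

lemma emeasure_PiM_const:
  assumes "finite_measure \<nu>" "finite I"
  shows "emeasure (PiM I (\<lambda>_. \<nu>)) (space (PiM I (\<lambda>_. \<nu>))) = ennreal (measure \<nu> (space \<nu>) ^ card I)"
proof -
  interpret finite_measure \<nu> by fact
  interpret P: product_sigma_finite "\<lambda>_. \<nu>"
    by (rule product_sigma_finite.intro) (rule sigma_finite_measure_axioms)
  show ?thesis
    using P.emeasure_PiM[OF assms(2), of "\<lambda>_. space \<nu>"]
    by (simp add: space_PiM emeasure_eq_measure ennreal_power)
qed

lemma finite_measure_PiM:
  assumes "finite_measure \<nu>" "finite I"
  shows "finite_measure (PiM I (\<lambda>_. \<nu>))"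
  by (rule finite_measureI) (simp add: emeasure_PiM_const[OF assms])

text \<open>Integrating out the second variable leaves the mass near the first one, which is small
  wherever the cut-off does not vanish.\<close>

lemma integral_light_part_le:
  fixes \<nu> :: "('a::{metric_space, second_countable_topology} \<times> 'b::euclidean_space) measure"
  assumes sub: "subprob_space \<nu>" and sets: "sets \<nu> = sets borel" and k: "2 \<le> k"
    and F: "F \<in> borel_measurable (PiM {..<k} (\<lambda>_. \<nu>))"
    and F1: "\<And>z. z \<in> seqs k \<Longrightarrow> \<bar>F z\<bar> \<le> 1"
    and F\<epsilon>: "\<And>z. z \<in> seqs k \<Longrightarrow> dist (snd (z 0)) (snd (z 1)) > \<rho> \<Longrightarrow> \<bar>F z\<bar> \<le> \<epsilon>"
    and g: "g \<in> borel_measurable borel" "\<And>z. 0 \<le> g z" "\<And>z. g z \<le> 1"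
    and light: "\<And>z. g z \<noteq> 0 \<Longrightarrow> measure \<nu> (UNIV \<times> cball (snd z) \<rho>) \<le> \<epsilon>"
    and \<epsilon>: "0 \<le> \<epsilon>"
  shows "\<bar>\<integral>z. g (z 0) * F z \<partial>PiM {..<k} (\<lambda>_. \<nu>)\<bar> \<le> 2 * \<epsilon> * measure \<nu> UNIV"
proof -
  interpret subprob_space \<nu> by fact
  interpret P: product_sigma_finite "\<lambda>_. \<nu>"
    by (rule product_sigma_finite.intro) (rule sigma_finite_measure_axioms)
  note [measurable_cong] = sets
  note [measurable] = g(1)
  have sp: "space \<nu> = UNIV" using sets_eq_imp_space_eq[OF sets] by simp
  have [measurable]: "snd \<in> borel_measurable (borel :: ('a \<times> 'b) measure)"
    by (intro borel_measurable_continuous_onI continuous_intros)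
  let ?M = "measure \<nu> UNIV"
  have M1: "?M \<le> 1" using subprob_measure_le_1 .
  \<comment> \<open>Coordinate 1 is integrated first, with coordinate 0 still fixed among the
    remaining ones.\<close>
  define J where "J = {..<k} - {1}"
  have J: "finite J" "1 \<notin> J" "insert 1 J = {..<k}" "0 \<in> J" "card J \<ge> 1"
    using k by (auto simp: J_def card_Diff_singleton_if)
  \<comment> \<open>The majorant reflects two cases: \<open>F\<close> is at most epsilon when the
    first two points are far apart, and at most 1 when they are near and the cut-off is non-zero.
    Each case contributes one epsilon after integration over coordinate 1.\<close>
  define h :: "(nat \<Rightarrow> 'a \<times> 'b) \<Rightarrow> ennreal" where
    "h z = ennreal \<epsilon> + indicator {z. g (z 0) \<noteq> 0} z * indicator {z. dist (snd (z 0)) (snd (z 1)) \<le> \<rho>} z" for z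
  have z01: "(\<lambda>z. z 0) \<in> measurable (PiM {..<k} (\<lambda>_. \<nu>)) borel" "(\<lambda>z. z 1) \<in> measurable (PiM {..<k} (\<lambda>_. \<nu>)) borel"
    using measurable_component_singleton[of 0 "{..<k}" "\<lambda>_. \<nu>"]
      measurable_component_singleton[of 1 "{..<k}" "\<lambda>_. \<nu>"] k
    by (simp_all add: measurable_cong_sets[OF refl sets])
  note [measurable] = z01
  have h: "h \<in> borel_measurable (PiM {..<k} (\<lambda>_. \<nu>))"
    unfolding h_def indicator_def by measurable
  have "ennreal \<bar>\<integral>z. g (z 0) * F z \<partial>PiM {..<k} (\<lambda>_. \<nu>)\<bar> \<le> (\<integral>\<^sup>+z. ennreal (norm (g (z 0) * F z)) \<partial>PiM {..<k} (\<lambda>_. \<nu>))"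
    using integral_norm_bound_ennreal[of "PiM {..<k} (\<lambda>_. \<nu>)" "\<lambda>z. g (z 0) * F z"]
    by (cases "integrable (PiM {..<k} (\<lambda>_. \<nu>)) (\<lambda>z. g (z 0) * F z)") (auto simp: not_integrable_integral_eq)
  also have "\<dots> \<le> (\<integral>\<^sup>+z. h z \<partial>PiM {..<k} (\<lambda>_. \<nu>))"
  proof (rule nn_integral_mono)
    fix z assume "z \<in> space (PiM {..<k} (\<lambda>_. \<nu>))"
    then have z: "z \<in> seqs k" by (simp add: space_PiM sp)
    have gF: "norm (g (z 0) * F z) \<le> \<bar>F z\<bar>"
      using g(2,3)[of "z 0"] by (simp add: abs_mult mult_left_le_one_le)
    consider "g (z 0) = 0" | "dist (snd (z 0)) (snd (z 1)) > \<rho>"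
      | "g (z 0) \<noteq> 0" "dist (snd (z 0)) (snd (z 1)) \<le> \<rho>" by linarith
    then show "ennreal (norm (g (z 0) * F z)) \<le> h z"
    proof cases
      case 1
      then show ?thesis by simp
    next
      case 2
      then have "norm (g (z 0) * F z) \<le> \<epsilon>" using gF F\<epsilon>[OF z] by linarith
      then show ?thesis unfolding h_def by (meson add_increasing2 ennreal_leI zero_le)
    next
      case 3
      then have "h z = ennreal \<epsilon> + 1" by (simp add: h_def)
      moreover have "ennreal (norm (g (z 0) * F z)) \<le> 1" using gF F1[OF z] by simp
      ultimately show ?thesis by (simp add: add_increasing)
    qed
  qed
  also have "\<dots> = (\<integral>\<^sup>+x. (\<integral>\<^sup>+y. h (x(1 := y)) \<partial>\<nu>) \<partial>PiM J (\<lambda>_. \<nu>))"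
    using P.product_nn_integral_insert[OF J(1,2), of h] h unfolding J(3) by blast
  also have "\<dots> \<le> (\<integral>\<^sup>+x. ennreal (2 * \<epsilon>) \<partial>PiM J (\<lambda>_. \<nu>))"
  proof (rule nn_integral_mono)
    fix x :: "nat \<Rightarrow> 'a \<times> 'b"
    have "(\<integral>\<^sup>+y. h (x(1 := y)) \<partial>\<nu>) = (\<integral>\<^sup>+y. ennreal \<epsilon> + indicator {z. g z \<noteq> 0} (x 0) *
        indicator (UNIV \<times> cball (snd (x 0)) \<rho>) y \<partial>\<nu>)"
      by (intro nn_integral_cong) (auto simp: h_def indicator_def split: prod.splits)
    also have "\<dots> = ennreal \<epsilon> * emeasure \<nu> UNIV + indicator {z. g z \<noteq> 0} (x 0) * emeasure \<nu> (UNIV \<times> cball (snd (x 0)) \<rho>)"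
    proof (subst nn_integral_add)
      have B: "UNIV \<times> cball (snd (x 0)) \<rho> \<in> sets \<nu>"
        by (simp add: sets borel_closed closed_Times)
      then show "(\<lambda>y. indicator {z. g z \<noteq> 0} (x 0) * indicator (UNIV \<times> cball (snd (x 0)) \<rho>) y :: ennreal) \<in> borel_measurable \<nu>"
        by (intro borel_measurable_times_ennreal borel_measurable_const borel_measurable_indicator)
      show "(\<integral>\<^sup>+y. ennreal \<epsilon> \<partial>\<nu>) + (\<integral>\<^sup>+y. indicator {z. g z \<noteq> 0} (x 0) * indicator (UNIV \<times> cball (snd (x 0)) \<rho>) y \<partial>\<nu>) =
        ennreal \<epsilon> * emeasure \<nu> UNIV + indicator {z. g z \<noteq> 0} (x 0) * emeasure \<nu> (UNIV \<times> cball (snd (x 0)) \<rho>)"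
        by (simp only: nn_integral_cmult_indicator[OF B] nn_integral_const sp)
    qed simp
    also have "\<dots> \<le> ennreal \<epsilon> * 1 + ennreal \<epsilon>"
    proof (rule add_mono)
      show "ennreal \<epsilon> * emeasure \<nu> UNIV \<le> ennreal \<epsilon> * 1"
        using emeasure_space_le_1 by (intro mult_left_mono) (simp_all add: sp)
      show "indicator {z. g z \<noteq> 0} (x 0) * emeasure \<nu> (UNIV \<times> cball (snd (x 0)) \<rho>) \<le> ennreal \<epsilon>"
        using light[of "x 0"] by (cases "g (x 0) = 0") (simp_all add: emeasure_eq_measure ennreal_leI)
    qed
    also have "\<dots> = ennreal (2 * \<epsilon>)"
      using \<epsilon> by (simp flip: ennreal_plus)
    finally show "(\<integral>\<^sup>+y. h (x(1 := y)) \<partial>\<nu>) \<le> ennreal (2 * \<epsilon>)" .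
  qed
  also have "(\<integral>\<^sup>+x. ennreal (2 * \<epsilon>) \<partial>PiM J (\<lambda>_. \<nu>)) = ennreal (2 * \<epsilon>) * ennreal (?M ^ card J)"
    using emeasure_PiM_const[OF finite_measure_axioms J(1)] by (simp add: sp)
  also have "\<dots> = ennreal (2 * \<epsilon> * ?M ^ card J)"
    using \<epsilon> by (intro ennreal_mult[symmetric]) auto
  \<comment> \<open>As k is at least 2, \<open>J\<close> is non-empty and one factor of the mass
    survives. This makes the bound summable over infinitely many components.\<close>
  also have "\<dots> \<le> ennreal (2 * \<epsilon> * ?M)"
  proof (intro ennreal_leI mult_left_mono)
    show "?M ^ card J \<le> ?M"
      using power_decreasing[OF J(5) _ M1] by simp
  qed (use \<epsilon> in simp)
  finally show ?thesis using \<epsilon> by (simp add: ennreal_le_iff)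
qed

section \<open>Cut-offs and translation invariant test functions\<close>

definition cutoff :: "real \<Rightarrow> 'b::real_normed_vector \<Rightarrow> real" where
  "cutoff R y = max 0 (min 1 (2 - norm y / R))"

lemma cutoff_bounds: "0 \<le> cutoff R y" "cutoff R y \<le> 1"
  by (simp_all add: cutoff_def)

lemma cutoff_eq_1: "R > 0 \<Longrightarrow> norm y \<le> R \<Longrightarrow> cutoff R y = 1"
  by (simp add: cutoff_def field_simps)

lemma cutoff_eq_0: "R > 0 \<Longrightarrow> norm y \<ge> 2 * R \<Longrightarrow> cutoff R y = 0"
  by (simp add: cutoff_def field_simps)

lemma continuous_on_cutoff [continuous_intros]:
  "continuous_on S f \<Longrightarrow> continuous_on S (\<lambda>x. cutoff R (f x))"
  unfolding cutoff_def divide_inverse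
  by (intro continuous_on_max continuous_on_min continuous_on_const continuous_on_diff
      continuous_on_mult continuous_on_norm)

lemma cutoff_tendsto_1: "(\<lambda>j. cutoff (real j) y) \<longlonglongrightarrow> 1"
proof (rule tendsto_eventually)
  obtain N where N: "norm y \<le> real N" using real_arch_simple by blast
  show "\<forall>\<^sub>F j in sequentially. cutoff (real j) y = 1"
    \<comment> \<open>Starting at \<open>Suc N\<close> keeps the radius positive, as
      \<open>cutoff_eq_1\<close> demands.\<close>
    using eventually_ge_at_top[of "Suc N"]
  proof eventually_elim
    case (elim j)
    then show ?case using N by (intro cutoff_eq_1) auto
  qed
qed

section \<open>Translations acting on measures and on product integrals\<close>

definition translate :: "'b \<Rightarrow> 'a \<times> 'b::real_normed_vector \<Rightarrow> 'a \<times> 'b" where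
  "translate a z = (fst z, snd z - a)"

lemma shift_meas_eq: "shift_meas \<nu> a = distr \<nu> borel (translate a)"
  by (simp add: shift_meas_def translate_def[abs_def] case_prod_unfold)

lemma measurable_translate:
  "translate a \<in> borel_measurable (borel :: ('a::topological_space \<times> 'b::real_normed_vector) measure)"
  unfolding translate_def[abs_def] by (intro borel_measurable_continuous_onI continuous_intros)

lemma sets_shift_meas [simp]: "sets (shift_meas \<nu> a) = sets borel"
  by (simp add: shift_meas_eq)

lemma emeasure_shift_meas:
  assumes "sets \<nu> = sets borel" "A \<in> sets borel"
  shows "emeasure (shift_meas \<nu> a) A = emeasure \<nu> (translate a -` A)"
proof -
  have "translate a \<in> measurable \<nu> borel"
    using measurable_translate by (simp add: measurable_cong_sets[OF assms(1) refl])
  then show ?thesis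
    using sets_eq_imp_space_eq[OF assms(1)] assms(2) by (simp add: shift_meas_eq emeasure_distr)
qed

lemma emeasure_shift_meas_cylinder:
  fixes \<nu> :: "('a::topological_space \<times> 'b::real_normed_vector) measure"
  assumes "sets \<nu> = sets borel" "A \<times> (UNIV :: 'b set) \<in> sets borel"
  shows "emeasure (shift_meas \<nu> a) (A \<times> UNIV) = emeasure \<nu> (A \<times> UNIV)"
proof -
  have "translate a -` (A \<times> UNIV) = A \<times> UNIV" by (auto simp: translate_def)
  then show ?thesis using emeasure_shift_meas[OF assms] by simp
qed

lemma borel_cylinder:
  fixes A :: "'a::topological_space set"
  assumes "A \<in> sets borel"
  shows "A \<times> (UNIV :: 'b::topological_space set) \<in> sets borel"
proof -
  have "(fst :: 'a \<times> 'b \<Rightarrow> 'a) \<in> borel_measurable borel"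
    by (intro borel_measurable_continuous_onI continuous_intros)
  from measurable_sets[OF this assms] show ?thesis by (simp add: fst_vimage_eq_Times)
qed

lemma subprob_space_shift_meas:
  assumes "subprob_space \<nu>" "sets \<nu> = sets borel"
  shows "subprob_space (shift_meas \<nu> a)"
proof -
  have "translate a \<in> measurable \<nu> borel"
    using measurable_translate by (simp add: measurable_cong_sets[OF assms(2) refl])
  then show ?thesis
    unfolding shift_meas_eq by (intro subprob_space.subprob_space_distr assms) simp_all
qed

lemma integral_PiM_shift_meas:
  fixes \<nu> :: "('a::topological_space \<times> 'b::real_normed_vector) measure" and h :: "_ \<Rightarrow> real"
  assumes sub: "subprob_space \<nu>" and sets: "sets \<nu> = sets borel" and I: "finite I"
    and h: "h \<in> borel_measurable (PiM I (\<lambda>_. borel))"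
  shows "integral\<^sup>L (PiM I (\<lambda>_. shift_meas \<nu> a)) h = (\<integral>z. h (\<lambda>i\<in>I. translate a (z i)) \<partial>PiM I (\<lambda>_. \<nu>))"
proof -
  have sp: "space \<nu> = UNIV" using sets_eq_imp_space_eq[OF sets] by simp
  have fin: "finite_measure \<nu>" "finite_measure (shift_meas \<nu> a)"
    using sub subprob_space_shift_meas[OF sub sets] by (auto simp: subprob_space_def)
  have tr: "translate a \<in> measurable \<nu> (shift_meas \<nu> a)"
    using measurable_translate by (simp add: measurable_cong_sets[OF sets sets_shift_meas])
  have "sets (PiM I (\<lambda>_. shift_meas \<nu> a)) = sets (PiM I (\<lambda>_. borel))"
    by (intro sets_PiM_cong) auto
  then have h': "h \<in> borel_measurable (PiM I (\<lambda>_. shift_meas \<nu> a))"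
    using h by (simp cong: measurable_cong_sets)
  have "integral\<^sup>L (PiM I (\<lambda>_. shift_meas \<nu> a)) h =
    (\<integral>z. indicator (PiE I (\<lambda>_. UNIV)) z * h (\<lambda>i\<in>I. translate a (z i)) \<partial>PiM I (\<lambda>_. \<nu>))"
    using sp by (intro integral_PiM_pushforward[OF fin I _ tr _ h']) (auto simp: emeasure_shift_meas[OF sets] sets)
  also have "\<dots> = (\<integral>z. h (\<lambda>i\<in>I. translate a (z i)) \<partial>PiM I (\<lambda>_. \<nu>))"
    by (intro Bochner_Integration.integral_cong) (auto simp: space_PiM sp)
  finally show ?thesis .
qed

text \<open>The form shared by all integrands of \<open>Lam\<close>. Decay is in the mutual
  distances only, so such a function is in general not a \<open>vanishing_test\<close>.\<close>

definition translation_test :: "nat \<Rightarrow> ((nat \<Rightarrow> 'a::topological_space \<times> 'b::real_normed_vector) \<Rightarrow> real) \<Rightarrow> bool" where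
  "translation_test k F \<longleftrightarrow> continuous_on (seqs k) F \<and> (\<forall>z\<in>seqs k. \<bar>F z\<bar> \<le> 1) \<and>
    (\<forall>z\<in>seqs k. \<forall>a. F (\<lambda>i\<in>{..<k}. translate a (z i)) = F z) \<and>
    (\<forall>\<epsilon>>0. \<exists>\<rho>. \<forall>z\<in>seqs k. \<forall>i<k. \<forall>j<k. dist (snd (z i)) (snd (z j)) > \<rho> \<longrightarrow> \<bar>F z\<bar> \<le> \<epsilon>)"

lemma translation_testD:
  assumes "translation_test k F"
  shows "continuous_on (seqs k) F" "\<And>z. z \<in> seqs k \<Longrightarrow> \<bar>F z\<bar> \<le> 1"
    "\<And>z a. z \<in> seqs k \<Longrightarrow> F (\<lambda>i\<in>{..<k}. translate a (z i)) = F z"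
    "\<And>\<epsilon>. \<epsilon> > 0 \<Longrightarrow> \<exists>\<rho>. \<forall>z\<in>seqs k. \<forall>i<k. \<forall>j<k. dist (snd (z i)) (snd (z j)) > \<rho> \<longrightarrow> \<bar>F z\<bar> \<le> \<epsilon>"
proof -
  note T = assms[unfolded translation_test_def]
  note A = conjunct1[OF T] and B = conjunct1[OF conjunct2[OF T]]
    and C = conjunct1[OF conjunct2[OF conjunct2[OF T]]] and D = conjunct2[OF conjunct2[OF conjunct2[OF T]]]
  show "continuous_on (seqs k) F" by (rule A)
  show "\<bar>F z\<bar> \<le> 1" if "z \<in> seqs k" for z by (rule bspec[OF B that])
  show "F (\<lambda>i\<in>{..<k}. translate a (z i)) = F z" if "z \<in> seqs k" for z a
    by (rule spec[OF bspec[OF C that]])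
  show "\<exists>\<rho>. \<forall>z\<in>seqs k. \<forall>i<k. \<forall>j<k. dist (snd (z i)) (snd (z j)) > \<rho> \<longrightarrow> \<bar>F z\<bar> \<le> \<epsilon>" if "\<epsilon> > 0" for \<epsilon>
    by (rule mp[OF spec[OF D] that])
qed

lemma translation_test_product:
  fixes f :: "'a::topological_space \<Rightarrow> real" and W :: "(nat \<Rightarrow> 'b::real_normed_vector) \<Rightarrow> real"
  assumes f: "continuous_on UNIV f" "\<And>x. \<bar>f x\<bar> \<le> 1"
    and W: "W \<in> Ck k" "\<And>y. y \<in> seqs k \<Longrightarrow> \<bar>W y\<bar> \<le> 1"
  shows "translation_test k (\<lambda>z. (\<Prod>l<k. f (fst (z l))) * W (\<lambda>l\<in>{..<k}. snd (z l)))"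
  unfolding translation_test_def
proof (intro conjI ballI allI impI)
  let ?y = "\<lambda>z :: nat \<Rightarrow> 'a \<times> 'b. \<lambda>l\<in>{..<k}. snd (z l)"
  have y: "?y z \<in> seqs k" for z by (simp add: restrict_PiE_iff)
  have prod: "\<bar>\<Prod>l<k. f (fst (z l))\<bar> \<le> 1" for z :: "nat \<Rightarrow> 'a \<times> 'b"
    unfolding abs_prod using f(2) by (intro prod_le_1) auto
  have le: "\<bar>(\<Prod>l<k. f (fst (z l))) * W (?y z)\<bar> \<le> \<bar>W (?y z)\<bar>" for z
    unfolding abs_mult using prod by (intro mult_left_le_one_le) auto
  have coord: "continuous_on (seqs k) (\<lambda>z :: nat \<Rightarrow> 'a \<times> 'b. z i)" for i
    by (rule continuous_on_subset[OF continuous_on_product_coordinates]) simp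
  have "continuous_on (seqs k) (\<lambda>z. ?y z i)" for i
    by (cases "i < k") (auto intro!: continuous_intros coord)
  then have "continuous_on (seqs k) ?y"
    by (rule continuous_on_coordinatewise_then_product)
  moreover have "continuous_on (seqs k) W" using W(1) by (simp add: Ck_def)
  ultimately have "continuous_on (seqs k) (\<lambda>z. W (?y z))"
    using continuous_on_compose2[of "seqs k" W "seqs k" ?y] y by blast
  moreover have "continuous_on (seqs k) (\<lambda>z :: nat \<Rightarrow> 'a \<times> 'b. f (fst (z i)))" for i
    by (rule continuous_on_compose2[OF f(1)]) (auto intro!: continuous_intros coord)
  ultimately show "continuous_on (seqs k) (\<lambda>z. (\<Prod>l<k. f (fst (z l))) * W (?y z))"
    by (intro continuous_on_mult continuous_on_prod)
  show "\<bar>(\<Prod>l<k. f (fst (z l))) * W (?y z)\<bar> \<le> 1" for z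
    using le[of z] W(2)[OF y[of z]] by linarith
  fix z :: "nat \<Rightarrow> 'a \<times> 'b" and a
  have eq: "?y (\<lambda>i\<in>{..<k}. translate a (z i)) = (\<lambda>i\<in>{..<k}. ?y z i + (- a))"
    by (simp add: translate_def cong: restrict_cong)
  have "\<forall>y\<in>seqs k. \<forall>a. W (\<lambda>i\<in>{..<k}. y i + a) = W y" using W(1) by (simp add: Ck_def)
  then have W': "W (\<lambda>i\<in>{..<k}. ?y z i + (- a)) = W (?y z)" using y by blast
  show "(\<Prod>l<k. f (fst ((\<lambda>i\<in>{..<k}. translate a (z i)) l))) * W (?y (\<lambda>i\<in>{..<k}. translate a (z i))) =
      (\<Prod>l<k. f (fst (z l))) * W (?y z)"
    unfolding eq W' by (simp add: translate_def)
next
  let ?y = "\<lambda>z :: nat \<Rightarrow> 'a \<times> 'b. \<lambda>l\<in>{..<k}. snd (z l)"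
  fix \<epsilon> :: real assume "\<epsilon> > 0"
  then have "\<exists>R. \<forall>y\<in>seqs k. (\<exists>i<k. \<exists>j<k. norm (y i - y j) > R) \<longrightarrow> \<bar>W y\<bar> < \<epsilon>"
    using W(1) by (simp add: Ck_def)
  then obtain R where R: "\<And>y. y \<in> seqs k \<Longrightarrow> (\<exists>i<k. \<exists>j<k. norm (y i - y j) > R) \<Longrightarrow> \<bar>W y\<bar> < \<epsilon>"
    by blast
  have prod: "\<bar>\<Prod>l<k. f (fst (z l))\<bar> \<le> 1" for z :: "nat \<Rightarrow> 'a \<times> 'b"
    unfolding abs_prod using f(2) by (intro prod_le_1) auto
  have le: "\<bar>(\<Prod>l<k. f (fst (z l))) * W (?y z)\<bar> \<le> \<bar>W (?y z)\<bar>" for z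
    unfolding abs_mult using prod by (intro mult_left_le_one_le) auto
  have "\<bar>(\<Prod>l<k. f (fst (z l))) * W (?y z)\<bar> \<le> \<epsilon>" if "i < k" "j < k" "dist (snd (z i)) (snd (z j)) > R" for z i j
  proof -
    have "\<exists>i<k. \<exists>j<k. norm (?y z i - ?y z j) > R"
      using that by (intro exI[of _ i] conjI exI[of _ j]) (auto simp: dist_norm)
    then have "\<bar>W (?y z)\<bar> < \<epsilon>" by (intro R) (auto simp: restrict_PiE_iff)
    then show ?thesis using le[of z] by linarith
  qed
  then show "\<exists>\<rho>. \<forall>z\<in>seqs k. \<forall>i<k. \<forall>j<k. \<rho> < dist (snd (z i)) (snd (z j)) \<longrightarrow>
      \<bar>(\<Prod>l<k. f (fst (z l))) * W (?y z)\<bar> \<le> \<epsilon>" by blast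
qed

text \<open>The first point is confined to the ball of radius 2R. If any other point has norm above
  rho + 2R, it is farther than rho from the first, where \<open>F\<close> is already small.\<close>

lemma vanishing_test_cutoff:
  assumes F: "translation_test k F" and k: "0 < k" and R: "R > 0"
  shows "vanishing_test k (\<lambda>z. cutoff R (snd (z 0)) * F z)"
  unfolding vanishing_test_def
proof (intro conjI allI impI)
  have coord: "continuous_on (seqs k) (\<lambda>z :: nat \<Rightarrow> 'a \<times> 'b. z i)" for i
    by (rule continuous_on_subset[OF continuous_on_product_coordinates]) simp
  show "continuous_on (seqs k) (\<lambda>z. cutoff R (snd (z 0)) * F z)"
    by (intro continuous_intros coord translation_testD(1)[OF F])
  have le: "\<bar>cutoff R (snd (z 0)) * F z\<bar> \<le> \<bar>F z\<bar>" for z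
    unfolding abs_mult using cutoff_bounds[of R "snd (z 0)"] by (intro mult_left_le_one_le) auto
  then show "\<exists>B. \<forall>z\<in>seqs k. \<bar>cutoff R (snd (z 0)) * F z\<bar> \<le> B"
    using order_trans[OF le translation_testD(2)[OF F]] by blast
  fix \<epsilon> :: real assume "\<epsilon> > 0"
  from translation_testD(4)[OF F this] obtain \<rho> where \<rho>: "\<And>z i j. z \<in> seqs k \<Longrightarrow> i < k \<Longrightarrow> j < k \<Longrightarrow>
      dist (snd (z i)) (snd (z j)) > \<rho> \<Longrightarrow> \<bar>F z\<bar> \<le> \<epsilon>"
    by blast
  have "\<bar>cutoff R (snd (z 0)) * F z\<bar> \<le> \<epsilon>" if z: "z \<in> seqs k" "i < k" "norm (snd (z i)) > \<rho> + 2 * R" for z i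
  proof (cases "norm (snd (z 0)) \<ge> 2 * R")
    case True
    then show ?thesis using cutoff_eq_0[OF R, of "snd (z 0)"] \<open>\<epsilon> > 0\<close> by simp
  next
    case False
    then have "dist (snd (z i)) (snd (z 0)) > \<rho>"
      using z(3) norm_triangle_ineq2[of "snd (z i)" "snd (z 0)"] by (simp add: dist_norm)
    then show ?thesis using \<rho>[OF z(1,2) k] le[of z] by linarith
  qed
  then show "\<exists>R'. \<forall>z\<in>seqs k. (\<exists>i<k. R' < norm (snd (z i))) \<longrightarrow> \<bar>cutoff R (snd (z 0)) * F z\<bar> \<le> \<epsilon>"
    by (intro exI[of _ "\<rho> + 2 * R"]) blast
qed

section \<open>Approximation of Lambda by finitely many cut-off integrals\<close>

lemma integrable_bounded_PiM:
  fixes h :: "_ \<Rightarrow> real"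
  assumes "finite_measure \<nu>" "sets \<nu> = sets borel" "finite I"
    and h: "h \<in> borel_measurable (PiM I (\<lambda>_. borel))" "\<And>z. z \<in> PiE I (\<lambda>_. UNIV) \<Longrightarrow> \<bar>h z\<bar> \<le> B"
  shows "integrable (PiM I (\<lambda>_. \<nu>)) h"
proof -
  interpret P: finite_measure "PiM I (\<lambda>_. \<nu>)"
    by (rule finite_measure_PiM[OF assms(1,3)])
  have "sets (PiM I (\<lambda>_. \<nu>)) = sets (PiM I (\<lambda>_. borel))"
    by (intro sets_PiM_cong) (auto simp: assms(2))
  then have "h \<in> borel_measurable (PiM I (\<lambda>_. \<nu>))"
    using h(1) by (simp cong: measurable_cong_sets)
  moreover have "space \<nu> = UNIV" using sets_eq_imp_space_eq[OF assms(2)] by simp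
  ultimately show ?thesis
    using h(2) by (intro P.integrable_const_bound[of _ B]) (auto simp: space_PiM)
qed

text \<open>A cut-off vanishes from distance 2R on, so centres of one component more than 4R apart
  have cut-offs with disjoint supports: at most one summand is non-zero at any point.\<close>

lemma sum_cutoff_separated:
  fixes c :: "nat \<Rightarrow> nat \<times> 'b::real_normed_vector"
  assumes R: "R > 0" and Q: "finite Q"
    and sep: "\<And>p q. p \<in> Q \<Longrightarrow> q \<in> Q \<Longrightarrow> p \<noteq> q \<Longrightarrow> fst (c p) = fst (c q) \<Longrightarrow> dist (snd (c p)) (snd (c q)) > 4 * R"
  defines "s \<equiv> \<lambda>i y. \<Sum>q\<in>Q. if fst (c q) = i then cutoff R (y - snd (c q)) else 0"
  shows "0 \<le> s i y" "s i y \<le> 1"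
    and "q \<in> Q \<Longrightarrow> fst (c q) = i \<Longrightarrow> dist y (snd (c q)) \<le> R \<Longrightarrow> s i y = 1"
proof -
  show s0: "0 \<le> s i y" unfolding s_def by (intro sum_nonneg) (simp add: cutoff_bounds)
  show s1: "s i y \<le> 1"
  proof (cases "\<exists>q\<in>Q. (if fst (c q) = i then cutoff R (y - snd (c q)) else 0) \<noteq> 0")
    case True
    then obtain q where q: "q \<in> Q" "fst (c q) = i" "cutoff R (y - snd (c q)) \<noteq> 0" by (auto split: if_splits)
    have near: "dist y (snd (c q)) < 2 * R"
      using cutoff_eq_0[OF R, of "y - snd (c q)"] q(3) by (force simp: dist_norm)
    have "(if fst (c p) = i then cutoff R (y - snd (c p)) else 0) = 0" if "p \<in> Q - {q}" for p
    proof -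
      have "cutoff R (y - snd (c p)) = 0" if "fst (c p) = i"
      proof -
        have "dist (snd (c p)) (snd (c q)) > 4 * R" using sep[of p q] q that \<open>p \<in> Q - {q}\<close> by auto
        then have "dist y (snd (c p)) \<ge> 2 * R"
          using near dist_triangle3[of "snd (c p)" "snd (c q)" y] by linarith
        then show ?thesis by (intro cutoff_eq_0[OF R]) (simp add: dist_norm)
      qed
      then show ?thesis by simp
    qed
    then have "s i y = (if fst (c q) = i then cutoff R (y - snd (c q)) else 0)"
      unfolding s_def using sum.remove[OF Q q(1), of "\<lambda>q. if fst (c q) = i then cutoff R (y - snd (c q)) else 0"]
      by simp
    then show ?thesis by (simp add: cutoff_bounds)
  next
    case False
    then have "s i y = 0" unfolding s_def by (intro sum.neutral) blast
    then show ?thesis by simp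
  qed
  assume q: "q \<in> Q" "fst (c q) = i" "dist y (snd (c q)) \<le> R"
  then have "1 = (if fst (c q) = i then cutoff R (y - snd (c q)) else 0)"
    using cutoff_eq_1[OF R, of "y - snd (c q)"] by (simp add: dist_norm)
  also have "\<dots> \<le> s i y"
    unfolding s_def using Q q by (intro member_le_sum) (auto simp: cutoff_bounds)
  finally show "s i y = 1" using s1 by simp
qed

lemma mass_summable:
  assumes "\<And>i. finite_measure (\<mu> i)" and mass: "(\<Sum>i. emeasure (\<mu> i) UNIV) \<le> 1"
  shows "summable (\<lambda>i. measure (\<mu> i) UNIV)" "(\<Sum>i. measure (\<mu> i) UNIV) \<le> 1"
proof -
  have eq: "(\<Sum>i. ennreal (measure (\<mu> i) UNIV)) = (\<Sum>i. emeasure (\<mu> i) UNIV)"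
    using assms(1) by (simp add: finite_measure.emeasure_eq_measure)
  then have nt: "(\<Sum>i. ennreal (measure (\<mu> i) UNIV)) \<noteq> top"
    using mass by (auto simp: top_unique)
  show "summable (\<lambda>i. measure (\<mu> i) UNIV)"
    by (rule summable_suminf_not_top[OF _ nt]) simp
  have "ennreal (\<Sum>i. measure (\<mu> i) UNIV) \<le> 1"
    using suminf_ennreal[OF _ nt] eq mass by simp
  then show "(\<Sum>i. measure (\<mu> i) UNIV) \<le> 1" by simp
qed

text \<open>The light-part estimate with cut-off 1 and the trivial threshold 1. Its linearity in the
  mass yields absolute convergence of the series that define Lambda.\<close>

lemma integral_translation_test_le:
  fixes \<nu> :: "('a::{metric_space, second_countable_topology} \<times> 'b::euclidean_space) measure"
  assumes F: "translation_test k F" and k: "2 \<le> k" and \<nu>: "subprob_space \<nu>" "sets \<nu> = sets borel"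
  shows "\<bar>integral\<^sup>L (PiM {..<k} (\<lambda>_. \<nu>)) F\<bar> \<le> 2 * measure \<nu> UNIV"
proof -
  interpret subprob_space \<nu> by fact
  have "sets (PiM {..<k} (\<lambda>_. \<nu>)) = sets (PiM {..<k} (\<lambda>_. borel))"
    by (intro sets_PiM_cong) (auto simp: \<nu>)
  then have "F \<in> borel_measurable (PiM {..<k} (\<lambda>_. \<nu>))"
    using measurable_continuous_on_seqs[OF translation_testD(1)[OF F]] by (simp cong: measurable_cong_sets)
  then have "\<bar>\<integral>z. 1 * F z \<partial>PiM {..<k} (\<lambda>_. \<nu>)\<bar> \<le> 2 * 1 * measure \<nu> UNIV"
    by (intro integral_light_part_le[OF \<nu> k, where g="\<lambda>_. 1" and \<rho>=0])
      (auto intro: translation_testD(2)[OF F] subprob_measure_le_1)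
  then show ?thesis by simp
qed

text \<open>The weight \<open>1 - s\<close> that is left after the cut-offs are removed vanishes
  within distance R of each centre in the component, so it lives where balls of radius rho have mass
  at most epsilon. The light-part estimate is linear in the mass and sums to at most 2 epsilon over
  all components.\<close>

lemma suminf_integral_near_cutoff_sum:
  fixes \<mu> :: "nat \<Rightarrow> ('a::{metric_space, second_countable_topology} \<times> 'b::euclidean_space) measure"
    and c :: "nat \<Rightarrow> nat \<times> 'b"
  assumes F: "translation_test k F" and k: "2 \<le> k"
    and sub: "\<And>i. subprob_space (\<mu> i)" and sets: "\<And>i. sets (\<mu> i) = sets borel"
    and mass: "(\<Sum>i. emeasure (\<mu> i) UNIV) \<le> 1"
    and R: "R > 0" and Q: "finite Q"
    and sep: "\<And>p q. p \<in> Q \<Longrightarrow> q \<in> Q \<Longrightarrow> p \<noteq> q \<Longrightarrow> fst (c p) = fst (c q) \<Longrightarrow> dist (snd (c p)) (snd (c q)) > 4 * R"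
    and \<epsilon>: "0 \<le> \<epsilon>"
    and heavy: "\<And>i y. measure (\<mu> i) (UNIV \<times> cball y \<rho>) > \<epsilon> \<Longrightarrow> \<exists>q\<in>Q. fst (c q) = i \<and> dist y (snd (c q)) \<le> R"
    and F\<epsilon>: "\<And>z. z \<in> seqs k \<Longrightarrow> dist (snd (z 0)) (snd (z 1)) > \<rho> \<Longrightarrow> \<bar>F z\<bar> \<le> \<epsilon>"
  shows "\<bar>(\<Sum>i. integral\<^sup>L (PiM {..<k} (\<lambda>_. \<mu> i)) F) -
    (\<Sum>q\<in>Q. \<integral>z. cutoff R (snd (z 0) - snd (c q)) * F z \<partial>PiM {..<k} (\<lambda>_. \<mu> (fst (c q))))\<bar> \<le> 2 * \<epsilon>"
proof -
  define J where "J i q = (\<integral>z. cutoff R (snd (z 0) - snd (c q)) * F z \<partial>PiM {..<k} (\<lambda>_. \<mu> i))" for i q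
  define I where "I i = integral\<^sup>L (PiM {..<k} (\<lambda>_. \<mu> i)) F" for i
  define s where "s i y = (\<Sum>q\<in>Q. if fst (c q) = i then cutoff R (y - snd (c q)) else 0)" for i y
  have s: "0 \<le> s i y" "s i y \<le> 1" for i y
    unfolding s_def by (rule sum_cutoff_separated(1,2)[OF R Q], erule (3) sep)+
  have s1: "s i y = 1" if "q \<in> Q" "fst (c q) = i" "dist y (snd (c q)) \<le> R" for i y q
    unfolding s_def by (rule sum_cutoff_separated(3)[where c=c and q=q, OF R Q]) (erule (3) sep, simp_all add: that)
  have fin: "finite_measure (\<mu> i)" for i using sub[of i] by (simp add: subprob_space_def)
  note M = mass_summable[of \<mu>, OF fin mass]
  have Fm: "F \<in> borel_measurable (PiM {..<k} (\<lambda>_. borel))"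
    by (rule measurable_continuous_on_seqs[OF translation_testD(1)[OF F]])
  have coord: "continuous_on (seqs k) (\<lambda>z :: nat \<Rightarrow> 'a \<times> 'b. z 0)"
    by (rule continuous_on_subset[OF continuous_on_product_coordinates]) simp
  have Jint: "integrable (PiM {..<k} (\<lambda>_. \<mu> i)) (\<lambda>z. cutoff R (snd (z 0) - snd (c q)) * F z)" for i q
  proof (rule integrable_bounded_PiM[OF fin sets finite_lessThan])
    show "(\<lambda>z. cutoff R (snd (z 0) - snd (c q)) * F z) \<in> borel_measurable (PiM {..<k} (\<lambda>_. borel))"
      by (intro measurable_continuous_on_seqs continuous_intros coord translation_testD(1)[OF F])
    fix z :: "nat \<Rightarrow> 'a \<times> 'b" assume z: "z \<in> seqs k"
    show "\<bar>cutoff R (snd (z 0) - snd (c q)) * F z\<bar> \<le> 1"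
      using translation_testD(2)[OF F z] cutoff_bounds[of R "snd (z 0) - snd (c q)"]
      by (simp add: abs_mult mult_le_one)
  qed
  have Jint': "integrable (PiM {..<k} (\<lambda>_. \<mu> i))
      (\<lambda>z. if fst (c q) = i then cutoff R (snd (z 0) - snd (c q)) * F z else 0)" for i q
    by (cases "fst (c q) = i") (simp_all add: Jint)
  have Iint: "integrable (PiM {..<k} (\<lambda>_. \<mu> i)) F" for i
    by (rule integrable_bounded_PiM[OF fin sets finite_lessThan Fm translation_testD(2)[OF F]])
  have diff: "I i - (\<Sum>q\<in>Q. if i = fst (c q) then J i q else 0) =
      (\<integral>z. (1 - s i (snd (z 0))) * F z \<partial>PiM {..<k} (\<lambda>_. \<mu> i))" for i
  proof -
    have "(\<Sum>q\<in>Q. if i = fst (c q) then J i q else 0) =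
      (\<Sum>q\<in>Q. \<integral>z. (if fst (c q) = i then cutoff R (snd (z 0) - snd (c q)) * F z else 0) \<partial>PiM {..<k} (\<lambda>_. \<mu> i))"
      by (intro sum.cong) (auto simp: J_def)
    also have "\<dots> = (\<integral>z. (\<Sum>q\<in>Q. if fst (c q) = i then cutoff R (snd (z 0) - snd (c q)) * F z else 0) \<partial>PiM {..<k} (\<lambda>_. \<mu> i))"
      by (rule Bochner_Integration.integral_sum[symmetric]) (rule Jint')
    also have "I i - \<dots> = (\<integral>z. F z - (\<Sum>q\<in>Q. if fst (c q) = i then cutoff R (snd (z 0) - snd (c q)) * F z else 0) \<partial>PiM {..<k} (\<lambda>_. \<mu> i))"
      unfolding I_def
      by (intro Bochner_Integration.integral_diff[symmetric] Bochner_Integration.integrable_sum Iint Jint')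
    also have "\<dots> = (\<integral>z. (1 - s i (snd (z 0))) * F z \<partial>PiM {..<k} (\<lambda>_. \<mu> i))"
      by (intro Bochner_Integration.integral_cong refl)
        (auto simp: s_def sum_distrib_right left_diff_distrib intro!: sum.cong)
    finally show ?thesis .
  qed
  have small: "\<bar>I i - (\<Sum>q\<in>Q. if i = fst (c q) then J i q else 0)\<bar> \<le> 2 * \<epsilon> * measure (\<mu> i) UNIV" for i
    unfolding diff
  proof (rule integral_light_part_le[OF sub sets k, where g="\<lambda>z. 1 - s i (snd z)" and \<rho>=\<rho>])
    have "sets (PiM {..<k} (\<lambda>_. \<mu> i)) = sets (PiM {..<k} (\<lambda>_. borel))"
      by (intro sets_PiM_cong) (auto simp: sets)
    then show "F \<in> borel_measurable (PiM {..<k} (\<lambda>_. \<mu> i))"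
      using Fm by (simp cong: measurable_cong_sets)
    have "continuous_on UNIV (\<lambda>z :: 'a \<times> 'b. if fst (c q) = i then cutoff R (snd z - snd (c q)) else 0)" for q
      by (cases "fst (c q) = i") (auto intro!: continuous_intros)
    then show "(\<lambda>z :: 'a \<times> 'b. 1 - s i (snd z)) \<in> borel_measurable borel"
      unfolding s_def by (intro borel_measurable_continuous_onI continuous_on_diff continuous_on_const continuous_on_sum)
    show "measure (\<mu> i) (UNIV \<times> cball (snd z) \<rho>) \<le> \<epsilon>" if "1 - s i (snd z) \<noteq> 0" for z :: "'a \<times> 'b"
      using heavy[of i "snd z"] s1[of _ i "snd z"] that by fastforce
    show "0 \<le> 1 - s i (snd z)" "1 - s i (snd z) \<le> 1" for z :: "'a \<times> 'b"
      using s(1,2)[of i "snd z"] by simp_all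
  qed (use translation_testD(2)[OF F] F\<epsilon> \<epsilon> in auto)
  have "summable I"
    by (rule summable_comparison_test'[OF summable_mult[OF M(1), of 2]])
      (simp add: I_def integral_translation_test_le[OF F k sub sets])
  then have "I sums (\<Sum>i. I i)" by (rule summable_sums)
  \<comment> \<open>Each centre belongs to one component, so the series over components collapses to
    the finite sum over centres.\<close>
  moreover have "(\<lambda>i. \<Sum>q\<in>Q. if i = fst (c q) then J i q else 0) sums (\<Sum>q\<in>Q. J (fst (c q)) q)"
    by (rule sums_sum) (rule sums_single)
  ultimately have sums: "(\<lambda>i. I i - (\<Sum>q\<in>Q. if i = fst (c q) then J i q else 0)) sums
      ((\<Sum>i. I i) - (\<Sum>q\<in>Q. J (fst (c q)) q))"
    by (rule sums_diff)
  have sM: "(\<lambda>i. 2 * \<epsilon> * measure (\<mu> i) UNIV) sums (2 * \<epsilon> * (\<Sum>i. measure (\<mu> i) UNIV))"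
    by (intro sums_mult summable_sums M(1))
  have up: "(\<Sum>i. I i) - (\<Sum>q\<in>Q. J (fst (c q)) q) \<le> 2 * \<epsilon> * (\<Sum>i. measure (\<mu> i) UNIV)"
    by (rule sums_le[OF abs_le_D1[OF small] sums sM])
  have lo: "- (2 * \<epsilon> * (\<Sum>i. measure (\<mu> i) UNIV)) \<le> (\<Sum>i. I i) - (\<Sum>q\<in>Q. J (fst (c q)) q)"
  proof (rule sums_le[OF _ sums_minus[OF sM] sums])
    show "- (2 * \<epsilon> * measure (\<mu> i) UNIV) \<le> I i - (\<Sum>q\<in>Q. if i = fst (c q) then J i q else 0)" for i
      using abs_le_D2[OF small[of i]] by linarith
  qed
  have "2 * \<epsilon> * (\<Sum>i. measure (\<mu> i) UNIV) \<le> 2 * \<epsilon>"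
    using M(2) \<epsilon> by (intro mult_left_le) auto
  with up lo show ?thesis unfolding I_def J_def by linarith
qed

section \<open>Limits along centres\<close>

text \<open>The situation after passing to a subsequence. \<open>c n p\<close> pairs a component
  index with a position in the Euclidean factor, and the code \<open>p = prod_encode (m, j)\<close>
  stands for centre j of level m, so that one natural number runs through all centres of all levels.
  Heavy balls of level m are caught by codes with j at most m.\<close>

locale centred_limits =
  fixes \<mu> :: "nat \<Rightarrow> nat \<Rightarrow> ('a::polish_space \<times> 'b::euclidean_space) measure"
    and \<beta> :: "nat \<Rightarrow> 'a measure" and \<beta>\<^sub>0 :: "'a measure"
    and c :: "nat \<Rightarrow> nat \<Rightarrow> nat \<times> 'b"
    and lam :: "nat \<Rightarrow> ('a \<times> 'b) measure"
  assumes sub: "\<And>n i. subprob_space (\<mu> n i)" and sets: "\<And>n i. sets (\<mu> n i) = sets borel"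
    and prob: "\<And>n. prob_space (\<beta> n)" and sets_\<beta>: "\<And>n. sets (\<beta> n) = sets borel"
    and marginal: "\<And>n A. A \<in> sets borel \<Longrightarrow> (\<Sum>i. emeasure (\<mu> n i) (A \<times> UNIV)) \<le> emeasure (\<beta> n) A"
    and prob0: "prob_space \<beta>\<^sub>0" and sets_\<beta>0: "sets \<beta>\<^sub>0 = sets borel"
    and weak: "\<And>g. continuous_on UNIV g \<Longrightarrow> bounded (range g) \<Longrightarrow>
      (\<lambda>n. integral\<^sup>L (\<beta> n) g) \<longlonglongrightarrow> (integral\<^sup>L \<beta>\<^sub>0 g :: real)"
    and heavy: "\<And>n m i y. measure (\<mu> n i) (UNIV \<times> cball y (real (Suc m))) > 1 / real (Suc m) \<Longrightarrow>
      \<exists>j\<le>m. fst (c n (prod_encode (m, j))) = i \<and> dist y (snd (c n (prod_encode (m, j)))) \<le> 2 * real (Suc m)"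
    and sub_lam: "\<And>p. subprob_space (lam p)" and sets_lam: "\<And>p. sets (lam p) = sets borel"
    and vague: "\<And>p. vague_conv (\<lambda>n. shift_meas (\<mu> n (fst (c n p))) (snd (c n p))) (lam p)"
    and dichotomy: "\<And>p q. (\<exists>V. \<forall>\<^sub>F n in sequentially. fst (c n p) = fst (c n q) \<and> dist (snd (c n p)) (snd (c n q)) \<le> V) \<or>
      (\<forall>V. \<forall>\<^sub>F n in sequentially. \<not> (fst (c n p) = fst (c n q) \<and> dist (snd (c n p)) (snd (c n q)) \<le> V))"
begin

section \<open>Classes of centres that stay together\<close>

definition close :: "nat \<Rightarrow> nat \<Rightarrow> bool" where
  "close p q \<longleftrightarrow> (\<exists>V. \<forall>\<^sub>F n in sequentially. fst (c n p) = fst (c n q) \<and> dist (snd (c n p)) (snd (c n q)) \<le> V)"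

text \<open>The least code of each class of close centres. Taking representatives among the codes
  keeps the natural numbers as index set of the limit collection.\<close>

definition leaders :: "nat set" where
  "leaders = {q. \<forall>p<q. \<not> close p q}"

lemma close_refl: "close p p"
  unfolding close_def by (intro exI[of _ 0]) simp

lemma close_sym: "close p q \<Longrightarrow> close q p"
  unfolding close_def by (simp add: dist_commute eq_commute)

lemma close_trans:
  assumes "close p q" "close q r"
  shows "close p r"
proof -
  obtain V V' where V: "\<forall>\<^sub>F n in sequentially. fst (c n p) = fst (c n q) \<and> dist (snd (c n p)) (snd (c n q)) \<le> V"
    and V': "\<forall>\<^sub>F n in sequentially. fst (c n q) = fst (c n r) \<and> dist (snd (c n q)) (snd (c n r)) \<le> V'"
    using assms unfolding close_def by blast
  from V V' have "\<forall>\<^sub>F n in sequentially. fst (c n p) = fst (c n r) \<and> dist (snd (c n p)) (snd (c n r)) \<le> V + V'"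
  proof eventually_elim
    case (elim n)
    then show ?case using dist_triangle[of "snd (c n p)" "snd (c n r)" "snd (c n q)"] by auto
  qed
  then show ?thesis unfolding close_def by blast
qed

lemma ex_leader: "\<exists>q\<in>leaders. close p q"
proof -
  define q where "q = (LEAST q. close q p)"
  have q: "close q p" unfolding q_def by (rule LeastI[of "\<lambda>q. close q p", OF close_refl])
  have "\<not> close p' q" if "p' < q" for p'
  proof
    assume "close p' q"
    then have "close p' p" using close_trans q by blast
    then show False using not_less_Least[of p' "\<lambda>q. close q p"] that by (simp add: q_def)
  qed
  then show ?thesis using close_sym[OF q] by (auto simp: leaders_def)
qed

text \<open>Failure of closeness alone only says that no bound holds eventually; the dichotomy
  strengthens it to drifting apart beyond every bound.\<close>

lemma leaders_far:
  assumes "p \<in> leaders" "q \<in> leaders" "p \<noteq> q"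
  shows "\<forall>\<^sub>F n in sequentially. fst (c n p) = fst (c n q) \<longrightarrow> dist (snd (c n p)) (snd (c n q)) > V"
proof -
  have "\<not> close p q"
    using assms close_sym unfolding leaders_def by (cases p q rule: linorder_cases) auto
  then have "\<forall>\<^sub>F n in sequentially. \<not> (fst (c n p) = fst (c n q) \<and> dist (snd (c n p)) (snd (c n q)) \<le> V)"
    using dichotomy[of p q] unfolding close_def by blast
  then show ?thesis by eventually_elim auto
qed

lemma leaders_separated:
  assumes "finite Q" "Q \<subseteq> leaders"
  shows "\<forall>\<^sub>F n in sequentially. \<forall>p\<in>Q. \<forall>q\<in>Q. p \<noteq> q \<longrightarrow> fst (c n p) = fst (c n q) \<longrightarrow>
    dist (snd (c n p)) (snd (c n q)) > V"
proof (intro eventually_ball_finite ballI assms)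
  fix p q assume "p \<in> Q" "q \<in> Q"
  then show "\<forall>\<^sub>F n in sequentially. p \<noteq> q \<longrightarrow> fst (c n p) = fst (c n q) \<longrightarrow> dist (snd (c n p)) (snd (c n q)) > V"
    using leaders_far[of p q V] assms by (cases "p = q") auto
qed

text \<open>Invariance of \<open>F\<close> moves the translation from the measure to the cut-off.
  The cut-off around a moving centre thus becomes a fixed vanishing test function for the recentred
  measures.\<close>

lemma cutoff_integral_tendsto:
  assumes F: "translation_test k F" and k: "0 < k" and R: "R > 0"
  shows "(\<lambda>n. \<integral>z. cutoff R (snd (z 0) - snd (c n q)) * F z \<partial>PiM {..<k} (\<lambda>_. \<mu> n (fst (c n q)))) \<longlonglongrightarrow>
    (\<integral>z. cutoff R (snd (z 0)) * F z \<partial>PiM {..<k} (\<lambda>_. lam q))"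
proof -
  let ?h = "\<lambda>z. cutoff R (snd (z 0)) * F z"
  have van: "vanishing_test k ?h" by (rule vanishing_test_cutoff[OF F k R])
  then have "continuous_on (seqs k) ?h" by (simp add: vanishing_test_def)
  then have m: "?h \<in> borel_measurable (PiM {..<k} (\<lambda>_. borel))"
    by (rule measurable_continuous_on_seqs)
  have eq: "integral\<^sup>L (PiM {..<k} (\<lambda>_. shift_meas (\<mu> n i) a)) ?h =
      (\<integral>z. cutoff R (snd (z 0) - a) * F z \<partial>PiM {..<k} (\<lambda>_. \<mu> n i))" for n i a
  proof -
    have "space (\<mu> n i) = UNIV" using sets_eq_imp_space_eq[OF sets] by simp
    then have "z \<in> seqs k" if "z \<in> space (PiM {..<k} (\<lambda>_. \<mu> n i))" for z
      using that by (simp add: space_PiM)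
    then show ?thesis
      unfolding integral_PiM_shift_meas[OF sub sets finite_lessThan m]
      using k by (intro Bochner_Integration.integral_cong refl)
        (simp add: translation_testD(3)[OF F], simp add: translate_def)
  qed
  have "(\<lambda>n. integral\<^sup>L (PiM {..<k} (\<lambda>_. shift_meas (\<mu> n (fst (c n q))) (snd (c n q)))) ?h) \<longlonglongrightarrow>
      integral\<^sup>L (PiM {..<k} (\<lambda>_. lam q)) ?h"
    using vague[of q] van unfolding vague_conv_def by blast
  then show ?thesis unfolding eq .
qed

section \<open>The marginal bound for the limit measures\<close>

lemma sum_marginals_le:
  assumes "finite J" "A \<in> sets borel"
  shows "(\<Sum>i\<in>J. measure (\<mu> n i) (A \<times> UNIV)) \<le> measure (\<beta> n) A"
proof -
  interpret B: prob_space "\<beta> n" by (rule prob)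
  have fin: "finite_measure (\<mu> n i)" for i using sub[of n i] by (simp add: subprob_space_def)
  have "ennreal (\<Sum>i\<in>J. measure (\<mu> n i) (A \<times> UNIV)) = (\<Sum>i\<in>J. emeasure (\<mu> n i) (A \<times> UNIV))"
    by (simp add: finite_measure.emeasure_eq_measure[OF fin])
  also have "\<dots> \<le> (\<Sum>i. emeasure (\<mu> n i) (A \<times> UNIV))"
    using assms(1) by (intro sum_le_suminf) auto
  also have "\<dots> \<le> emeasure (\<beta> n) A" by (rule marginal[OF assms(2)])
  finally show ?thesis by (simp add: B.emeasure_eq_measure)
qed

text \<open>The closed set separates the two test functions, so that the marginal bound, which is
  only known for sets, can be applied before the limit.\<close>

lemma sum_limit_marginals_le_integral:
  fixes g h :: "'a \<Rightarrow> real"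
  assumes Q: "finite Q" "Q \<subseteq> leaders" and C: "closed C"
    and g: "continuous_on UNIV g" "\<And>x. 0 \<le> g x" "\<And>x. g x \<le> indicator C x"
    and h: "continuous_on UNIV h" "\<And>x. indicator C x \<le> h x" "\<And>x. h x \<le> 1"
  shows "(\<Sum>q\<in>Q. \<integral>z. g (fst z) \<partial>lam q) \<le> integral\<^sup>L \<beta>\<^sub>0 h"
proof -
  define F :: "(nat \<Rightarrow> 'a \<times> 'b) \<Rightarrow> real" where "F z = g (fst (z 0))" for z
  have g1: "g x \<le> 1" for x using order_trans[OF g(3)[of x] indicator_le_1] .
  have h0: "0 \<le> h x" for x using order_trans[OF indicator_pos_le h(2)[of x]] .
  have CB: "C \<in> sets borel" using C by simp
  have cg: "norm (cutoff R y * g x) \<le> 1" for R x and y :: 'b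
    using mult_le_one[OF cutoff_bounds(2)[of R y] g(2)[of x] g1[of x]]
      mult_nonneg_nonneg[OF cutoff_bounds(1)[of R y] g(2)[of x]] by simp
  have coord: "continuous_on (seqs 1) (\<lambda>z :: nat \<Rightarrow> 'a \<times> 'b. z 0)"
    by (rule continuous_on_subset[OF continuous_on_product_coordinates]) simp
  \<comment> \<open>With a single point the decay in mutual distances is vacuous, so a function of
    the first factor alone qualifies and the convergence of cut-off integrals covers it.\<close>
  have F: "translation_test 1 F"
    unfolding translation_test_def
  proof (intro conjI ballI allI impI)
    show "continuous_on (seqs 1) F"
      unfolding F_def
      by (rule continuous_on_compose2[OF g(1)], intro continuous_on_fst coord, simp)
    show "\<bar>F z\<bar> \<le> 1" for z using g(2) g1 by (simp add: F_def)
    show "F (\<lambda>i\<in>{..<1}. translate a (z i)) = F z" for z a by (simp add: F_def translate_def)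
    show "\<exists>\<rho>. \<forall>z\<in>seqs 1. \<forall>i<1. \<forall>j<1. \<rho> < dist (snd (z i)) (snd (z j)) \<longrightarrow> \<bar>F z\<bar> \<le> \<epsilon>" for \<epsilon>
      by (intro exI[of _ 0]) simp
  qed
  have cutg: "continuous_on UNIV (\<lambda>z :: 'a \<times> 'b. cutoff R (snd z - a) * g (fst z))" for R a
    by (intro continuous_intros continuous_on_compose2[OF g(1)]) auto
  have single: "(\<integral>z. cutoff R (snd (z 0) - a) * F z \<partial>PiM {..<1} (\<lambda>_. \<nu>)) =
      (\<integral>z. cutoff R (snd z - a) * g (fst z) \<partial>\<nu>)"
    if "subprob_space \<nu>" "sets \<nu> = sets borel" for \<nu> :: "('a \<times> 'b) measure" and a :: 'b and R
  proof -
    interpret subprob_space \<nu> by fact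
    interpret P: product_sigma_finite "\<lambda>_. \<nu>"
      by (rule product_sigma_finite.intro) (rule sigma_finite_measure_axioms)
    have "(\<lambda>z. cutoff R (snd z - a) * g (fst z)) \<in> borel_measurable \<nu>"
      using borel_measurable_continuous_onI[OF cutg] by (simp add: measurable_cong_sets[OF that(2) refl])
    from P.product_integral_singleton[OF this, of 0]
    show ?thesis by (simp add: F_def lessThan_Suc)
  qed
  have fin_lam: "finite_measure (lam q)" for q using sub_lam[of q] by (simp add: subprob_space_def)
  have fin: "finite_measure (\<mu> n i)" for n i using sub[of n i] by (simp add: subprob_space_def)
  have bound: "(\<Sum>q\<in>Q. \<integral>z. cutoff R (snd z) * g (fst z) \<partial>lam q) \<le> integral\<^sup>L \<beta>\<^sub>0 h" if R: "R > 0" for R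
  proof (rule LIMSEQ_le)
    show "(\<lambda>n. \<Sum>q\<in>Q. \<integral>z. cutoff R (snd z - snd (c n q)) * g (fst z) \<partial>\<mu> n (fst (c n q))) \<longlonglongrightarrow>
        (\<Sum>q\<in>Q. \<integral>z. cutoff R (snd z) * g (fst z) \<partial>lam q)"
    proof (rule tendsto_sum)
      fix q
      show "(\<lambda>n. \<integral>z. cutoff R (snd z - snd (c n q)) * g (fst z) \<partial>\<mu> n (fst (c n q))) \<longlonglongrightarrow>
        (\<integral>z. cutoff R (snd z) * g (fst z) \<partial>lam q)"
        using cutoff_integral_tendsto[OF F _ R, of q] single[OF sub sets] single[OF sub_lam sets_lam, where a=0]
        by simp
    qed
    show "(\<lambda>n. integral\<^sup>L (\<beta> n) h) \<longlonglongrightarrow> integral\<^sup>L \<beta>\<^sub>0 h"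
      using h0 h(3) by (intro weak h(1) boundedI[of _ 1]) auto
    have "\<forall>\<^sub>F n in sequentially. \<forall>p\<in>Q. \<forall>q\<in>Q. p \<noteq> q \<longrightarrow> fst (c n p) = fst (c n q) \<longrightarrow>
        dist (snd (c n p)) (snd (c n q)) > 4 * R"
      by (rule leaders_separated[OF Q])
    then have "\<forall>\<^sub>F n in sequentially. (\<Sum>q\<in>Q. \<integral>z. cutoff R (snd z - snd (c n q)) * g (fst z) \<partial>\<mu> n (fst (c n q))) \<le> integral\<^sup>L (\<beta> n) h"
    proof eventually_elim
      case (elim n)
      interpret B: prob_space "\<beta> n" by (rule prob)
      \<comment> \<open>Once the leaders are 4R apart, the cut-offs in a component sum to at most 1,
        so the parts cut out around different leaders do not count any mass twice.\<close>
      define s where "s i y = (\<Sum>q\<in>Q. if fst (c n q) = i then cutoff R (y - snd (c n q)) else 0)" for i y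
      have s: "0 \<le> s i y" "s i y \<le> 1" for i y
        unfolding s_def by (rule sum_cutoff_separated(1,2)[OF R Q(1)]; use elim in blast)+
      have int: "integrable (\<mu> n i) (\<lambda>z. cutoff R (snd z - a) * g (fst z))" for i a
      proof (rule finite_measure.integrable_const_bound[OF fin, where B=1])
        show "AE z in \<mu> n i. norm (cutoff R (snd z - a) * g (fst z)) \<le> 1"
          by (rule AE_I2) (rule cg)
        show "(\<lambda>z. cutoff R (snd z - a) * g (fst z)) \<in> borel_measurable (\<mu> n i)"
          using borel_measurable_continuous_onI[OF cutg] by (simp add: measurable_cong_sets[OF sets refl])
      qed
      have part: "(\<Sum>q\<in>{q\<in>Q. fst (c n q) = i}. \<integral>z. cutoff R (snd z - snd (c n q)) * g (fst z) \<partial>\<mu> n (fst (c n q)))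
          \<le> measure (\<mu> n i) (C \<times> UNIV)" for i
      proof -
        have "(\<Sum>q\<in>{q\<in>Q. fst (c n q) = i}. \<integral>z. cutoff R (snd z - snd (c n q)) * g (fst z) \<partial>\<mu> n (fst (c n q))) =
          (\<Sum>q\<in>{q\<in>Q. fst (c n q) = i}. \<integral>z. cutoff R (snd z - snd (c n q)) * g (fst z) \<partial>\<mu> n i)"
          by (intro sum.cong) auto
        also have "\<dots> = (\<integral>z. (\<Sum>q\<in>{q\<in>Q. fst (c n q) = i}. cutoff R (snd z - snd (c n q)) * g (fst z)) \<partial>\<mu> n i)"
          by (rule Bochner_Integration.integral_sum[symmetric]) (rule int)
        also have "\<dots> \<le> (\<integral>z. indicator (C \<times> UNIV) z \<partial>\<mu> n i)"
        proof (rule integral_mono)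
          show "integrable (\<mu> n i) (\<lambda>z. indicator (C \<times> UNIV) z :: real)"
            using borel_cylinder[OF CB] finite_measure.emeasure_finite[OF fin]
            by (intro integrable_real_indicator) (simp_all add: sets less_top)
          fix z
          have "(\<Sum>q\<in>{q\<in>Q. fst (c n q) = i}. cutoff R (snd z - snd (c n q)) * g (fst z)) = s i (snd z) * g (fst z)"
            unfolding s_def sum_distrib_right using Q(1)
            by (intro sum.mono_neutral_cong_left) auto
          also have "\<dots> \<le> g (fst z)"
            using s[of i "snd z"] g(2)[of "fst z"] by (intro mult_left_le_one_le)
          also have "\<dots> \<le> indicator (C \<times> UNIV) z"
            using g(3)[of "fst z"] by (simp add: indicator_def mem_Times_iff)
          finally show "(\<Sum>q\<in>{q\<in>Q. fst (c n q) = i}. cutoff R (snd z - snd (c n q)) * g (fst z)) \<le> indicator (C \<times> UNIV) z" .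
        qed (intro Bochner_Integration.integrable_sum int)
        also have "\<dots> = measure (\<mu> n i) (C \<times> UNIV)"
          using sets_eq_imp_space_eq[OF sets[of n i]] by simp
        finally show ?thesis .
      qed
      have "(\<Sum>q\<in>Q. \<integral>z. cutoff R (snd z - snd (c n q)) * g (fst z) \<partial>\<mu> n (fst (c n q))) =
        (\<Sum>i\<in>(\<lambda>q. fst (c n q)) ` Q. \<Sum>q\<in>{q\<in>Q. fst (c n q) = i}. \<integral>z. cutoff R (snd z - snd (c n q)) * g (fst z) \<partial>\<mu> n (fst (c n q)))"
        using Q(1) by (intro sum.group[symmetric]) auto
      also have "\<dots> \<le> (\<Sum>i\<in>(\<lambda>q. fst (c n q)) ` Q. measure (\<mu> n i) (C \<times> UNIV))"
        by (intro sum_mono part)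
      also have "\<dots> \<le> measure (\<beta> n) C"
        using Q(1) CB by (intro sum_marginals_le) auto
      also have "\<dots> = integral\<^sup>L (\<beta> n) (indicator C)"
        using sets_eq_imp_space_eq[OF sets_\<beta>[of n]] by simp
      also have "\<dots> \<le> integral\<^sup>L (\<beta> n) h"
      proof (rule integral_mono)
        show "integrable (\<beta> n) (indicator C :: 'a \<Rightarrow> real)"
          using CB by (intro integrable_real_indicator) (simp_all add: sets_\<beta> B.emeasure_eq_measure)
        have "h \<in> borel_measurable (\<beta> n)"
          using borel_measurable_continuous_onI[OF h(1)] by (simp add: measurable_cong_sets[OF sets_\<beta> refl])
        then show "integrable (\<beta> n) h"
          using h0 h(3) by (intro B.integrable_const_bound[of _ 1]) auto
      qed (rule h(2))
      finally show ?case .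
    qed
    then show "\<exists>N. \<forall>n\<ge>N. (\<Sum>q\<in>Q. \<integral>z. cutoff R (snd z - snd (c n q)) * g (fst z) \<partial>\<mu> n (fst (c n q))) \<le> integral\<^sup>L (\<beta> n) h"
      by (simp add: eventually_sequentially)
  qed
  \<comment> \<open>The bound is uniform in R, so the cut-off can now be removed;
    \<open>Suc j\<close> keeps the radius positive.\<close>
  have "(\<lambda>j. \<Sum>q\<in>Q. \<integral>z. cutoff (real (Suc j)) (snd z) * g (fst z) \<partial>lam q) \<longlonglongrightarrow> (\<Sum>q\<in>Q. \<integral>z. 1 * g (fst z) \<partial>lam q)"
  proof (rule tendsto_sum)
    fix q
    have m: "(\<lambda>z. cutoff (real (Suc j)) (snd z) * g (fst z)) \<in> borel_measurable (lam q)" for j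
      using borel_measurable_continuous_onI[OF cutg[of _ 0]] by (simp add: measurable_cong_sets[OF sets_lam refl])
    have lim: "(\<lambda>j. cutoff (real (Suc j)) (snd z) * g (fst z)) \<longlonglongrightarrow> 1 * g (fst z)" for z :: "'a \<times> 'b"
      by (intro tendsto_mult tendsto_const LIMSEQ_Suc[OF cutoff_tendsto_1])
    show "(\<lambda>j. \<integral>z. cutoff (real (Suc j)) (snd z) * g (fst z) \<partial>lam q) \<longlonglongrightarrow> (\<integral>z. 1 * g (fst z) \<partial>lam q)"
    proof (rule integral_dominated_convergence[where w="\<lambda>_. 1"])
      show "(\<lambda>z. 1 * g (fst z)) \<in> borel_measurable (lam q)"
        by (rule borel_measurable_LIMSEQ_metric[OF m lim])
      show "integrable (lam q) (\<lambda>_. 1 :: real)"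
        using finite_measure.integrable_const[OF fin_lam] by blast
      show "AE z in lam q. norm (cutoff (real (Suc j)) (snd z) * g (fst z)) \<le> 1" for j
        by (rule AE_I2) (rule cg)
    qed (use m lim in auto)
  qed
  moreover have "\<exists>N. \<forall>j\<ge>N. (\<Sum>q\<in>Q. \<integral>z. cutoff (real (Suc j)) (snd z) * g (fst z) \<partial>lam q) \<le> integral\<^sup>L \<beta>\<^sub>0 h"
    using bound by auto
  ultimately show ?thesis
    using LIMSEQ_le_const2 by fastforce
qed

text \<open>An open set is exhausted from inside by pairs of continuous functions with a closed set
  between them; the lower functions tend pointwise to its indicator, and the upper ones stay below
  it.\<close>

lemma sum_limit_marginals_le_open:
  assumes Q: "finite Q" "Q \<subseteq> leaders" and U: "open U"
  shows "(\<Sum>q\<in>Q. measure (lam q) (U \<times> UNIV)) \<le> measure \<beta>\<^sub>0 U"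
proof -
  interpret B: prob_space \<beta>\<^sub>0 by (rule prob0)
  have fin_lam: "finite_measure (lam q)" for q using sub_lam[of q] by (simp add: subprob_space_def)
  \<comment> \<open>The distance \<open>infdist\<close> to the empty set is 0, so the whole space is
    treated separately.\<close>
  define d where "d x = (if U = UNIV then 1 else infdist x (- U))" for x
  have cd: "continuous_on UNIV d"
    unfolding d_def[abs_def] by (cases "U = UNIV") (auto intro!: continuous_intros)
  have d0: "0 \<le> d x" for x by (simp add: d_def infdist_nonneg)
  have dU: "0 < d x \<longleftrightarrow> x \<in> U" for x
  proof (cases "U = UNIV")
    case False
    then have "- U \<noteq> {}" "closed (- U)" using U by auto
    then have "infdist x (- U) = 0 \<longleftrightarrow> x \<in> - U" using in_closed_iff_infdist_zero[of "- U" x] by blast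
    then show ?thesis using False infdist_nonneg[of x "- U"] by (auto simp: d_def)
  qed (simp add: d_def)
  \<comment> \<open>The shift by 1 makes \<open>g m\<close> vanish outside the closed set
    \<open>C m\<close>, on which \<open>h m\<close> already equals 1.\<close>
  define g where "g m x = max 0 (min 1 (real m * d x - 1))" for m x
  define h where "h m x = min 1 (real m * d x)" for m x
  define C where "C m = {x. 1 \<le> real m * d x}" for m
  have cg: "continuous_on UNIV (g m)" and ch: "continuous_on UNIV (h m)" for m
    unfolding g_def[abs_def] h_def[abs_def] by (intro continuous_intros cd)+
  have C: "closed (C m)" for m
    unfolding C_def by (intro closed_Collect_le continuous_intros cd)
  have g: "0 \<le> g m x" "g m x \<le> indicator (C m) x" "g m x \<le> 1" for m x
    by (auto simp: g_def C_def indicator_def)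
  have h: "indicator (C m) x \<le> h m x" "h m x \<le> 1" for m x
    using d0[of x] by (auto simp: h_def C_def indicator_def)
  have h0: "0 \<le> h m x" for m x using d0[of x] by (simp add: h_def)
  have hU: "h m x \<le> indicator U x" for m x
  proof (cases "x \<in> U")
    case False
    then have "d x = 0" using dU[of x] d0[of x] by linarith
    then show ?thesis using False by (simp add: h_def)
  qed (simp add: h_def)
  have le: "(\<Sum>q\<in>Q. \<integral>z. g m (fst z) \<partial>lam q) \<le> measure \<beta>\<^sub>0 U" for m
  proof -
    have "(\<Sum>q\<in>Q. \<integral>z. g m (fst z) \<partial>lam q) \<le> integral\<^sup>L \<beta>\<^sub>0 (h m)"
      by (rule sum_limit_marginals_le_integral[OF Q C[of m] cg g(1,2) ch h])
    also have "\<dots> \<le> integral\<^sup>L \<beta>\<^sub>0 (indicator U)"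
    proof (rule integral_mono)
      show "integrable \<beta>\<^sub>0 (indicator U :: 'a \<Rightarrow> real)"
        using U by (intro integrable_real_indicator) (simp_all add: sets_\<beta>0 B.emeasure_eq_measure)
      have "h m \<in> borel_measurable \<beta>\<^sub>0"
        using borel_measurable_continuous_onI[OF ch] by (simp add: measurable_cong_sets[OF sets_\<beta>0 refl])
      then show "integrable \<beta>\<^sub>0 (h m)"
        using h0 h(2) by (intro B.integrable_const_bound[of _ 1]) auto
    qed (rule hU)
    also have "\<dots> = measure \<beta>\<^sub>0 U" using sets_eq_imp_space_eq[OF sets_\<beta>0] by simp
    finally show ?thesis .
  qed
  have "(\<lambda>m. \<Sum>q\<in>Q. \<integral>z. g m (fst z) \<partial>lam q) \<longlonglongrightarrow> (\<Sum>q\<in>Q. \<integral>z. indicator (U \<times> UNIV) z \<partial>lam q)"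
  proof (rule tendsto_sum)
    fix q
    have "continuous_on UNIV (\<lambda>z :: 'a \<times> 'b. g m (fst z))" for m
      by (rule continuous_on_compose2[OF cg]) (auto intro!: continuous_intros)
    then have m: "(\<lambda>z. g m (fst z)) \<in> borel_measurable (lam q)" for m
      using borel_measurable_continuous_onI by (auto simp: measurable_cong_sets[OF sets_lam refl])
    have lim: "(\<lambda>m. g m (fst z)) \<longlonglongrightarrow> indicator (U \<times> UNIV) z" for z :: "'a \<times> 'b"
    proof (cases "fst z \<in> U")
      case True
      then have "d (fst z) > 0" by (simp add: dU)
      then obtain N where N: "2 / d (fst z) \<le> real N" using real_arch_simple by blast
      have "\<forall>\<^sub>F m in sequentially. g m (fst z) = 1"
        using eventually_ge_at_top[of N]
      proof eventually_elim
        case (elim m)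
        then have "2 / d (fst z) \<le> real m" using N by linarith
        then have "2 \<le> real m * d (fst z)" using \<open>d (fst z) > 0\<close> by (simp add: pos_divide_le_eq)
        then show ?case by (simp add: g_def)
      qed
      then show ?thesis using True by (intro tendsto_eventually) (simp add: mem_Times_iff)
    next
      case False
      then have "d (fst z) = 0" using dU[of "fst z"] d0[of "fst z"] by linarith
      then show ?thesis using False by (simp add: g_def mem_Times_iff)
    qed
    show "(\<lambda>m. \<integral>z. g m (fst z) \<partial>lam q) \<longlonglongrightarrow> (\<integral>z. indicator (U \<times> UNIV) z \<partial>lam q)"
    proof (rule integral_dominated_convergence[where w="\<lambda>_. 1"])
      show "(\<lambda>z. indicator (U \<times> UNIV) z :: real) \<in> borel_measurable (lam q)"
        by (rule borel_measurable_LIMSEQ_metric[OF m lim])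
      show "integrable (lam q) (\<lambda>_. 1 :: real)"
        using finite_measure.integrable_const[OF fin_lam] by blast
      show "AE z in lam q. norm (g m (fst z)) \<le> 1" for m
        using g by (intro AE_I2) (simp add: abs_of_nonneg)
    qed (use m lim in auto)
  qed
  then have "(\<Sum>q\<in>Q. \<integral>z. indicator (U \<times> UNIV) z \<partial>lam q) \<le> measure \<beta>\<^sub>0 U"
    by (rule LIMSEQ_le_const2) (use le in blast)
  then show ?thesis
    using sets_eq_imp_space_eq[OF sets_lam] by simp
qed

text \<open>Every open superset of \<open>A\<close> bounds the left side, and outer regularity of
  the limit law brings this bound down to \<open>A\<close> itself.\<close>

lemma sum_limit_marginals_le:
  assumes Q: "finite Q" "Q \<subseteq> leaders" and A: "A \<in> sets borel"
  shows "(\<Sum>q\<in>Q. emeasure (lam q) (A \<times> UNIV)) \<le> emeasure \<beta>\<^sub>0 A"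
proof -
  interpret B: prob_space \<beta>\<^sub>0 by (rule prob0)
  have fin_lam: "finite_measure (lam q)" for q using sub_lam[of q] by (simp add: subprob_space_def)
  have "(\<Sum>q\<in>Q. emeasure (lam q) (A \<times> UNIV)) \<le> emeasure \<beta>\<^sub>0 U" if U: "A \<subseteq> U" "open U" for U
  proof -
    have "(\<Sum>q\<in>Q. emeasure (lam q) (A \<times> UNIV)) \<le> (\<Sum>q\<in>Q. emeasure (lam q) (U \<times> UNIV))"
      using U borel_cylinder[of U] by (intro sum_mono emeasure_mono) (auto simp: sets_lam)
    also have "\<dots> = ennreal (\<Sum>q\<in>Q. measure (lam q) (U \<times> UNIV))"
      by (simp add: finite_measure.emeasure_eq_measure[OF fin_lam])
    also have "\<dots> \<le> emeasure \<beta>\<^sub>0 U"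
      using sum_limit_marginals_le_open[OF Q U(2)] by (simp add: B.emeasure_eq_measure ennreal_leI)
    finally show ?thesis .
  qed
  then have "(\<Sum>q\<in>Q. emeasure (lam q) (A \<times> UNIV)) \<le> (INF U\<in>{U. A \<subseteq> U \<and> open U}. emeasure \<beta>\<^sub>0 U)"
    by (intro INF_greatest) auto
  also have "\<dots> = emeasure \<beta>\<^sub>0 A"
    by (rule outer_regular[OF sets_\<beta>0 _ A, symmetric]) simp
  finally show ?thesis .
qed

text \<open>The null measure at codes that are not leaders is the padding allowed by the encoding of
  collections as sequences of orbits, so no enumeration of the leaders is made.\<close>

definition limit_family :: "nat \<Rightarrow> ('a \<times> 'b) measure" where
  "limit_family q = (if q \<in> leaders then lam q else null_measure borel)"

lemma sets_limit_family: "sets (limit_family q) = sets borel"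
  by (simp add: limit_family_def sets_lam)

lemma subprob_limit_family: "subprob_space (limit_family q)"
  by (cases "q \<in> leaders") (auto simp: limit_family_def sub_lam intro!: subprob_spaceI)

lemma limit_family_marginal:
  assumes "A \<in> sets borel"
  shows "(\<Sum>q. emeasure (limit_family q) (A \<times> UNIV)) \<le> emeasure \<beta>\<^sub>0 A"
proof (rule suminf_le_const)
  fix n
  have "(\<Sum>q<n. emeasure (limit_family q) (A \<times> UNIV)) = (\<Sum>q\<in>{..<n} \<inter> leaders. emeasure (lam q) (A \<times> UNIV))"
    unfolding sum.inter_restrict[OF finite_lessThan] by (intro sum.cong) (auto simp: limit_family_def)
  also have "\<dots> \<le> emeasure \<beta>\<^sub>0 A"
    by (rule sum_limit_marginals_le[OF _ _ assms]) auto
  finally show "(\<Sum>q<n. emeasure (limit_family q) (A \<times> UNIV)) \<le> emeasure \<beta>\<^sub>0 A" .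
qed simp

text \<open>Both series are compared with cut-off integrals around a finite set of leaders. This set
  is large enough to catch all heavy balls of level m and to exhaust the limit series up to
  epsilon.\<close>

lemma suminf_integral_tendsto:
  assumes F: "translation_test k F" and k: "2 \<le> k"
  shows "(\<lambda>n. \<Sum>i. integral\<^sup>L (PiM {..<k} (\<lambda>_. \<mu> n i)) F) \<longlonglongrightarrow>
    (\<Sum>q. integral\<^sup>L (PiM {..<k} (\<lambda>_. limit_family q)) F)"
proof (rule tendstoI)
  fix r :: real assume "r > 0"
  \<comment> \<open>The errors are 2 epsilon for the light part and less than epsilon each for the
    limit in n, the removal of the cut-off and the tail of the limit series: less than 5 epsilon in
    total.\<close>
  define \<epsilon> where "\<epsilon> = r / 8"
  have \<epsilon>: "\<epsilon> > 0" using \<open>r > 0\<close> by (simp add: \<epsilon>_def)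
  have k0: "0 < k" using k by simp
  interpret B: prob_space \<beta>\<^sub>0 by (rule prob0)
  define L where "L q = integral\<^sup>L (PiM {..<k} (\<lambda>_. limit_family q)) F" for q
  have Lle: "\<bar>L q\<bar> \<le> 2 * measure (limit_family q) UNIV" for q
    unfolding L_def by (rule integral_translation_test_le[OF F k subprob_limit_family sets_limit_family])
  have L0: "L q = 0" if "q \<notin> leaders" for q
    using Lle[of q] that by (simp add: limit_family_def measure_def)
  have fin_lim: "finite_measure (limit_family q)" for q
    using subprob_limit_family[of q] by (simp add: subprob_space_def)
  have mass0: "(\<Sum>q. emeasure (limit_family q) UNIV) \<le> 1"
    using limit_family_marginal[of UNIV] B.emeasure_space_1 sets_eq_imp_space_eq[OF sets_\<beta>0] by simp
  have "summable L"
    by (rule summable_comparison_test'[OF summable_mult[OF mass_summable(1)[OF fin_lim mass0], of 2]])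
      (simp add: Lle)
  then have Lsum: "(\<lambda>N. \<Sum>q<N. L q) \<longlonglongrightarrow> suminf L" by (rule summable_LIMSEQ)
  from translation_testD(4)[OF F \<epsilon>] obtain \<rho>\<^sub>0 where \<rho>0: "\<And>z i j. z \<in> seqs k \<Longrightarrow> i < k \<Longrightarrow> j < k \<Longrightarrow> dist (snd (z i)) (snd (z j)) > \<rho>\<^sub>0 \<Longrightarrow> \<bar>F z\<bar> \<le> \<epsilon>"
    by blast
  obtain m1 where m1: "\<rho>\<^sub>0 \<le> real m1" using real_arch_simple by blast
  obtain m2 where m2: "1 / \<epsilon> \<le> real m2" using real_arch_simple by blast
  \<comment> \<open>The level exceeds both the decay distance of \<open>F\<close> and 1/epsilon,
    since radius and threshold of a level are tied together.\<close>
  define m where "m = max m1 m2"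
  define \<rho> where "\<rho> = real (Suc m)"
  have \<rho>: "\<rho>\<^sub>0 \<le> \<rho>" "\<rho> > 0" using m1 by (auto simp: \<rho>_def m_def)
  have "1 / \<epsilon> \<le> real (Suc m)" using m2 by (simp add: m_def)
  then have m\<epsilon>: "1 / real (Suc m) \<le> \<epsilon>" using \<epsilon> by (simp add: field_simps)
  have F\<epsilon>: "\<bar>F z\<bar> \<le> \<epsilon>" if "z \<in> seqs k" "dist (snd (z 0)) (snd (z 1)) > \<rho>" for z
    using \<rho>0[of z 0 1] that k \<rho>(1) by simp
  have "\<forall>j. \<exists>q. q \<in> leaders \<and> close (prod_encode (m, j)) q" using ex_leader by blast
  then obtain l where l: "\<And>j. l j \<in> leaders" "\<And>j. close (prod_encode (m, j)) (l j)" by metis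
  then have "\<forall>j. \<exists>V. \<forall>\<^sub>F n in sequentially. fst (c n (prod_encode (m, j))) = fst (c n (l j)) \<and>
      dist (snd (c n (prod_encode (m, j)))) (snd (c n (l j))) \<le> V"
    unfolding close_def by blast
  from choice[OF this] obtain V where V: "\<And>j. \<forall>\<^sub>F n in sequentially. fst (c n (prod_encode (m, j))) = fst (c n (l j)) \<and>
      dist (snd (c n (prod_encode (m, j)))) (snd (c n (l j))) \<le> V j" by blast
  \<comment> \<open>The centre of a heavy ball is within 2 rho of a selected centre, which is
    eventually within \<open>V j\<close> of its leader; the sum bounds all of the \<open>V j\<close>
    at once.\<close>
  define R\<^sub>0 where "R\<^sub>0 = 2 * \<rho> + (\<Sum>j\<le>m. \<bar>V j\<bar>)"
  have VR: "2 * \<rho> + V j \<le> R\<^sub>0" if "j \<le> m" for j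
    using member_le_sum[of j "{..m}" "\<lambda>j. \<bar>V j\<bar>"] that by (simp add: R\<^sub>0_def)
  have "\<forall>\<^sub>F N in sequentially. dist (\<Sum>q<N. L q) (suminf L) < \<epsilon>" using tendstoD[OF Lsum \<epsilon>] .
  moreover have "\<forall>\<^sub>F N in sequentially. \<forall>j\<in>{..m}. l j < N"
    by (intro eventually_ball_finite ballI eventually_gt_at_top) simp
  ultimately have "\<forall>\<^sub>F N in sequentially. dist (\<Sum>q<N. L q) (suminf L) < \<epsilon> \<and> (\<forall>j\<in>{..m}. l j < N)"
    by (rule eventually_conj)
  from eventually_happens'[OF sequentially_bot this]
  obtain N where N: "dist (\<Sum>q<N. L q) (suminf L) < \<epsilon>" "\<And>j. j \<le> m \<Longrightarrow> l j < N"
    by auto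
  \<comment> \<open>\<open>N\<close> was taken beyond the leaders of all m+1 centres of level m, so
    these leaders all belong to \<open>Q\<close>.\<close>
  define Q where "Q = {..<N} \<inter> leaders"
  have Q: "finite Q" "Q \<subseteq> leaders" "\<And>j. j \<le> m \<Longrightarrow> l j \<in> Q" using N(2) l(1) by (auto simp: Q_def)
  have LQ: "(\<Sum>q<N. L q) = (\<Sum>q\<in>Q. L q)"
    unfolding Q_def by (rule sum.mono_neutral_right) (auto intro: L0)
  define K where "K R q = (\<integral>z. cutoff R (snd (z 0)) * F z \<partial>PiM {..<k} (\<lambda>_. lam q))" for R q
  have "(\<lambda>j. \<Sum>q\<in>Q. K (real j) q) \<longlonglongrightarrow> (\<Sum>q\<in>Q. L q)"
  proof (rule tendsto_sum)
    fix q assume "q \<in> Q"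
    then have Lq: "L q = (\<integral>z. F z \<partial>PiM {..<k} (\<lambda>_. lam q))"
      using Q(2) by (auto simp: L_def limit_family_def)
    have fl: "finite_measure (lam q)" using sub_lam[of q] by (simp add: subprob_space_def)
    interpret P: finite_measure "PiM {..<k} (\<lambda>_. lam q)" by (rule finite_measure_PiM[OF fl finite_lessThan])
    have spq: "space (lam q) = UNIV" using sets_eq_imp_space_eq[OF sets_lam] by simp
    have ms: "measurable (PiM {..<k} (\<lambda>_. lam q)) borel = measurable (PiM {..<k} (\<lambda>_. borel)) (borel :: real measure)"
      by (intro measurable_cong_sets sets_PiM_cong refl sets_lam)
    have coord: "continuous_on (seqs k) (\<lambda>z :: nat \<Rightarrow> 'a \<times> 'b. z 0)"
      by (rule continuous_on_subset[OF continuous_on_product_coordinates]) simp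
    show "(\<lambda>j. K (real j) q) \<longlonglongrightarrow> L q"
      unfolding K_def Lq
    proof (rule integral_dominated_convergence[where w="\<lambda>_. 1"])
      show "F \<in> borel_measurable (PiM {..<k} (\<lambda>_. lam q))"
        unfolding ms by (rule measurable_continuous_on_seqs[OF translation_testD(1)[OF F]])
      show "(\<lambda>z. cutoff (real j) (snd (z 0)) * F z) \<in> borel_measurable (PiM {..<k} (\<lambda>_. lam q))" for j
        unfolding ms by (intro measurable_continuous_on_seqs continuous_intros coord translation_testD(1)[OF F])
      show "integrable (PiM {..<k} (\<lambda>_. lam q)) (\<lambda>_. 1 :: real)" by (rule P.integrable_const)
      show "AE z in PiM {..<k} (\<lambda>_. lam q). (\<lambda>j. cutoff (real j) (snd (z 0)) * F z) \<longlonglongrightarrow> F z"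
      proof (rule AE_I2)
        show "(\<lambda>j. cutoff (real j) (snd (z 0)) * F z) \<longlonglongrightarrow> F z" for z
          using tendsto_mult[OF cutoff_tendsto_1[of "snd (z 0)"] tendsto_const[of "F z"]] by simp
      qed
      show "AE z in PiM {..<k} (\<lambda>_. lam q). norm (cutoff (real j) (snd (z 0)) * F z) \<le> 1" for j
      proof (rule AE_I2)
        fix z assume "z \<in> space (PiM {..<k} (\<lambda>_. lam q))"
        then have "z \<in> seqs k" by (simp add: space_PiM spq)
        from translation_testD(2)[OF F this] show "norm (cutoff (real j) (snd (z 0)) * F z) \<le> 1"
          using cutoff_bounds[of "real j" "snd (z 0)"] by (simp add: abs_mult mult_le_one)
      qed
    qed
  qed
  from tendstoD[OF this \<epsilon>] obtain j\<^sub>0 where j0: "\<And>j. j \<ge> j\<^sub>0 \<Longrightarrow> dist (\<Sum>q\<in>Q. K (real j) q) (\<Sum>q\<in>Q. L q) < \<epsilon>"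
    unfolding eventually_sequentially by blast
  obtain j1 :: nat where j1: "R\<^sub>0 \<le> real j1" using real_arch_simple by blast
  define R where "R = real (Suc (max j\<^sub>0 j1))"
  have R: "R > 0" "R\<^sub>0 \<le> R" using j1 by (auto simp: R_def)
  have KR: "dist (\<Sum>q\<in>Q. K R q) (\<Sum>q\<in>Q. L q) < \<epsilon>" unfolding R_def by (rule j0) simp
  define J where "J n q = (\<integral>z. cutoff R (snd (z 0) - snd (c n q)) * F z \<partial>PiM {..<k} (\<lambda>_. \<mu> n (fst (c n q))))" for n q
  have "(\<lambda>n. \<Sum>q\<in>Q. J n q) \<longlonglongrightarrow> (\<Sum>q\<in>Q. K R q)"
    unfolding J_def K_def by (intro tendsto_sum cutoff_integral_tendsto F k0 R)
  from tendstoD[OF this \<epsilon>]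
  have "\<forall>\<^sub>F n in sequentially. dist (\<Sum>q\<in>Q. J n q) (\<Sum>q\<in>Q. K R q) < \<epsilon>" .
  moreover have "\<forall>\<^sub>F n in sequentially. \<forall>p\<in>Q. \<forall>q\<in>Q. p \<noteq> q \<longrightarrow> fst (c n p) = fst (c n q) \<longrightarrow>
        dist (snd (c n p)) (snd (c n q)) > 4 * R"
    by (rule leaders_separated[OF Q(1,2)])
  moreover have "\<forall>\<^sub>F n in sequentially. \<forall>j\<in>{..m}. fst (c n (prod_encode (m, j))) = fst (c n (l j)) \<and>
      dist (snd (c n (prod_encode (m, j)))) (snd (c n (l j))) \<le> V j"
    by (intro eventually_ball_finite ballI V) simp
  ultimately show "\<forall>\<^sub>F n in sequentially. dist (\<Sum>i. integral\<^sup>L (PiM {..<k} (\<lambda>_. \<mu> n i)) F)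
      (\<Sum>q. integral\<^sup>L (PiM {..<k} (\<lambda>_. limit_family q)) F) < r"
  proof eventually_elim
    case (elim n)
    have hv: "\<exists>q\<in>Q. fst (c n q) = i \<and> dist y (snd (c n q)) \<le> R"
      if h: "measure (\<mu> n i) (UNIV \<times> cball y \<rho>) > \<epsilon>" for i y
    proof -
      have "measure (\<mu> n i) (UNIV \<times> cball y (real (Suc m))) > 1 / real (Suc m)"
        using h m\<epsilon> unfolding \<rho>_def by linarith
      from heavy[OF this] obtain j where j: "j \<le> m" "fst (c n (prod_encode (m, j))) = i"
        "dist y (snd (c n (prod_encode (m, j)))) \<le> 2 * \<rho>" unfolding \<rho>_def by blast
      have cl: "fst (c n (prod_encode (m, j))) = fst (c n (l j))"
        "dist (snd (c n (prod_encode (m, j)))) (snd (c n (l j))) \<le> V j"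
        using elim(3) j(1) by auto
      have "dist y (snd (c n (l j))) \<le> 2 * \<rho> + V j"
        using dist_triangle[of y "snd (c n (l j))" "snd (c n (prod_encode (m, j)))"] j(3) cl(2) by linarith
      then have "dist y (snd (c n (l j))) \<le> R" using VR[OF j(1)] R(2) by linarith
      then show ?thesis using Q(3)[OF j(1)] cl(1) j(2) by (intro bexI[of _ "l j"]) auto
    qed
    have mass: "(\<Sum>i. emeasure (\<mu> n i) UNIV) \<le> 1"
      using marginal[of UNIV n] prob_space.emeasure_space_1[OF prob] sets_eq_imp_space_eq[OF sets_\<beta>] by simp
    have "\<bar>(\<Sum>i. integral\<^sup>L (PiM {..<k} (\<lambda>_. \<mu> n i)) F) - (\<Sum>q\<in>Q. J n q)\<bar> \<le> 2 * \<epsilon>"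
      unfolding J_def
      by (rule suminf_integral_near_cutoff_sum[OF F k sub sets mass R(1) Q(1) _ less_imp_le[OF \<epsilon>] hv F\<epsilon>])
        (use elim(2) in auto)
    moreover have "suminf L = (\<Sum>q. integral\<^sup>L (PiM {..<k} (\<lambda>_. limit_family q)) F)"
      by (simp add: L_def[abs_def])
    ultimately show ?case
      using elim(1) KR N(1) LQ \<epsilon> unfolding dist_real_def \<epsilon>_def by linarith
  qed
qed

end

section \<open>Extraction of subsequences\<close>

text \<open>The diagonal sequence is a subsequence of the k-th extracted sequence only from some
  index on. Stability under subsequences gives the property for that tail, and \<open>tail\<close>
  extends it to the whole sequence.\<close>

lemma ex_common_subseq:
  fixes P :: "nat \<Rightarrow> (nat \<Rightarrow> nat) \<Rightarrow> bool"
  assumes ex: "\<And>k s. strict_mono s \<Longrightarrow> \<exists>r :: nat \<Rightarrow> nat. strict_mono r \<and> P k (s \<circ> r)"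
    and stable: "\<And>k s r. strict_mono (r :: nat \<Rightarrow> nat) \<Longrightarrow> P k s \<Longrightarrow> P k (s \<circ> r)"
    and tail: "\<And>k s m. P k (\<lambda>n. s (n + m)) \<Longrightarrow> P k s"
  shows "\<exists>s. strict_mono s \<and> (\<forall>k. P k s)"
proof -
  interpret subseqs P by (rule subseqs.intro) (use ex in blast)
  have "P k (\<lambda>n. diagseq (n + Suc k))" for k
    using diagseq_holds[of k, OF stable] by (simp add: comp_def add.commute)
  then have "P k diagseq" for k by (rule tail)
  then show ?thesis using subseq_diagseq by blast
qed

lemma vague_conv_tail:
  fixes \<nu>s :: "nat \<Rightarrow> ('a::topological_space \<times> 'b::real_normed_vector) measure"
  assumes "vague_conv (\<lambda>n. \<nu>s (n + m)) \<nu>"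
  shows "vague_conv \<nu>s \<nu>"
  unfolding vague_conv_def
proof (intro allI impI)
  fix k and F :: "(nat \<Rightarrow> 'a \<times> 'b) \<Rightarrow> real" assume "vanishing_test k F"
  with assms have "(\<lambda>n. integral\<^sup>L (PiM {..<k} (\<lambda>_. \<nu>s (n + m))) F) \<longlonglongrightarrow> integral\<^sup>L (PiM {..<k} (\<lambda>_. \<nu>)) F"
    unfolding vague_conv_def by blast
  then show "(\<lambda>n. integral\<^sup>L (PiM {..<k} (\<lambda>_. \<nu>s n)) F) \<longlonglongrightarrow> integral\<^sup>L (PiM {..<k} (\<lambda>_. \<nu>)) F"
    by (rule LIMSEQ_offset)
qed

lemma weak_conv_tail:
  fixes \<beta>s :: "nat \<Rightarrow> 'a::topological_space measure"
  assumes "weak_conv (\<lambda>n. \<beta>s (n + m)) \<beta>"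
  shows "weak_conv \<beta>s \<beta>"
  unfolding Defs.weak_conv_def
proof (intro allI impI)
  fix g :: "'a \<Rightarrow> real" assume "continuous_on UNIV g \<and> bounded (range g)"
  with assms have "(\<lambda>n. integral\<^sup>L (\<beta>s (n + m)) g) \<longlonglongrightarrow> integral\<^sup>L \<beta> g"
    unfolding Defs.weak_conv_def by blast
  then show "(\<lambda>n. integral\<^sup>L (\<beta>s n) g) \<longlonglongrightarrow> integral\<^sup>L \<beta> g"
    by (rule LIMSEQ_offset)
qed

lemma weak_conv_subseq:
  fixes \<beta>s :: "nat \<Rightarrow> 'a::topological_space measure"
  assumes "strict_mono r" "weak_conv \<beta>s \<beta>"
  shows "weak_conv (\<beta>s \<circ> r) \<beta>"
  unfolding Defs.weak_conv_def
proof (intro allI impI)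
  fix g :: "'a \<Rightarrow> real" assume "continuous_on UNIV g \<and> bounded (range g)"
  with assms(2) have "(\<lambda>n. integral\<^sup>L (\<beta>s n) g) \<longlonglongrightarrow> integral\<^sup>L \<beta> g"
    unfolding Defs.weak_conv_def by blast
  from LIMSEQ_subseq_LIMSEQ[OF this assms(1)]
  show "(\<lambda>n. integral\<^sup>L ((\<beta>s \<circ> r) n) g) \<longlonglongrightarrow> integral\<^sup>L \<beta> g" by (simp add: comp_def)
qed

lemma tight_imp_weak_conv_subseq:
  fixes \<beta>s :: "nat \<Rightarrow> 'c::{metric_space, second_countable_topology} measure"
  assumes prob: "\<And>n. prob_space (\<beta>s n)" and sets: "\<And>n. sets (\<beta>s n) = sets borel"
    and tight: "\<And>\<epsilon>. \<epsilon> > 0 \<Longrightarrow> \<exists>C. compact C \<and> (\<forall>n. measure (\<beta>s n) (- C) \<le> \<epsilon>)"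
  shows "\<exists>r \<beta>. strict_mono (r :: nat \<Rightarrow> nat) \<and> prob_space \<beta> \<and> sets \<beta> = sets borel \<and> weak_conv (\<beta>s \<circ> r) \<beta>"
proof -
  have "\<exists>r (\<Omega> :: real measure) Y Z. strict_mono (r :: nat \<Rightarrow> nat) \<and> prob_space \<Omega> \<and>
    (\<forall>n. Y n \<in> borel_measurable \<Omega>) \<and> Z \<in> borel_measurable \<Omega> \<and>
    (\<forall>n. distr \<Omega> borel (Y n) = \<beta>s (r n)) \<and> (AE \<omega> in \<Omega>. (\<lambda>n. Y n \<omega>) \<longlonglongrightarrow> Z \<omega>)"
    using tight by (intro tight_subseq_ae_coupling prob sets)
  then obtain r and \<Omega> :: "real measure" and Y Z where "strict_mono (r :: nat \<Rightarrow> nat) \<and> prob_space \<Omega> \<and>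
    (\<forall>n. Y n \<in> borel_measurable \<Omega>) \<and> Z \<in> borel_measurable \<Omega> \<and>
    (\<forall>n. distr \<Omega> borel (Y n) = \<beta>s (r n)) \<and> (AE \<omega> in \<Omega>. (\<lambda>n. Y n \<omega>) \<longlonglongrightarrow> Z \<omega>)"
    by (elim exE) (rule that)
  then have r: "strict_mono (r :: nat \<Rightarrow> nat)" and \<Omega>: "prob_space \<Omega>"
    and Y: "\<And>n. Y n \<in> borel_measurable \<Omega>" and Z: "Z \<in> borel_measurable \<Omega>"
    and distr: "\<And>n. distr \<Omega> borel (Y n) = \<beta>s (r n)"
    and lim: "AE \<omega> in \<Omega>. (\<lambda>n. Y n \<omega>) \<longlonglongrightarrow> Z \<omega>"
    by simp_all
  interpret \<Omega>: prob_space \<Omega> by fact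
  have "weak_conv (\<beta>s \<circ> r) (distr \<Omega> borel Z)"
    unfolding Defs.weak_conv_def
  proof (intro allI impI)
    fix g :: "'c \<Rightarrow> real" assume "continuous_on UNIV g \<and> bounded (range g)"
    then have g: "continuous_on UNIV g" and "bounded (range g)" by simp_all
    then obtain B where B: "\<And>x. norm (g x) \<le> B" by (auto simp: bounded_iff)
    have gm: "g \<in> borel_measurable borel" by (rule borel_measurable_continuous_onI[OF g])
    have "(\<lambda>n. \<integral>\<omega>. g (Y n \<omega>) \<partial>\<Omega>) \<longlonglongrightarrow> (\<integral>\<omega>. g (Z \<omega>) \<partial>\<Omega>)"
    proof (rule integral_dominated_convergence[where w="\<lambda>_. B"])
      show "AE \<omega> in \<Omega>. (\<lambda>n. g (Y n \<omega>)) \<longlonglongrightarrow> g (Z \<omega>)"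
        using lim by eventually_elim (rule continuous_on_tendsto_compose[OF g], auto)
      show "AE \<omega> in \<Omega>. norm (g (Y n \<omega>)) \<le> B" for n by (rule AE_I2) (rule B)
    qed (use measurable_compose[OF Y gm] measurable_compose[OF Z gm] in auto)
    moreover have "integral\<^sup>L ((\<beta>s \<circ> r) n) g = (\<integral>\<omega>. g (Y n \<omega>) \<partial>\<Omega>)" for n
      unfolding comp_def distr[symmetric] by (rule integral_distr[OF Y gm])
    moreover have "integral\<^sup>L (distr \<Omega> borel Z) g = (\<integral>\<omega>. g (Z \<omega>) \<partial>\<Omega>)"
      by (rule integral_distr[OF Z gm])
    ultimately show "(\<lambda>n. integral\<^sup>L ((\<beta>s \<circ> r) n) g) \<longlonglongrightarrow> integral\<^sup>L (distr \<Omega> borel Z) g" by simp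
  qed
  moreover have "prob_space (distr \<Omega> borel Z)" by (rule \<Omega>.prob_space_distr[OF Z])
  ultimately show ?thesis using r by (intro exI[of _ r] exI[of _ "distr \<Omega> borel Z"]) simp
qed

text \<open>If escape fails for some \<open>V\<close>, then the bound \<open>V\<close> holds for
  infinitely many indices, and enumerating these gives the bounded alternative.\<close>

lemma bounded_or_escaping_subseq:
  fixes d :: "nat \<Rightarrow> real"
  assumes s: "strict_mono (s :: nat \<Rightarrow> nat)"
  shows "\<exists>r. strict_mono (r :: nat \<Rightarrow> nat) \<and>
    ((\<exists>V. \<forall>\<^sub>F n in sequentially. E (s (r n)) \<and> d (s (r n)) \<le> V) \<or>
     (\<forall>V. \<forall>\<^sub>F n in sequentially. \<not> (E (s (r n)) \<and> d (s (r n)) \<le> V)))"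
proof (cases "\<forall>V. \<forall>\<^sub>F n in sequentially. \<not> (E (s n) \<and> d (s n) \<le> V)")
  case True
  then show ?thesis by (intro exI[of _ id]) (simp add: strict_mono_def)
next
  case False
  then obtain V where V: "\<exists>\<^sub>F n in sequentially. E (s n) \<and> d (s n) \<le> V"
    by (auto simp: frequently_def)
  let ?S = "{n. E (s n) \<and> d (s n) \<le> V}"
  have inf: "infinite ?S"
    using V by (simp add: frequently_cofinite cofinite_eq_sequentially[symmetric])
  have "strict_mono (enumerate ?S)" by (rule strict_mono_enumerate[OF inf])
  moreover have "E (s (enumerate ?S n)) \<and> d (s (enumerate ?S n)) \<le> V" for n
    using enumerate_in_set[OF inf, of n] by simp
  ultimately show ?thesis
    by (intro exI[of _ "enumerate ?S"] conjI disjI1 exI[of _ V] always_eventually) auto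
qed

text \<open>Dominated convergence for series: the geometric weights times 2B bound the terms
  uniformly in n.\<close>

lemma weighted_differences_tendsto_0:
  fixes x :: "nat \<Rightarrow> nat \<Rightarrow> real"
  assumes lim: "\<And>r. (\<lambda>n. x n r) \<longlonglongrightarrow> y r" and B: "\<And>n r. \<bar>x n r\<bar> \<le> B" "\<And>r. \<bar>y r\<bar> \<le> B"
  shows "(\<lambda>n. \<Sum>r. (1/2) ^ Suc r * \<bar>x n r - y r\<bar>) \<longlonglongrightarrow> 0"
proof -
  have "(\<lambda>n. \<Sum>r. (1/2) ^ Suc r * \<bar>x n r - y r\<bar>) \<longlonglongrightarrow> (\<Sum>r. (0 :: real))"
  proof (rule tannerys_theorem[THEN conjunct2, THEN conjunct2])
    show "(\<lambda>n. (1/2) ^ Suc r * \<bar>x n r - y r\<bar>) \<longlonglongrightarrow> 0" for r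
      using tendsto_mult[OF tendsto_const tendsto_rabs[OF tendsto_diff[OF lim tendsto_const]], of "(1/2) ^ Suc r" r "y r"]
      by simp
    have "norm ((1/2) ^ Suc r * \<bar>x n r - y r\<bar>) \<le> (1/2) ^ Suc r * (2 * B)" for r n
    proof -
      have "\<bar>x n r - y r\<bar> \<le> 2 * B" using B(1)[of n r] B(2)[of r] by linarith
      then show ?thesis by (simp add: abs_mult)
    qed
    then show "\<forall>\<^sub>F (r, n) in at_top \<times>\<^sub>F sequentially. norm ((1/2) ^ Suc r * \<bar>x n r - y r\<bar>) \<le> (1/2) ^ Suc r * (2 * B)"
      by (intro always_eventually) auto
    show "summable (\<lambda>r. (1/2) ^ Suc r * (2 * B))"
      by (intro summable_mult2) (simp add: summable_geometric)
  qed simp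
  then show ?thesis by simp
qed

section \<open>Orbit representatives and boundedness of Lambda\<close>

lemma rep_orbit: "\<exists>a. rep (orbit \<nu>) = shift_meas \<nu> a"
proof -
  have "rep (orbit \<nu>) \<in> orbit \<nu>"
    unfolding rep_def by (rule someI_ex) (auto simp: orbit_def)
  then show ?thesis by (auto simp: orbit_def)
qed

text \<open>The chosen representative is some unknown translate of the measure, and the invariance
  of \<open>F\<close> absorbs the translation.\<close>

lemma integral_PiM_rep_orbit:
  fixes \<nu> :: "('a::second_countable_topology \<times> 'b::{real_normed_vector, second_countable_topology}) measure"
  assumes F: "translation_test k F" and \<nu>: "subprob_space \<nu>" "sets \<nu> = sets borel"
  shows "integral\<^sup>L (PiM {..<k} (\<lambda>_. rep (orbit \<nu>))) F = integral\<^sup>L (PiM {..<k} (\<lambda>_. \<nu>)) F"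
proof -
  obtain a where a: "rep (orbit \<nu>) = shift_meas \<nu> a" using rep_orbit by blast
  have sp: "space \<nu> = UNIV" using sets_eq_imp_space_eq[OF \<nu>(2)] by simp
  have "integral\<^sup>L (PiM {..<k} (\<lambda>_. shift_meas \<nu> a)) F = (\<integral>z. F (\<lambda>i\<in>{..<k}. translate a (z i)) \<partial>PiM {..<k} (\<lambda>_. \<nu>))"
    by (rule integral_PiM_shift_meas[OF \<nu> finite_lessThan measurable_continuous_on_seqs[OF translation_testD(1)[OF F]]])
  also have "\<dots> = integral\<^sup>L (PiM {..<k} (\<lambda>_. \<nu>)) F"
    by (intro Bochner_Integration.integral_cong refl translation_testD(3)[OF F]) (simp add: space_PiM sp)
  finally show ?thesis unfolding a .
qed

lemma abs_suminf_integral_le: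
  fixes \<mu> :: "nat \<Rightarrow> ('a::{metric_space, second_countable_topology} \<times> 'b::euclidean_space) measure"
  assumes F: "translation_test k F" and k: "2 \<le> k"
    and sub: "\<And>i. subprob_space (\<mu> i)" and sets: "\<And>i. sets (\<mu> i) = sets borel"
    and mass: "(\<Sum>i. emeasure (\<mu> i) UNIV) \<le> 1"
  shows "\<bar>\<Sum>i. integral\<^sup>L (PiM {..<k} (\<lambda>_. \<mu> i)) F\<bar> \<le> 2"
proof -
  have fin: "finite_measure (\<mu> i)" for i using sub[of i] by (simp add: subprob_space_def)
  note M = mass_summable[of \<mu>, OF fin mass]
  note le = integral_translation_test_le[OF F k sub sets]
  have s: "summable (\<lambda>i. \<bar>integral\<^sup>L (PiM {..<k} (\<lambda>_. \<mu> i)) F\<bar>)"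
    by (rule summable_comparison_test'[OF summable_mult[OF M(1), of 2]]) (simp add: le)
  have "\<bar>\<Sum>i. integral\<^sup>L (PiM {..<k} (\<lambda>_. \<mu> i)) F\<bar> \<le> (\<Sum>i. \<bar>integral\<^sup>L (PiM {..<k} (\<lambda>_. \<mu> i)) F\<bar>)"
    by (rule summable_rabs[OF s])
  also have "\<dots> \<le> (\<Sum>i. 2 * measure (\<mu> i) UNIV)"
    by (rule suminf_le[OF le s summable_mult[OF M(1)]])
  also have "\<dots> \<le> 2" using M by (simp add: suminf_mult)
  finally show ?thesis .
qed

theorem theorem2p3:
  fixes fs :: "nat \<Rightarrow> 'a::polish_space \<Rightarrow> real"
    and Wk :: "nat \<Rightarrow> ((nat \<Rightarrow> 'b::euclidean_space) \<Rightarrow> real) set"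
    and e :: "nat \<Rightarrow> nat \<times> nat \<times> ((nat \<Rightarrow> 'b) \<Rightarrow> real)"
    and K :: "((nat \<Rightarrow> ('a \<times> 'b) measure set) \<times> 'a measure) set"
    and \<Theta> :: "nat \<Rightarrow> (nat \<Rightarrow> ('a \<times> 'b) measure set) \<times> 'a measure"
  assumes "admissible_f fs"
    and "admissible_W Wk"
    and "bij_betw e UNIV {(j, k, W). 2 \<le> k \<and> W \<in> Wk k}"
    and "K \<subseteq> Xspace"
    and "uniformly_tight (snd ` K)"
    and "\<forall>n. \<Theta> n \<in> K"
  shows "\<exists>\<phi> \<Theta>0. strict_mono \<phi> \<and> \<Theta>0 \<in> Xspace \<and> (\<lambda>n. Dmet fs e (\<Theta> (\<phi> n)) \<Theta>0) \<longlonglongrightarrow> 0"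
proof -
  define \<mu> where "\<mu> n i = rep (fst (\<Theta> n) i)" for n i
  define \<beta> where "\<beta> n = snd (\<Theta> n)" for n
  have X: "prob_space (\<beta> n)" "sets (\<beta> n) = sets borel"
    "\<And>i. \<exists>\<nu>. subprob_space \<nu> \<and> sets \<nu> = sets borel \<and> fst (\<Theta> n) i = orbit \<nu>"
    "\<And>A. A \<in> sets borel \<Longrightarrow> (\<Sum>i. emeasure (\<mu> n i) (A \<times> UNIV)) \<le> emeasure (\<beta> n) A" for n
  proof -
    have "\<Theta> n \<in> Xspace" using assms(4,6) by blast
    then show "prob_space (\<beta> n)" "sets (\<beta> n) = sets borel"
      "\<And>i. \<exists>\<nu>. subprob_space \<nu> \<and> sets \<nu> = sets borel \<and> fst (\<Theta> n) i = orbit \<nu>"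
      "\<And>A. A \<in> sets borel \<Longrightarrow> (\<Sum>i. emeasure (\<mu> n i) (A \<times> UNIV)) \<le> emeasure (\<beta> n) A"
      by (auto simp: Xspace_def \<beta>_def \<mu>_def case_prod_beta)
  qed
  have sub: "subprob_space (\<mu> n i)" and sets: "sets (\<mu> n i) = sets borel" for n i
  proof -
    obtain \<nu> where \<nu>: "subprob_space \<nu>" "sets \<nu> = sets borel" "fst (\<Theta> n) i = orbit \<nu>"
      using X(3) by blast
    obtain a where "\<mu> n i = shift_meas \<nu> a" using rep_orbit[of \<nu>] \<nu>(3) by (auto simp: \<mu>_def)
    then show "subprob_space (\<mu> n i)" "sets (\<mu> n i) = sets borel"
      using subprob_space_shift_meas[OF \<nu>(1,2)] by simp_all
  qed
  have fin: "finite_measure (\<mu> n i)" for n i using sub[of n i] by (simp add: subprob_space_def)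
  have sp\<beta>: "space (\<beta> n) = UNIV" for n using sets_eq_imp_space_eq[OF X(2)] by simp
  have mass: "(\<Sum>i. emeasure (\<mu> n i) UNIV) \<le> 1" for n
    using X(4)[of UNIV n] prob_space.emeasure_space_1[OF X(1)[of n]] by (simp add: sp\<beta>)
  have tight: "\<exists>C. compact C \<and> (\<forall>n. measure (\<beta> n) (- C) \<le> \<epsilon>)" if \<epsilon>: "\<epsilon> > 0" for \<epsilon>
  proof -
    have "\<exists>C. compact C \<and> (\<forall>b\<in>snd ` K. measure b (space b - C) \<le> \<epsilon>)"
      by (rule mp[OF spec[OF assms(5)[unfolded uniformly_tight_def]] \<epsilon>])
    then obtain C where C: "compact C" "\<forall>b\<in>snd ` K. measure b (space b - C) \<le> \<epsilon>"
      by (elim exE conjE) (rule that)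
    have "measure (\<beta> n) (- C) \<le> \<epsilon>" for n
    proof -
      have "\<beta> n \<in> snd ` K" unfolding \<beta>_def using assms(6) by (intro imageI) simp
      from bspec[OF C(2) this] show ?thesis by (simp add: sp\<beta> Compl_eq_Diff_UNIV)
    qed
    then show ?thesis using C(1) by blast
  qed
  have "\<exists>C. \<forall>i y. measure (\<mu> n i) (UNIV \<times> cball y (real (Suc m))) > 1 / real (Suc m) \<longrightarrow>
      (\<exists>j\<le>m. fst (C j) = i \<and> dist y (snd (C j)) \<le> 2 * real (Suc m))" for n m
    by (rule ex_heavy_centres[OF fin sets mass])
  then have "\<forall>n. \<exists>C. \<forall>m i y. measure (\<mu> n i) (UNIV \<times> cball y (real (Suc m))) > 1 / real (Suc m) \<longrightarrow>
      (\<exists>j\<le>m. fst (C m j) = i \<and> dist y (snd (C m j)) \<le> 2 * real (Suc m))"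
    by (intro allI choice)
  from choice[OF this] obtain C where C: "\<And>n m i y. measure (\<mu> n i) (UNIV \<times> cball y (real (Suc m))) > 1 / real (Suc m) \<Longrightarrow>
      \<exists>j\<le>m. fst (C n m j) = i \<and> dist y (snd (C n m j)) \<le> 2 * real (Suc m)"
    by blast
  define c where "c n p = C n (fst (prod_decode p)) (snd (prod_decode p))" for n p
  define \<nu> where "\<nu> n p = shift_meas (\<mu> n (fst (c n p))) (snd (c n p))" for n p
  \<comment> \<open>The convergence of the laws (\<open>A\<close>), of the recentred measures
    (\<open>B\<close>) and the alternative for pairs of centres (\<open>D\<close>) are stated as
    properties of an index sequence, the form in which the diagonal extraction takes them.\<close>
  define A where "A s \<longleftrightarrow> (\<exists>\<beta>\<^sub>0. prob_space \<beta>\<^sub>0 \<and> sets \<beta>\<^sub>0 = sets borel \<and> weak_conv (\<lambda>n. \<beta> (s n)) \<beta>\<^sub>0)" for s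
  define B where "B p s \<longleftrightarrow> (\<exists>l. subprob_space l \<and> sets l = sets borel \<and> vague_conv (\<lambda>n. \<nu> (s n) p) l)" for p s
  define D where "D p q s \<longleftrightarrow>
    (\<exists>V. \<forall>\<^sub>F n in sequentially. fst (c (s n) p) = fst (c (s n) q) \<and> dist (snd (c (s n) p)) (snd (c (s n) q)) \<le> V) \<or>
    (\<forall>V. \<forall>\<^sub>F n in sequentially. \<not> (fst (c (s n) p) = fst (c (s n) q) \<and> dist (snd (c (s n) p)) (snd (c (s n) q)) \<le> V))"
    for p q s
  have A_ex: "\<exists>r :: nat \<Rightarrow> nat. strict_mono r \<and> A (s \<circ> r)" for s :: "nat \<Rightarrow> nat"
  proof -
    have "\<exists>C. compact C \<and> (\<forall>n. measure (\<beta> (s n)) (- C) \<le> \<epsilon>)" if "\<epsilon> > 0" for \<epsilon>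
      using tight[OF that] by blast
    then have "\<exists>r b. strict_mono (r :: nat \<Rightarrow> nat) \<and> prob_space b \<and> sets b = sets borel \<and>
        weak_conv ((\<lambda>n. \<beta> (s n)) \<circ> r) b"
      by (intro tight_imp_weak_conv_subseq X(1,2))
    then show ?thesis unfolding A_def comp_def by blast
  qed
  have A_sub: "A (s \<circ> r)" if "A s" "strict_mono r" for s r :: "nat \<Rightarrow> nat"
    using that weak_conv_subseq[OF that(2), of "\<lambda>n. \<beta> (s n)"] unfolding A_def comp_def by blast
  have A_tail: "A s" if "A (\<lambda>n. s (n + m))" for s m
    using that weak_conv_tail[of "\<lambda>n. \<beta> (s n)" m] unfolding A_def by blast
  have B_ex: "\<exists>r :: nat \<Rightarrow> nat. strict_mono r \<and> B p (s \<circ> r)" for p and s :: "nat \<Rightarrow> nat"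
  proof -
    \<comment> \<open>Recentring acts only in the Euclidean factor, so the first marginals are
      unchanged and dominated by the tight laws, whatever the centres are.\<close>
    have "\<exists>C. compact C \<and> (\<forall>n. measure (\<nu> (s n) p) ((- C) \<times> UNIV) \<le> \<epsilon>)" if \<epsilon>: "\<epsilon> > 0" for \<epsilon>
    proof -
      obtain C where C: "compact C" "\<And>n. measure (\<beta> n) (- C) \<le> \<epsilon>" using tight[OF \<epsilon>] by blast
      have CB: "- C \<in> sets borel" using compact_imp_closed[OF C(1)] by (intro borel_open) auto
      have "measure (\<nu> n p) ((- C) \<times> UNIV) \<le> \<epsilon>" for n
      proof -
        have "emeasure (\<nu> n p) ((- C) \<times> UNIV) = emeasure (\<mu> n (fst (c n p))) ((- C) \<times> UNIV)"
          unfolding \<nu>_def by (rule emeasure_shift_meas_cylinder[OF sets borel_cylinder[OF CB]])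
        also have "\<dots> = (\<Sum>i\<in>{fst (c n p)}. emeasure (\<mu> n i) ((- C) \<times> UNIV))" by simp
        also have "\<dots> \<le> (\<Sum>i. emeasure (\<mu> n i) ((- C) \<times> UNIV))"
          by (intro sum_le_suminf) auto
        also have "\<dots> \<le> emeasure (\<beta> n) (- C)" by (rule X(4)[OF CB])
        also have "\<dots> = ennreal (measure (\<beta> n) (- C))"
          using X(1)[of n] by (simp add: finite_measure.emeasure_eq_measure prob_space_def)
        finally have "measure (\<nu> n p) ((- C) \<times> UNIV) \<le> measure (\<beta> n) (- C)"
          unfolding measure_def[of "\<nu> n p"] by (intro enn2real_leI) auto
        then show ?thesis using C(2)[of n] by linarith
      qed
      then show ?thesis using C(1) by blast
    qed
    then have "\<exists>r l. strict_mono (r :: nat \<Rightarrow> nat) \<and> subprob_space l \<and> sets l = sets borel \<and> vague_conv ((\<lambda>n. \<nu> (s n) p) \<circ> r) l"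
      by (intro tight_marginals_imp_vague_subseq)
        (simp_all add: \<nu>_def subprob_space_shift_meas[OF sub sets])
    then show ?thesis unfolding B_def comp_def by blast
  qed
  have B_sub: "B p (s \<circ> r)" if "B p s" "strict_mono r" for p and s r :: "nat \<Rightarrow> nat"
    using that vague_conv_subseq[OF that(2), of "\<lambda>n. \<nu> (s n) p"] unfolding B_def comp_def by blast
  have B_tail: "B p s" if "B p (\<lambda>n. s (n + m))" for p s m
    using that vague_conv_tail[of "\<lambda>n. \<nu> (s n) p" m] unfolding B_def by blast
  have D_ex: "\<exists>r :: nat \<Rightarrow> nat. strict_mono r \<and> D p q (s \<circ> r)" if "strict_mono s" for p q and s :: "nat \<Rightarrow> nat"
    unfolding D_def comp_def by (rule bounded_or_escaping_subseq[OF that])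
  have D_sub: "D p q (s \<circ> r)" if "D p q s" "strict_mono r" for p q and s r :: "nat \<Rightarrow> nat"
  proof -
    have "\<forall>\<^sub>F n in sequentially. Q (r n)" if "\<forall>\<^sub>F n in sequentially. Q n" for Q
      using eventually_subseq[OF \<open>strict_mono r\<close> that] .
    then show ?thesis using that(1) unfolding D_def comp_def by blast
  qed
  have D_tail: "D p q s" if "D p q (\<lambda>n. s (n + m))" for p q s m
    using that unfolding D_def eventually_sequentially_seg[where k=m, symmetric,
      of "\<lambda>n. fst (c (s n) p) = fst (c (s n) q) \<and> dist (snd (c (s n) p)) (snd (c (s n) q)) \<le> _"]
      eventually_sequentially_seg[where k=m, symmetric,
      of "\<lambda>n. \<not> (fst (c (s n) p) = fst (c (s n) q) \<and> dist (snd (c (s n) p)) (snd (c (s n) q)) \<le> _)"] .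
  \<comment> \<open>The code k is read as a pair (p, q) for \<open>D\<close>, and its first entry
    serves \<open>B\<close>. As k varies, all centres and all pairs of centres occur.\<close>
  define P where "P k s \<longleftrightarrow> A s \<and> B (fst (prod_decode k)) s \<and> D (fst (prod_decode k)) (snd (prod_decode k)) s" for k s
  have "\<exists>s. strict_mono s \<and> (\<forall>k. P k s)"
  proof (rule ex_common_subseq)
    fix k and s :: "nat \<Rightarrow> nat" assume s: "strict_mono s"
    let ?p = "fst (prod_decode k)" and ?q = "snd (prod_decode k)"
    obtain r1 :: "nat \<Rightarrow> nat" where r1: "strict_mono r1" "A (s \<circ> r1)" using A_ex by blast
    obtain r2 :: "nat \<Rightarrow> nat" where r2: "strict_mono r2" "B ?p (s \<circ> r1 \<circ> r2)" using B_ex by blast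
    obtain r3 :: "nat \<Rightarrow> nat" where r3: "strict_mono r3" "D ?p ?q (s \<circ> r1 \<circ> r2 \<circ> r3)"
      using D_ex[OF strict_mono_o[OF strict_mono_o[OF s r1(1)] r2(1)]] by blast
    have "P k (s \<circ> (r1 \<circ> r2 \<circ> r3))"
      using A_sub[OF A_sub[OF r1(2) r2(1)] r3(1)] B_sub[OF r2(2) r3(1)] r3(2)
      by (simp add: P_def comp_assoc)
    moreover have "strict_mono (r1 \<circ> r2 \<circ> r3)" by (intro strict_mono_o r1 r2 r3)
    ultimately show "\<exists>r :: nat \<Rightarrow> nat. strict_mono r \<and> P k (s \<circ> r)" by blast
  next
    show "P k (s \<circ> r)" if "strict_mono r" "P k s" for k and s r :: "nat \<Rightarrow> nat"
      using that A_sub B_sub D_sub unfolding P_def by blast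
    show "P k s" if "P k (\<lambda>n. s (n + m))" for k s m
      using that A_tail B_tail D_tail unfolding P_def by blast
  qed
  then obtain s where s: "strict_mono s" "\<And>k. P k s" by blast
  obtain \<beta>\<^sub>0 where \<beta>0: "prob_space \<beta>\<^sub>0" "sets \<beta>\<^sub>0 = sets borel" "weak_conv (\<lambda>n. \<beta> (s n)) \<beta>\<^sub>0"
    using s(2) unfolding P_def A_def by blast
  have "\<exists>l. subprob_space l \<and> sets l = sets borel \<and> vague_conv (\<lambda>n. \<nu> (s n) p) l" for p
    using s(2)[of "prod_encode (p, 0)"] by (simp add: P_def B_def)
  then have "\<forall>p. \<exists>l. subprob_space l \<and> sets l = sets borel \<and> vague_conv (\<lambda>n. \<nu> (s n) p) l" by blast
  from choice[OF this] obtain lam where lam: "\<And>p. subprob_space (lam p)" "\<And>p. sets (lam p) = sets borel"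
    "\<And>p. vague_conv (\<lambda>n. \<nu> (s n) p) (lam p)" by blast
  have D: "D p q s" for p q using s(2)[of "prod_encode (p, q)"] by (simp add: P_def)
  interpret centred_limits "\<lambda>n. \<mu> (s n)" "\<lambda>n. \<beta> (s n)" \<beta>\<^sub>0 "\<lambda>n. c (s n)" lam
  proof (rule centred_limits.intro)
    show "(\<lambda>n. integral\<^sup>L (\<beta> (s n)) g) \<longlonglongrightarrow> integral\<^sup>L \<beta>\<^sub>0 g" if "continuous_on UNIV g" "bounded (range g)" for g :: "'a \<Rightarrow> real"
      using \<beta>0(3) that unfolding Defs.weak_conv_def by blast
    show "\<exists>j\<le>m. fst (c (s n) (prod_encode (m, j))) = i \<and> dist y (snd (c (s n) (prod_encode (m, j)))) \<le> 2 * real (Suc m)"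
      if "measure (\<mu> (s n) i) (UNIV \<times> cball y (real (Suc m))) > 1 / real (Suc m)" for n m i y
      using C[OF that] by (simp add: c_def)
    show "vague_conv (\<lambda>n. shift_meas (\<mu> (s n) (fst (c (s n) p))) (snd (c (s n) p))) (lam p)" for p
      using lam(3)[of p] by (simp add: \<nu>_def)
    show "(\<exists>V. \<forall>\<^sub>F n in sequentially. fst (c (s n) p) = fst (c (s n) q) \<and> dist (snd (c (s n) p)) (snd (c (s n) q)) \<le> V) \<or>
      (\<forall>V. \<forall>\<^sub>F n in sequentially. \<not> (fst (c (s n) p) = fst (c (s n) q) \<and> dist (snd (c (s n) p)) (snd (c (s n) q)) \<le> V))" for p q
      using D[of p q] unfolding D_def .
  qed (use sub sets X(1,2,4) \<beta>0(1,2) lam(1,2) in simp_all)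
  define \<xi> where "\<xi> q = orbit (limit_family q)" for q
  have \<xi>: "emeasure (rep (\<xi> q)) (A \<times> UNIV) = emeasure (limit_family q) (A \<times> UNIV)" if "A \<in> sets borel" for A q
    using rep_orbit[of "limit_family q"] emeasure_shift_meas_cylinder[OF sets_limit_family borel_cylinder[OF that]]
    by (auto simp: \<xi>_def)
  have "(\<xi>, \<beta>\<^sub>0) \<in> Xspace"
    using \<beta>0(1,2) subprob_limit_family sets_limit_family limit_family_marginal
    unfolding Xspace_def by (auto simp: \<xi>) (auto simp: \<xi>_def intro!: exI[of _ "limit_family _"])
  moreover have "(\<lambda>n. Dmet fs e (\<Theta> (s n)) (\<xi>, \<beta>\<^sub>0)) \<longlonglongrightarrow> 0 + 0"
    unfolding Dmet_def
  proof (rule tendsto_add)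
    have lim_mass: "(\<Sum>q. emeasure (limit_family q) UNIV) \<le> 1"
      using limit_family_marginal[of UNIV] prob_space.emeasure_space_1[OF \<beta>0(1)]
        sets_eq_imp_space_eq[OF \<beta>0(2)] by simp
    have Lam: "(\<lambda>n. Lam fs e r (fst (\<Theta> (s n)))) \<longlonglongrightarrow> Lam fs e r \<xi> \<and>
        (\<forall>n. \<bar>Lam fs e r (fst (\<Theta> (s n)))\<bar> \<le> 2) \<and> \<bar>Lam fs e r \<xi>\<bar> \<le> 2" for r
    proof -
      obtain j k W where e: "e r = (j, k, W)" by (cases "e r")
      have "e r \<in> {(j, k, W). 2 \<le> k \<and> W \<in> Wk k}"
        by (rule bij_betwE[OF assms(3), rule_format]) simp
      then have k: "2 \<le> k" and W: "W \<in> Wk k" using e by auto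
      define F where "F z = (\<Prod>l<k. fs j (fst (z l))) * W (\<lambda>l\<in>{..<k}. snd (z l))" for z :: "nat \<Rightarrow> 'a \<times> 'b"
      have f: "continuous_on UNIV (fs j)" "\<And>x. \<bar>fs j x\<bar> \<le> 1" using assms(1) by (auto simp: admissible_f_def)
      have "Wk k \<subseteq> Ck k \<and> (\<forall>w\<in>Wk k. \<forall>y\<in>seqs k. \<bar>w y\<bar> \<le> 1)"
        using assms(2) k unfolding admissible_W_def by blast
      then have "W \<in> Ck k" "\<And>y. y \<in> seqs k \<Longrightarrow> \<bar>W y\<bar> \<le> 1" using W by blast+
      then have F: "translation_test k F"
        unfolding F_def[abs_def] by (intro translation_test_product f)
      have L: "Lam fs e r (fst (\<Theta> n)) = (\<Sum>i. integral\<^sup>L (PiM {..<k} (\<lambda>_. \<mu> n i)) F)" for n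
        by (simp add: Lam_def e F_def[abs_def] \<mu>_def)
      have L': "Lam fs e r \<xi> = (\<Sum>q. integral\<^sup>L (PiM {..<k} (\<lambda>_. limit_family q)) F)"
        unfolding integral_PiM_rep_orbit[OF F subprob_limit_family sets_limit_family, symmetric]
        by (simp add: Lam_def e F_def[abs_def] \<xi>_def)
      show ?thesis
        unfolding L L' using suminf_integral_tendsto[OF F k]
          abs_suminf_integral_le[OF F k sub sets mass]
          abs_suminf_integral_le[OF F k subprob_limit_family sets_limit_family lim_mass] by blast
    qed
    show "(\<lambda>n. Dstar fs e (fst (\<Theta> (s n))) (fst (\<xi>, \<beta>\<^sub>0))) \<longlonglongrightarrow> 0"
      unfolding Dstar_def fst_conv by (rule weighted_differences_tendsto_0[where B=2]) (use Lam in blast)+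
    have f: "continuous_on UNIV (fs j)" "\<And>x. \<bar>fs j x\<bar> \<le> 1" for j using assms(1) by (auto simp: admissible_f_def)
    have bound: "\<bar>integral\<^sup>L b (fs j)\<bar> \<le> 1" if "prob_space b" for j and b :: "'a measure"
    proof (cases "integrable b (fs j)")
      case True
      interpret prob_space b by fact
      have "\<bar>integral\<^sup>L b (fs j)\<bar> \<le> (\<integral>x. \<bar>fs j x\<bar> \<partial>b)" by (rule integral_abs_bound)
      also have "\<dots> \<le> (\<integral>x. 1 \<partial>b)" using True f(2) by (intro integral_mono) auto
      finally show ?thesis by (simp add: prob_space)
    qed (simp add: not_integrable_integral_eq)
    show "(\<lambda>n. dist_beta fs (snd (\<Theta> (s n))) (snd (\<xi>, \<beta>\<^sub>0))) \<longlonglongrightarrow> 0"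
      unfolding dist_beta_def snd_conv \<beta>_def[symmetric]
    proof (rule weighted_differences_tendsto_0[where B=1])
      show "(\<lambda>n. integral\<^sup>L (\<beta> (s n)) (fs j)) \<longlonglongrightarrow> integral\<^sup>L \<beta>\<^sub>0 (fs j)" for j
        using f by (intro weak boundedI[of _ 1]) auto
    qed (intro bound X(1) \<beta>0(1))+
  qed
  ultimately show ?thesis
    using s(1) by (intro exI[of _ s] exI[of _ "(\<xi>, \<beta>\<^sub>0)"]) simp
qed

end
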